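(* Let $N\ge 2$, let $K$ be the $N$-dimensional Sierpinski gasket, and let $\nu$ be the Kusuoka measure on $K$. Let $h\in\mathcal H$ be a nonconstant harmonic function with energy measure $\nu_h$. Then there exists a Borel subset $\hat K$ of $K$ such that $\nu(K\setminus\hat K)=0$ and every Borel $\nu$-version of the Radon--Nikodym derivative $\mathrm d\nu_h/\mathrm d\nu$ is discontinuous at every point of $\hat K$.
   Context: Let $N\ge 2$ be an integer and $S=\{1,2,\dots,N+1\}$. Let $V_0=\{p_1,\dots,p_{N+1}\}$ be the vertex set of a (nondegenerate) closed $N$-simplex in $\mathbb R^N$, and let $\psi_i(z)=(z+p_i)/2$ for $i\in S$. The $N$-dimensional Sierpinski gasket $K$ is the unique nonempty compact subset of $\mathbb R^N$ with $K=\bigcup_{i\in S}\psi_i(K)$; it carries the Euclidean metric. Let $W_m=S^m$ (words of length $m$; $W_0=\{\emptyset\}$), $W_*=\bigcup_{m\ge0}W_m$, $\psi_w=\psi_{w_1}\circ\cdots\circ\psi_{w_m}$ for $w=w_1\cdots w_m$ ($\psi_\emptyset=\mathrm{id}$). Energy form: for $f:V_0\to\mathbb R$ put $Q_0(f,f)=\frac12\sum_{i,j\in S}(f(p_i)-f(p_j))^2$. For $f\in C(K)$ the sequence $\left(\frac{N+3}{N+1}\right)^m\sum_{w\in W_m}Q_0(f\circ\psi_w|_{V_0},f\circ\psi_w|_{V_0})$ is nondecreasing in $m$; its limit is $\mathcal E(f,f)\in[0,\infty]$. Let $\mathcal F=\{f\in C(K)\mid\mathcal E(f,f)<\infty\}$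 (real-valued functions) and define $\mathcal E(f,g)$ for $f,g\in\mathcal F$ by polarization, $\mathcal E(f,g)=\frac12\{\mathcal E(f+g,f+g)-\mathcal E(f,f)-\mathcal E(g,g)\}$. Energy measure: for $f\in\mathcal F$, $\nu_f$ is the unique positive Borel measure on $K$ with $\int_K g\,\mathrm d\nu_f=2\mathcal E(f,fg)-\mathcal E(f^2,g)$ for every $g\in\mathcal F$. Harmonic functions: for every $u:V_0\to\mathbb R$ there is a unique $h\in\mathcal F$ with $h|_{V_0}=u$ and $\mathcal E(h,h)=\inf\{\mathcal E(f,f)\mid f\in\mathcal F,\ f|_{V_0}=u\}$; such $h$ is called harmonic, and $\mathcal H$ is the space of harmonic functions. For $k\in S$, $h_k\in\mathcal H$ is the harmonic function with $h_k(p_k)=1$ and $h_k(p_i)=0$ for $i\ne k$. Kusuoka measure: $\nu=\sum_{k\in S}\nu_{h_k}$. For every $f\in\mathcal F$, $\nu_f$ is absolutely continuous with respect to $\nu$. A Borel $\nu$-version of $\mathrm d\nu_h/\mathrm d\nu$ is a Borel function on $K$ that equals the Radon--Nikodym derivative $\nu$-a.e. *)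

theory Defs
  imports "HOL-Analysis.Analysis"
begin

text \<open>
  The vertices of the simplex are \<open>p 1, \<dots>, p (N + 1)\<close>; values of \<open>p\<close> at other indices
  are irrelevant.
\<close>

definition sg_letters :: "nat \<Rightarrow> nat set" where
  "sg_letters N = {1..N + 1}"

definition sg_nondegenerate :: "nat \<Rightarrow> (nat \<Rightarrow> 'a::euclidean_space) \<Rightarrow> bool" where
  "sg_nondegenerate N p \<longleftrightarrow>
     inj_on p (sg_letters N) \<and> \<not> affine_dependent (p ` sg_letters N)"

definition sg_map :: "(nat \<Rightarrow> 'a::euclidean_space) \<Rightarrow> nat \<Rightarrow> 'a \<Rightarrow> 'a" where
  "sg_map p i z = (1 / 2) *\<^sub>R (z + p i)"

definition sg_gasket :: "nat \<Rightarrow> (nat \<Rightarrow> 'a::euclidean_space) \<Rightarrow> 'a set" where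
  "sg_gasket N p =
     (THE K. compact K \<and> K \<noteq> {} \<and> K = (\<Union>i\<in>sg_letters N. sg_map p i ` K))"

definition sg_words :: "nat \<Rightarrow> nat \<Rightarrow> nat list set" where
  "sg_words N m = {w. set w \<subseteq> sg_letters N \<and> length w = m}"

primrec sg_word_map :: "(nat \<Rightarrow> 'a::euclidean_space) \<Rightarrow> nat list \<Rightarrow> 'a \<Rightarrow> 'a" where
  "sg_word_map p [] = id"
| "sg_word_map p (i # w) = sg_map p i \<circ> sg_word_map p w"

definition sg_Q0 :: "nat \<Rightarrow> (nat \<Rightarrow> 'a::euclidean_space) \<Rightarrow> ('a \<Rightarrow> real) \<Rightarrow> real" where
  "sg_Q0 N p f = (1 / 2) * (\<Sum>i\<in>sg_letters N. \<Sum>j\<in>sg_letters N. (f (p i) - f (p j))\<^sup>2)"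

definition sg_level_energy ::
    "nat \<Rightarrow> (nat \<Rightarrow> 'a::euclidean_space) \<Rightarrow> ('a \<Rightarrow> real) \<Rightarrow> nat \<Rightarrow> real" where
  "sg_level_energy N p f m =
     (real (N + 3) / real (N + 1)) ^ m * (\<Sum>w\<in>sg_words N m. sg_Q0 N p (f \<circ> sg_word_map p w))"

definition sg_energy ::
    "nat \<Rightarrow> (nat \<Rightarrow> 'a::euclidean_space) \<Rightarrow> ('a \<Rightarrow> real) \<Rightarrow> ennreal" where
  "sg_energy N p f = lim (\<lambda>m. ennreal (sg_level_energy N p f m))"

text \<open>
  A function on the gasket is represented by its extension by \<open>0\<close> to the whole space, so
  that equality of representatives is equality on the gasket, and pointwise sums and
  products of representatives are again representatives.
\<close>

definition sg_continuous :: "nat \<Rightarrow> (nat \<Rightarrow> 'a::euclidean_space) \<Rightarrow> ('a \<Rightarrow> real) set" where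
  "sg_continuous N p =
     {f. continuous_on (sg_gasket N p) f \<and> (\<forall>x. x \<notin> sg_gasket N p \<longrightarrow> f x = 0)}"

definition sg_domain :: "nat \<Rightarrow> (nat \<Rightarrow> 'a::euclidean_space) \<Rightarrow> ('a \<Rightarrow> real) set" where
  "sg_domain N p = {f \<in> sg_continuous N p. sg_energy N p f < \<infinity>}"

text \<open>The polarized form is only meaningful for arguments in \<^const>\<open>sg_domain\<close>.\<close>

definition sg_form ::
    "nat \<Rightarrow> (nat \<Rightarrow> 'a::euclidean_space) \<Rightarrow> ('a \<Rightarrow> real) \<Rightarrow> ('a \<Rightarrow> real) \<Rightarrow> real" where
  "sg_form N p f g =
     (1 / 2) * (enn2real (sg_energy N p (\<lambda>x. f x + g x))
                - enn2real (sg_energy N p f) - enn2real (sg_energy N p g))"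

definition sg_borel :: "nat \<Rightarrow> (nat \<Rightarrow> 'a::euclidean_space) \<Rightarrow> 'a measure" where
  "sg_borel N p = restrict_space borel (sg_gasket N p)"

text \<open>
  The use of \<^const>\<open>has_bochner_integral\<close> makes integrability of \<open>g\<close> part of the
  condition; the library's integral of a non-integrable function is \<open>0\<close>.
\<close>

definition sg_energy_measure ::
    "nat \<Rightarrow> (nat \<Rightarrow> 'a::euclidean_space) \<Rightarrow> ('a \<Rightarrow> real) \<Rightarrow> 'a measure" where
  "sg_energy_measure N p f =
     (THE \<mu>. sets \<mu> = sets (sg_borel N p) \<and>
        (\<forall>g\<in>sg_domain N p. has_bochner_integral \<mu> g
           (2 * sg_form N p f (\<lambda>x. f x * g x) - sg_form N p (\<lambda>x. (f x)\<^sup>2) g)))"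

definition sg_harmonic :: "nat \<Rightarrow> (nat \<Rightarrow> 'a::euclidean_space) \<Rightarrow> ('a \<Rightarrow> real) set" where
  "sg_harmonic N p =
     {h \<in> sg_domain N p. sg_energy N p h =
        (INF f\<in>{f \<in> sg_domain N p. \<forall>i\<in>sg_letters N. f (p i) = h (p i)}. sg_energy N p f)}"

definition sg_basis_harmonic ::
    "nat \<Rightarrow> (nat \<Rightarrow> 'a::euclidean_space) \<Rightarrow> nat \<Rightarrow> 'a \<Rightarrow> real" where
  "sg_basis_harmonic N p k =
     (THE h. h \<in> sg_harmonic N p \<and> (\<forall>i\<in>sg_letters N. h (p i) = (if i = k then 1 else 0)))"

definition sg_kusuoka :: "nat \<Rightarrow> (nat \<Rightarrow> 'a::euclidean_space) \<Rightarrow> 'a measure" where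
  "sg_kusuoka N p =
     measure_of (sg_gasket N p) (sets (sg_borel N p))
       (\<lambda>A. \<Sum>k\<in>sg_letters N. emeasure (sg_energy_measure N p (sg_basis_harmonic N p k)) A)"

text \<open>
  Borel versions are real-valued, and only their values on the gasket matter.
  The derivative is compared after \<^const>\<open>enn2real\<close>, since \<^const>\<open>ennreal\<close> would
  identify all negative values with \<open>0\<close>.
\<close>

definition sg_density_version ::
    "nat \<Rightarrow> (nat \<Rightarrow> 'a::euclidean_space) \<Rightarrow> ('a \<Rightarrow> real) \<Rightarrow> ('a \<Rightarrow> real) \<Rightarrow> bool" where
  "sg_density_version N p h \<phi> \<longleftrightarrow>
     \<phi> \<in> borel_measurable (sg_borel N p) \<and>
     (AE x in sg_kusuoka N p.
        \<phi> x = enn2real (RN_deriv (sg_kusuoka N p) (sg_energy_measure N p h) x))"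

end

theory Submission
  imports Defs
begin

text \<open>
  A harmonic function is determined by its values at the vertices of the simplex, and its values
  at the vertices of a smaller cell arise from these by applying products of \<open>N + 1\<close> fixed
  linear maps. Modulo constants the maps act on the \<^emph>\<open>balanced\<close> vectors (coordinate sum \<open>0\<close>), and there the
  map of letter \<open>i\<close> is \<open>1 / (N + 3)\<close> times \<open>T\<^sub>i = I + (N + 1) f\<^sub>i f\<^sub>i\<^sup>T\<close>, where \<open>f\<^sub>i\<close> is the
  centred \<open>i\<close>-th unit vector. With \<open>\<rho> = (N + 1) (N + 3)\<close>, \<open>x\<close> the centred boundary values of \<open>h\<close>
  and \<open>T\<^sub>w\<close> the product along the word \<open>w\<close>, the energy measure of the cell of \<open>w\<close> is
  \<open>2 (N + 1) \<rho> ^ (- |w|) |T\<^sub>w x|\<^sup>2\<close> (\<open>mass\<close>, \<open>energy_measure_eq\<close>), and the Kusuoka measure is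
  the sum of these expressions over \<open>x = f\<^sub>k\<close>. Everything about the density thus becomes a
  question about ratios \<open>|T\<^sub>w x|\<^sup>2 / (\<Sum>k. |T\<^sub>w f\<^sub>k|\<^sup>2)\<close>. Two facts about them give the theorem.

  First, the density has essential infimum \<open>0\<close> on every nonempty open subset of the gasket
  (\<open>no_lower_bound\<close>). Among three coordinates of a nonzero balanced vector two do not have
  opposite signs, say those at \<open>i\<close> and \<open>j\<close>. Applying \<open>T\<^sub>i\<close> or \<open>T\<^sub>j\<close>, always for the coordinate of
  smaller absolute value, preserves this, whereas the vector with entries \<open>1\<close> at \<open>i\<close> and \<open>-1\<close> at \<open>j\<close>, which
  has opposite signs there, keeps expanding. The ratio of the two tends to \<open>0\<close>
  (\<open>greedy_word\<close>, \<open>small_energy_ratio\<close>). Since every \<open>T\<^sub>w\<close> is invertible, this can be done inside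
  every cell. Hence a version of the density that is continuous at a point is at most \<open>0\<close> there.

  Second, the points near which the density is arbitrarily small form a null set for the Kusuoka
  measure \<open>\<nu>\<close> (\<open>vanishing_null\<close>). They are null for \<open>\<nu>\<^sub>h\<close> because \<open>\<nu>\<^sub>h \<le> \<epsilon> \<nu>\<close> on a neighbourhood of
  them for every \<open>\<epsilon> > 0\<close>, and a null set of one nonconstant harmonic function is a null set of all
  harmonic functions (\<open>nu_null_transfer\<close>): within two further letters \<open>\<langle>T\<^sub>v x, T\<^sub>v y\<rangle>\<close> becomes
  comparable to \<open>|x| |y|\<close> (\<open>ip_product_le\<close>), so in every cell the mutual energy measure is
  substantial; it vanishes on the null set, and Cauchy--Schwarz then forces \<open>\<nu>\<^sub>g\<close> to give a fixed
  fraction of every cell to the complement of the null set. The discontinuity points claimed in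
  the theorem are the complement of this exceptional set.

  To connect this with the definitions, the gasket is coded by infinite words, two of which give
  the same point only at the junction of two cells (\<open>pt_eqD\<close>). Functions on words that agree at
  junctions descend to the gasket; this yields harmonic functions and, level by level, piecewise
  harmonic interpolants, which have finite energy and are uniformly dense in the continuous
  functions. Density makes the energy measure unique; its existence follows by cutting
  an interval into nested strips whose lengths are the cell masses (\<open>cell_measure_exists\<close>).
\<close>

locale sierpinski_gasket =
  fixes N :: nat and p :: "nat \<Rightarrow> 'a::euclidean_space"
  assumes N_ge_2: "N \<ge> 2" and nondegenerate: "sg_nondegenerate N p"
begin

abbreviation S :: "nat set" where "S \<equiv> sg_letters N"

lemma finite_S [simp]: "finite S" and card_S [simp]: "card S = N + 1"
  by (auto simp: sg_letters_def)

lemma one_in_S [simp]: "Suc 0 \<in> S"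
  by (auto simp: sg_letters_def)

section \<open>Harmonic subdivision and balanced vectors\<close>

text \<open>
  The values at the vertices of cell \<open>i\<close> of the harmonic function with boundary values \<open>u\<close>: the
  point between the vertices \<open>i\<close> and \<open>j\<close> carries a weighted mean of \<open>u\<close> with weight \<open>2\<close> at \<open>i\<close> and
  \<open>j\<close> and weight \<open>1\<close> elsewhere.
\<close>

definition subdiv :: "nat \<Rightarrow> (nat \<Rightarrow> real) \<Rightarrow> nat \<Rightarrow> real" where
  "subdiv i u j = (if j = i then u i else (u i + u j + (\<Sum>k\<in>S. u k)) / (real N + 3))"

abbreviation subdivs :: "nat list \<Rightarrow> (nat \<Rightarrow> real) \<Rightarrow> nat \<Rightarrow> real" where
  "subdivs \<equiv> fold subdiv"

definition centre :: "(nat \<Rightarrow> real) \<Rightarrow> nat \<Rightarrow> real" where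
  "centre u i = u i - (\<Sum>k\<in>S. u k) / (real N + 1)"

text \<open>
  On balanced vectors this is \<open>I + (N + 1) f\<^sub>i f\<^sub>i\<^sup>T\<close>, which is \<open>N + 3\<close> times the map induced by
  \<open>subdiv i\<close> on vectors modulo constants (\<open>centre_subdiv\<close>). With this scaling no balanced vector
  becomes shorter (\<open>ip_expands_ge\<close>).
\<close>

definition expand :: "nat \<Rightarrow> (nat \<Rightarrow> real) \<Rightarrow> nat \<Rightarrow> real" where
  "expand i x j = (if j = i then (real N + 1) * x i else x j - x i)"

abbreviation expands :: "nat list \<Rightarrow> (nat \<Rightarrow> real) \<Rightarrow> nat \<Rightarrow> real" where
  "expands \<equiv> fold expand"

definition ip :: "(nat \<Rightarrow> real) \<Rightarrow> (nat \<Rightarrow> real) \<Rightarrow> real" where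
  "ip x y = (\<Sum>j\<in>S. x j * y j)"

definition balanced :: "(nat \<Rightarrow> real) \<Rightarrow> bool" where
  "balanced x \<longleftrightarrow> (\<Sum>j\<in>S. x j) = 0"

definition vertex_energy :: "(nat \<Rightarrow> real) \<Rightarrow> real" where
  "vertex_energy u = (1 / 2) * (\<Sum>i\<in>S. \<Sum>j\<in>S. (u i - u j)\<^sup>2)"

lemma ip_nonneg: "ip x x \<ge> 0"
  unfolding ip_def by (intro sum_nonneg) auto

lemma ip_eq_0D: "ip x x = 0 \<Longrightarrow> j \<in> S \<Longrightarrow> x j = 0"
  unfolding ip_def by (subst (asm) sum_nonneg_eq_0_iff) auto

lemma square_le_ip: "j \<in> S \<Longrightarrow> (x j)\<^sup>2 \<le> ip x x"
  unfolding ip_def power2_eq_square by (rule member_le_sum) auto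

lemma balanced_centre: "balanced (centre u)"
  unfolding balanced_def centre_def by (simp add: sum_subtractf add.commute)

lemma expands_cong:
  "(\<And>j. j \<in> S \<Longrightarrow> x j = y j) \<Longrightarrow> set w \<subseteq> S \<Longrightarrow> j \<in> S \<Longrightarrow> expands w x j = expands w y j"
proof (induction w arbitrary: x y)
  case (Cons i w)
  show ?case unfolding fold.simps comp_def
    by (rule Cons.IH) (use Cons.prems in \<open>auto simp: expand_def\<close>)
qed simp

lemma subdivs_cong:
  "(\<And>j. j \<in> S \<Longrightarrow> u j = v j) \<Longrightarrow> set w \<subseteq> S \<Longrightarrow> j \<in> S \<Longrightarrow> subdivs w u j = subdivs w v j"
proof (induction w arbitrary: u v)
  case (Cons i w)
  have "subdiv i u j = subdiv i v j" if "j \<in> S" for j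
    using Cons.prems that by (simp add: subdiv_def cong: sum.cong)
  then show ?case unfolding fold.simps comp_def
    using Cons.prems by (intro Cons.IH) auto
qed simp

lemma expands_linear:
  "expands w (\<lambda>j. a * x j + b * y j) = (\<lambda>j. a * expands w x j + b * expands w y j)"
proof (induction w arbitrary: x y)
  case (Cons i w)
  have "expand i (\<lambda>j. a * x j + b * y j) = (\<lambda>j. a * expand i x j + b * expand i y j)"
    by (auto simp: expand_def algebra_simps)
  then show ?case using Cons[of "expand i x" "expand i y"] by simp
qed simp

lemma expands_scale: "expands w (\<lambda>j. a * x j) = (\<lambda>j. a * expands w x j)"
  using expands_linear[of w a x 0 x] by simp

lemma sum_S_remove: "i \<in> S \<Longrightarrow> (\<Sum>j\<in>S. f j) = f i + (\<Sum>j\<in>S - {i}. f j :: real)"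
  by (rule sum.remove) auto

lemma balanced_expand: "balanced x \<Longrightarrow> i \<in> S \<Longrightarrow> balanced (expand i x)"
  unfolding balanced_def
  by (subst (asm) sum_S_remove[of i], assumption, subst sum_S_remove[of i])
     (auto simp: expand_def sum_subtractf algebra_simps)

lemma balanced_expands: "balanced x \<Longrightarrow> set w \<subseteq> S \<Longrightarrow> balanced (expands w x)"
  by (induction w arbitrary: x) (auto simp: balanced_expand)

text \<open>
  The operator \<open>expand i\<close> is symmetric on balanced vectors and its square differs from the
  identity by a multiple of the projection to \<open>f\<^sub>i\<close>.
\<close>

lemma ip_expand:
  assumes "balanced x" "balanced y" "i \<in> S"
  shows "ip (expand i x) (expand i y) = ip x y + (real N + 1) * (real N + 2) * (x i * y i)"
proof -
  have sx: "(\<Sum>j\<in>S - {i}. x j) = - x i" and sy: "(\<Sum>j\<in>S - {i}. y j) = - y i"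
    using assms sum_S_remove[of i x] sum_S_remove[of i y] by (auto simp: balanced_def)
  have "(\<Sum>j\<in>S - {i}. (x j - x i) * (y j - y i))
     = (\<Sum>j\<in>S - {i}. x j * y j) - y i * (\<Sum>j\<in>S - {i}. x j) - x i * (\<Sum>j\<in>S - {i}. y j)
       + N * (x i * y i)"
    using assms by (simp add: algebra_simps sum.distrib sum_subtractf sum_distrib_left)
  then show ?thesis
    unfolding ip_def using assms(3)
    by (subst (1 2) sum_S_remove[of i]) (auto simp: expand_def sx sy algebra_simps)
qed

text \<open>
  The maps \<open>f\<^sub>i f\<^sub>i\<^sup>T\<close> sum to the identity on balanced vectors. This is what makes the masses of cells additive.
\<close>

lemma sum_ip_expand:
  assumes "balanced x"
  shows "(\<Sum>i\<in>S. ip (expand i x) (expand i x)) = (real N + 1) * (real N + 3) * ip x x"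
proof -
  have "(\<Sum>i\<in>S. ip (expand i x) (expand i x))
      = (\<Sum>i\<in>S. ip x x + (real N + 1) * (real N + 2) * (x i * x i))"
    using assms by (intro sum.cong) (auto simp: ip_expand)
  also have "\<dots> = (real N + 1) * ip x x + (real N + 1) * (real N + 2) * ip x x"
    by (simp add: sum.distrib ip_def sum_distrib_left add.commute[of 1])
  finally show ?thesis by (simp add: algebra_simps)
qed

text \<open>
  The constant is smaller than \<open>(N + 1) (N + 3)\<close>, so that masses of cells decay geometrically with
  the level and points carry no mass.
\<close>

lemma ip_expand_le:
  assumes "balanced x" "i \<in> S"
  shows "ip (expand i x) (expand i x) \<le> ((real N)\<^sup>2 + 3 * real N + 3) * ip x x"
proof -
  have "(real N + 1) * (real N + 2) * (x i * x i) \<le> (real N + 1) * (real N + 2) * ip x x"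
    using square_le_ip[OF assms(2), of x] by (intro mult_left_mono) (auto simp: power2_eq_square)
  then show ?thesis
    by (simp add: ip_expand assms power2_eq_square algebra_simps)
qed

lemma ip_expands_ge:
  assumes "balanced x" "set w \<subseteq> S"
  shows "ip x x \<le> ip (expands w x) (expands w x)"
  using assms
proof (induction w arbitrary: x)
  case (Cons i w)
  have "ip x x \<le> ip (expand i x) (expand i x)"
    using Cons.prems by (simp add: ip_expand)
  also have "\<dots> \<le> ip (expands (i # w) x) (expands (i # w) x)"
    using Cons by (simp add: balanced_expand)
  finally show ?case .
qed simp

text \<open>
  The inverse of \<open>expand i\<close>.
\<close>

definition contract :: "nat \<Rightarrow> (nat \<Rightarrow> real) \<Rightarrow> nat \<Rightarrow> real" where
  "contract i y j = (if j = i then y i / (real N + 1) else y j + y i / (real N + 1))"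

lemma expands_surj:
  assumes "balanced y" "set w \<subseteq> S"
  shows "\<exists>x. balanced x \<and> expands w x = y"
  using assms
proof (induction w arbitrary: y rule: rev_induct)
  case (snoc i w)
  have inv: "expand i (contract i y) = y"
    by (auto simp: expand_def contract_def fun_eq_iff)
  have i: "i \<in> S" using snoc.prems by auto
  have "(\<Sum>j\<in>S - {i}. y j) = - y i"
    using snoc.prems sum_S_remove[OF i, of y] by (simp add: balanced_def)
  then have "(\<Sum>j\<in>S. contract i y j) = y i / (real N + 1) + (- y i + real N * (y i / (real N + 1)))"
    using i by (simp add: sum_S_remove contract_def sum.distrib)
  then have "balanced (contract i y)"
    by (simp add: balanced_def field_simps)
  then obtain x where "balanced x" "expands w x = contract i y"
    using snoc by auto
  with inv show ?case by (auto intro!: exI[of _ x])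
qed auto

lemma centre_subdiv:
  assumes "i \<in> S" "j \<in> S"
  shows "centre (subdiv i u) j = expand i (centre u) j / (real N + 3)"
proof -
  define s where "s = (\<Sum>k\<in>S. u k)"
  have s: "(\<Sum>k\<in>S - {i}. u k) = s - u i"
    using sum_S_remove[OF assms(1), of u] by (simp add: s_def)
  have "(\<Sum>k\<in>S. subdiv i u k) = u i + (\<Sum>k\<in>S - {i}. (u i + u k + s) / (real N + 3))"
    by (subst sum_S_remove[OF assms(1)]) (auto simp: subdiv_def s_def)
  also have "(\<Sum>k\<in>S - {i}. (u i + u k + s) / (real N + 3)) = (N * u i + (s - u i) + N * s) / (real N + 3)"
    using assms(1) by (simp add: sum_divide_distrib[symmetric] sum.distrib s)
  finally have t: "(\<Sum>k\<in>S. subdiv i u k) = u i + (N * u i + (s - u i) + N * s) / (real N + 3)" .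
  have "real N + 3 > 0" "real N + 1 > 0" by auto
  then show ?thesis
    unfolding centre_def t expand_def subdiv_def s_def[symmetric]
    by (auto simp: divide_simps) (simp_all add: algebra_simps)
qed

lemma centre_subdivs:
  assumes "set w \<subseteq> S" "j \<in> S"
  shows "centre (subdivs w u) j = expands w (centre u) j / (real N + 3) ^ length w"
  using assms
proof (induction w arbitrary: u)
  case (Cons i w)
  have "centre (subdivs (i # w) u) j = expands w (centre (subdiv i u)) j / (real N + 3) ^ length w"
    using Cons by simp
  also have "expands w (centre (subdiv i u)) j
           = expands w (\<lambda>j. (1 / (real N + 3)) * expand i (centre u) j) j"
    using Cons.prems by (intro expands_cong) (auto simp: centre_subdiv)
  also have "\<dots> = (1 / (real N + 3)) * expands (i # w) (centre u) j"
    by (subst expands_scale) simp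
  finally show ?case by simp
qed simp

lemma vertex_energy_centre: "vertex_energy u = (real N + 1) * ip (centre u) (centre u)"
proof -
  define x where "x = centre u"
  have b: "(\<Sum>j\<in>S. x j) = 0" using balanced_centre by (simp add: balanced_def x_def)
  have "vertex_energy u = (1/2) * (\<Sum>i\<in>S. \<Sum>j\<in>S. (x i * x i + x j * x j) - 2 * (x i * x j))"
    unfolding vertex_energy_def
    by (intro arg_cong[of _ _ "\<lambda>x. (1/2) * x"] sum.cong refl)
       (auto simp: x_def centre_def power2_eq_square algebra_simps)
  also have "\<dots> = (1/2) * (2 * ((real N + 1) * ip x x) - 2 * (\<Sum>i\<in>S. x i * (\<Sum>j\<in>S. x j)))"
    by (simp add: sum.distrib sum_subtractf sum_distrib_left ip_def algebra_simps)
  finally show ?thesis using b by (simp add: x_def)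
qed

text \<open>
  Orthogonality of the harmonic subdivision and its error: the mixed terms cancel because the
  Laplacian of the harmonic values at the point between \<open>i\<close> and \<open>j\<close> has opposite values in the
  two cells that meet there, while the error is the same in both.
\<close>

lemma subdivision_energy:
  assumes sym: "\<And>i j. i \<in> S \<Longrightarrow> j \<in> S \<Longrightarrow> m i j = m j i"
  shows "(\<Sum>i\<in>S. vertex_energy (m i)) =
     (real N + 1) / (real N + 3) * vertex_energy (\<lambda>i. m i i)
      + (\<Sum>i\<in>S. vertex_energy (\<lambda>j. m i j - subdiv i (\<lambda>i. m i i) j))"
proof -
  define u where "u = (\<lambda>i. m i i)"
  define e where "e = (\<lambda>i j. m i j - subdiv i u j)"
  have m: "m i j = subdiv i u j + e i j" for i j by (simp add: e_def)
  have esym: "e i j = e j i" if "i \<in> S" "j \<in> S" for i j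
    using sym[OF that] by (auto simp: e_def subdiv_def)
  have eii: "e i i = 0" for i by (simp add: e_def subdiv_def u_def)
  have lap: "(\<Sum>k\<in>S. subdiv i u j - subdiv i u k) = (real N + 1) * (u j - u i) / (real N + 3)"
    if "i \<in> S" "j \<in> S" "j \<noteq> i" for i j
  proof -
    have "(\<Sum>k\<in>S. subdiv i u j - subdiv i u k) = (real N + 1) * centre (subdiv i u) j"
      by (simp add: centre_def sum_subtractf) (simp add: field_simps)
    also have "\<dots> = (real N + 1) * (u j - u i) / (real N + 3)"
      unfolding centre_subdiv[OF that(1,2)] using that(3) by (simp add: expand_def centre_def)
    finally show ?thesis .
  qed
  have cross: "(\<Sum>i\<in>S. \<Sum>j\<in>S. \<Sum>k\<in>S. (subdiv i u j - subdiv i u k) * (e i j - e i k)) = 0"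
  proof -
    have "(\<Sum>j\<in>S. \<Sum>k\<in>S. (subdiv i u j - subdiv i u k) * (e i j - e i k))
        = (\<Sum>j\<in>S. 2 * (e i j * ((real N + 1) * (u j - u i) / (real N + 3))))" if "i \<in> S" for i
    proof -
      have "(\<Sum>j\<in>S. \<Sum>k\<in>S. (subdiv i u j - subdiv i u k) * (e i j - e i k))
         = (\<Sum>j\<in>S. \<Sum>k\<in>S. (subdiv i u j - subdiv i u k) * e i j)
          + (\<Sum>j\<in>S. \<Sum>k\<in>S. (subdiv i u k - subdiv i u j) * e i k)"
        by (simp add: sum.distrib[symmetric] algebra_simps)
      also have "(\<Sum>j\<in>S. \<Sum>k\<in>S. (subdiv i u k - subdiv i u j) * e i k)
          = (\<Sum>j\<in>S. \<Sum>k\<in>S. (subdiv i u j - subdiv i u k) * e i j)"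
        by (rule sum.swap)
      also have "(\<Sum>j\<in>S. \<Sum>k\<in>S. (subdiv i u j - subdiv i u k) * e i j)
          = (\<Sum>j\<in>S. e i j * (\<Sum>k\<in>S. subdiv i u j - subdiv i u k))"
        by (simp add: sum_distrib_left mult.commute)
      also have "\<dots> = (\<Sum>j\<in>S. e i j * ((real N + 1) * (u j - u i) / (real N + 3)))"
        using that by (intro sum.cong refl) (metis eii lap mult_zero_left)
      finally show ?thesis by (simp add: sum_distrib_left)
    qed
    then have "(\<Sum>i\<in>S. \<Sum>j\<in>S. \<Sum>k\<in>S. (subdiv i u j - subdiv i u k) * (e i j - e i k))
        = (\<Sum>i\<in>S. \<Sum>j\<in>S. 2 * (e i j * ((real N + 1) * (u j - u i) / (real N + 3))))" (is "_ = ?A")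
      by (rule sum.cong[OF refl])
    moreover have "?A = - ?A"
    proof -
      have "?A = (\<Sum>j\<in>S. \<Sum>i\<in>S. 2 * (e i j * ((real N + 1) * (u j - u i) / (real N + 3))))"
        by (rule sum.swap)
      also have "\<dots> = (\<Sum>j\<in>S. \<Sum>i\<in>S. - (2 * (e j i * ((real N + 1) * (u i - u j) / (real N + 3)))))"
        by (intro sum.cong refl) (simp add: esym field_simps)
      finally show ?thesis by (simp add: sum_negf)
    qed
    ultimately show ?thesis by simp
  qed
  have "(\<Sum>i\<in>S. vertex_energy (m i)) =
      (\<Sum>i\<in>S. vertex_energy (subdiv i u)
        + (\<Sum>j\<in>S. \<Sum>k\<in>S. (subdiv i u j - subdiv i u k) * (e i j - e i k)) + vertex_energy (e i))"
    unfolding vertex_energy_def m sum_distrib_left sum.distrib[symmetric]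
    by (intro sum.cong refl) (simp add: power2_eq_square field_simps)
  also have "\<dots> = (\<Sum>i\<in>S. vertex_energy (subdiv i u)) + (\<Sum>i\<in>S. vertex_energy (e i))"
    by (simp add: sum.distrib cross)
  also have "(\<Sum>i\<in>S. vertex_energy (subdiv i u)) = (real N + 1) / (real N + 3) * vertex_energy u"
  proof -
    have "(\<Sum>i\<in>S. vertex_energy (subdiv i u))
        = (\<Sum>i\<in>S. (real N + 1) / (real N + 3)\<^sup>2 * ip (expand i (centre u)) (expand i (centre u)))"
      unfolding vertex_energy_centre ip_def sum_distrib_left
      by (intro sum.cong refl) (simp add: centre_subdiv power2_eq_square)
    also have "\<dots> = (real N + 1) / (real N + 3)\<^sup>2 * ((real N + 1) * (real N + 3) * ip (centre u) (centre u))"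
      unfolding sum_distrib_left[symmetric] sum_ip_expand[OF balanced_centre] ..
    finally show ?thesis by (simp add: vertex_energy_centre power2_eq_square)
  qed
  finally show ?thesis by (simp add: e_def u_def)
qed

section \<open>Masses of cells and products of expansions\<close>

abbreviation rho :: real where "rho \<equiv> (real N + 1) * (real N + 3)"

text \<open>
  The energy measure, on the cell of \<open>w\<close>, of a harmonic function with centred boundary values \<open>x\<close>.
\<close>

definition mass :: "(nat \<Rightarrow> real) \<Rightarrow> nat list \<Rightarrow> real" where
  "mass x w = 2 * (real N + 1) / rho ^ length w * ip (expands w x) (expands w x)"

lemma rho_pos: "rho > 0"
  by (intro mult_pos_pos) auto

lemma mass_nonneg: "mass x w \<ge> 0"
  unfolding mass_def using rho_pos by (intro mult_nonneg_nonneg divide_nonneg_nonneg) (auto simp: ip_nonneg)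

lemma mass_append:
  assumes "balanced x" "set w \<subseteq> S"
  shows "(\<Sum>i\<in>S. mass x (w @ [i])) = mass x w"
proof -
  have "(\<Sum>i\<in>S. mass x (w @ [i]))
      = 2 * (real N + 1) / rho ^ Suc (length w) * (\<Sum>i\<in>S. ip (expand i (expands w x)) (expand i (expands w x)))"
    by (simp add: mass_def sum_distrib_left)
  also have "\<dots> = mass x w"
    using rho_pos unfolding sum_ip_expand[OF balanced_expands[OF assms]] by (simp add: mass_def)
  finally show ?thesis .
qed

definition decay :: real where "decay = ((real N)\<^sup>2 + 3 * real N + 3) / rho"

lemma decay: "0 \<le> decay" "decay < 1"
proof -
  have "(real N)\<^sup>2 + 3 * real N + 3 < rho"
    using N_ge_2 by (simp add: power2_eq_square algebra_simps)
  then show "0 \<le> decay" "decay < 1"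
    using rho_pos by (auto simp: decay_def)
qed

lemma mass_le:
  assumes "balanced x" "set w \<subseteq> S"
  shows "mass x w \<le> 2 * (real N + 1) * ip x x * decay ^ length w"
  using assms(2)
proof (induction w rule: rev_induct)
  case (snoc i w)
  have "mass x (w @ [i]) = 2 * (real N + 1) / rho ^ Suc (length w) * ip (expand i (expands w x)) (expand i (expands w x))"
    by (simp add: mass_def)
  also have "\<dots> \<le> 2 * (real N + 1) / rho ^ Suc (length w) * (((real N)\<^sup>2 + 3 * real N + 3) * ip (expands w x) (expands w x))"
    using rho_pos snoc.prems assms(1)
    by (intro mult_left_mono ip_expand_le balanced_expands divide_nonneg_nonneg) auto
  also have "\<dots> = decay * mass x w"
    using rho_pos by (simp add: mass_def decay_def)
  also have "\<dots> \<le> decay * (2 * (real N + 1) * ip x x * decay ^ length w)"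
    using snoc decay by (intro mult_left_mono) auto
  finally show ?case by (simp add: algebra_simps)
qed (simp add: mass_def)

lemma ip_combination:
  "ip (\<lambda>j. x j + c * y j) (\<lambda>j. x j + c * y j) = ip x x + 2 * c * ip x y + c\<^sup>2 * ip y y"
  by (simp add: ip_def sum_distrib_left sum.distrib[symmetric] power2_eq_square algebra_simps)

lemma mass_combination:
  "mass (\<lambda>j. x j + c * y j) w = 2 * (real N + 1) / rho ^ length w *
     (ip (expands w x) (expands w x) + 2 * c * ip (expands w x) (expands w y)
       + c\<^sup>2 * ip (expands w y) (expands w y))"
  unfolding mass_def using expands_linear[of w 1 x c y] by (simp add: ip_combination)

text \<open>
  A quadratic form satisfies \<open>q(x + t y) = q(x) + t\<^sup>2 q(y) + (t / 2) (q(x + y) - q(x - y))\<close>. With the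
  negative term moved to the left, both sides are masses of positive measures, so that the
  identity extends from cells to Borel sets without signed measures.
\<close>

lemma mass_pencil:
  "mass (\<lambda>j. x j + t * y j) w + t / 2 * mass (\<lambda>j. x j + (-1) * y j) w
   = mass x w + t\<^sup>2 * mass y w + t / 2 * mass (\<lambda>j. x j + 1 * y j) w"
  unfolding mass_combination mass_def
  by (simp add: algebra_simps add_divide_distrib diff_divide_distrib)

lemma mass_polar:
  "mass (\<lambda>j. x j + 1 * y j) w - mass (\<lambda>j. x j + (-1) * y j) w
   = 8 * (real N + 1) / rho ^ length w * ip (expands w x) (expands w y)"
  unfolding mass_combination
  by (simp add: algebra_simps add_divide_distrib diff_divide_distrib)

lemma mass_scale: "mass (\<lambda>j. a * x j) w = a\<^sup>2 * mass x w"
  by (simp add: mass_def expands_scale ip_def sum_distrib_left power2_eq_square algebra_simps)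

text \<open>
  Otherwise all the inner products for words of length at most \<open>2\<close> are small. By \<open>ip_expand\<close> this
  makes \<open>x\<^sub>i y\<^sub>i\<close> small for all \<open>i\<close> and \<open>(x\<^sub>i - x\<^sub>j) (y\<^sub>i - y\<^sub>j)\<close> small for all \<open>i\<close> and \<open>j\<close>, hence
  \<open>x\<^sub>i y\<^sub>j + x\<^sub>j y\<^sub>i\<close> and finally every single product \<open>x\<^sub>i y\<^sub>j\<close>.
\<close>

lemma ip_product_le:
  assumes "balanced x" "balanced y"
  shows "\<exists>v. set v \<subseteq> S \<and> length v \<le> 2 \<and>
     ip x x * ip y y \<le> (4 * (real N + 1))\<^sup>2 * (ip (expands v x) (expands v y))\<^sup>2"
proof -
  define V where "V = {v. set v \<subseteq> S \<and> length v \<le> 2}"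
  define F where "F = (\<lambda>v. \<bar>ip (expands v x) (expands v y)\<bar>)"
  have fin: "finite V" unfolding V_def by (rule finite_lists_length_le) simp
  have ne: "V \<noteq> {}" unfolding V_def by (auto intro: exI[of _ "[]"])
  define \<kappa> where "\<kappa> = Max (F ` V)"
  have "\<kappa> \<in> F ` V" unfolding \<kappa>_def using fin ne by (intro Max_in) auto
  then obtain v where v: "v \<in> V" "\<kappa> = F v" by auto
  have le: "F w \<le> \<kappa>" if "w \<in> V" for w
    unfolding \<kappa>_def using that fin by (intro Max_ge) auto
  have c: "(real N + 1) * (real N + 2) \<ge> 2" using N_ge_2
    by (simp add: algebra_simps)
  have step: "\<bar>z\<bar> \<le> \<kappa>" if "\<bar>b\<bar> \<le> \<kappa>" "\<bar>b + (real N + 1) * (real N + 2) * z\<bar> \<le> \<kappa>" for b z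
  proof -
    have "2 * \<bar>z\<bar> \<le> (real N + 1) * (real N + 2) * \<bar>z\<bar>"
      using c by (intro mult_right_mono) auto
    also have "\<dots> = \<bar>(real N + 1) * (real N + 2) * z\<bar>"
      by (simp add: abs_mult)
    also have "\<dots> \<le> 2 * \<kappa>" using that by linarith
    finally show ?thesis by simp
  qed
  have one: "\<bar>x i * y i\<bar> \<le> \<kappa>" if "i \<in> S" for i
    using le[of "[]"] le[of "[i]"] that step[of "ip x y" "x i * y i"] assms
    by (simp add: V_def F_def ip_expand)
  have two: "\<bar>(x i - x j) * (y i - y j)\<bar> \<le> \<kappa>" if "i \<in> S" "j \<in> S" for i j
  proof (cases "i = j")
    case False
    then show ?thesis
      using le[of "[j]"] le[of "[j, i]"] that assms
        step[of "ip (expand j x) (expand j y)" "(x i - x j) * (y i - y j)"]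
      by (simp add: V_def F_def ip_expand[of "expand j x"] balanced_expand)
         (simp add: expand_def)
  qed (use le[of "[]"] in \<open>simp add: F_def V_def\<close>)
  have prod: "(x i * y j)\<^sup>2 \<le> (4 * \<kappa>)\<^sup>2" if "i \<in> S" "j \<in> S" for i j
  proof -
    define a where "a = \<bar>x i * y j\<bar>"
    have "x i * y j + x j * y i = x i * y i + x j * y j - (x i - x j) * (y i - y j)"
      by (simp add: algebra_simps)
    then have m: "\<bar>x i * y j + x j * y i\<bar> \<le> 3 * \<kappa>"
      using one[OF that(1)] one[OF that(2)] two[OF that] by linarith
    have "a * a = (x i * y j) * (x i * y j + x j * y i) - (x i * y i) * (x j * y j)"
      by (simp add: a_def algebra_simps flip: abs_mult)
    also have "\<dots> \<le> \<bar>(x i * y j) * (x i * y j + x j * y i)\<bar> + \<bar>(x i * y i) * (x j * y j)\<bar>"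
      by linarith
    also have "\<dots> \<le> a * (3 * \<kappa>) + \<kappa> * \<kappa>"
      unfolding abs_mult[of "x i * y j" "x i * y j + x j * y i"] abs_mult[of "x i * y i" "x j * y j"]
      using one[OF that(1)] one[OF that(2)] m
      by (intro add_mono mult_mono) (auto simp: a_def)
    finally have q: "a * a \<le> 3 * \<kappa> * a + \<kappa> * \<kappa>" by (simp add: algebra_simps)
    have "\<kappa> \<ge> 0" using one[OF that(1)] by linarith
    have "a \<le> 4 * \<kappa>"
    proof (cases "a \<le> \<kappa>")
      case False
      then have "\<kappa> * \<kappa> \<le> \<kappa> * a" using \<open>\<kappa> \<ge> 0\<close> by (intro mult_left_mono) auto
      then have "a * a \<le> (4 * \<kappa>) * a" using q by linarith
      then show ?thesis using False \<open>\<kappa> \<ge> 0\<close> by (simp only: mult_le_cancel_right)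
    qed (use \<open>\<kappa> \<ge> 0\<close> in linarith)
    then have "\<bar>x i * y j\<bar> \<le> \<bar>4 * \<kappa>\<bar>" using \<open>\<kappa> \<ge> 0\<close> by (simp add: a_def)
    then show ?thesis by (simp only: abs_le_square_iff)
  qed
  have "ip x x * ip y y = (\<Sum>i\<in>S. \<Sum>j\<in>S. (x i * y j)\<^sup>2)"
    by (simp add: ip_def sum_product power2_eq_square algebra_simps)
  also have "\<dots> \<le> (\<Sum>i\<in>S. \<Sum>j\<in>S. (4 * \<kappa>)\<^sup>2)"
    by (intro sum_mono prod)
  also have "\<dots> = (4 * (real N + 1))\<^sup>2 * (ip (expands v x) (expands v y))\<^sup>2"
    by (simp add: v F_def power2_eq_square algebra_simps)
  finally show ?thesis using v by (auto simp: V_def)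
qed

text \<open>
  Repeating one letter makes the square of the coordinate at that letter dominate the norm, unless
  that coordinate is \<open>0\<close>.
\<close>

lemma expands_replicate_ip:
  assumes "balanced x" "i \<in> S"
  shows "ip (expands (replicate m i) x) (expands (replicate m i) x)
       = ip x x + (\<Sum>l<m. (real N + 1) * (real N + 2) * ((real N + 1) ^ l)\<^sup>2) * (x i)\<^sup>2"
proof -
  have at: "expands (replicate m i) x i = (real N + 1) ^ m * x i" for m x
    by (induction m arbitrary: x) (auto simp: expand_def)
  have b: "balanced (expands (replicate m i) x)" for m
    using assms by (intro balanced_expands) auto
  show ?thesis
  proof (induction m)
    case (Suc m)
    have e: "expands (replicate (Suc m) i) x = expand i (expands (replicate m i) x)"
      by (simp add: replicate_append_same[symmetric])
    show ?case
      unfolding e ip_expand[OF b b assms(2)] Suc at sum.lessThan_Suc distrib_right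
      by (simp add: power2_eq_square)
  qed simp
qed

lemma expand_same: "expand i x i = (real N + 1) * x i"
  and expand_other: "j \<noteq> i \<Longrightarrow> expand i x j = x j - x i"
  by (simp_all add: expand_def)

text \<open>
  Write \<open>X, Y\<close> for the coordinates of the image of \<open>x\<close> at \<open>i\<close> and \<open>j\<close>, and \<open>P, -Q\<close> for those of the
  image of \<open>y\<close>. Letter \<open>i\<close> maps \<open>(X, Y)\<close> to \<open>((N + 1) X, Y - X)\<close> and \<open>(P, Q)\<close> to
  \<open>((N + 1) P, P + Q)\<close>; it is chosen when \<open>X \<le> Y\<close>, and letter \<open>j\<close> otherwise. The sum
  \<open>X / P + Y / Q\<close> is a determinant divided by \<open>P Q\<close>: the determinant grows by the factor \<open>N + 1\<close>
  in each step, so the sum is multiplied by \<open>Q / (P + Q)\<close> or \<open>P / (P + Q)\<close>. As \<open>P / Q\<close> stays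
  between \<open>1 / (N + 1)\<close> and \<open>N + 1\<close>, these factors are at most \<open>(N + 1) / (N + 2)\<close>.
\<close>

lemma greedy_word:
  assumes ij: "i \<in> S" "j \<in> S" "i \<noteq> j" and a: "x i \<ge> 0" "x j \<ge> 0"
    and b: "y i = 1" "y j = - 1"
  shows "\<exists>v. set v \<subseteq> S \<and> expands v x i \<ge> 0 \<and> expands v x j \<ge> 0
    \<and> expands v y i > 0 \<and> expands v y j < 0
    \<and> - expands v y j \<le> (real N + 1) * expands v y i
    \<and> expands v y i \<le> (real N + 1) * - expands v y j
    \<and> expands v x i / expands v y i + expands v x j / - expands v y j
       \<le> (x i + x j) * ((real N + 1) / (real N + 2)) ^ m"
proof (induction m)
  case 0
  show ?case using assms by (intro exI[of _ "[]"]) auto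
next
  case (Suc m)
  define \<theta> where "\<theta> = (real N + 1) / (real N + 2)"
  define n where "n = real N"
  have n: "n \<ge> 2" using N_ge_2 by (simp add: n_def)
  obtain v where v: "set v \<subseteq> S" and nn: "expands v x i \<ge> 0" "expands v x j \<ge> 0"
    and pos: "expands v y i > 0" "expands v y j < 0"
    and r: "- expands v y j \<le> (real N + 1) * expands v y i"
     "expands v y i \<le> (real N + 1) * - expands v y j"
    and le: "expands v x i / expands v y i + expands v x j / - expands v y j \<le> (x i + x j) * \<theta> ^ m"
    using Suc unfolding \<theta>_def by blast
  define X Y P Q where "X = expands v x i" and "Y = expands v x j"
    and "P = expands v y i" and "Q = - expands v y j"
  note defs = X_def Y_def P_def Q_def
  have *: "X \<ge> 0" "Y \<ge> 0" "P > 0" "Q > 0" "Q \<le> (n + 1) * P" "P \<le> (n + 1) * Q"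
    "X / P + Y / Q \<le> (x i + x j) * \<theta> ^ m"
    using nn pos r le by (auto simp: defs n_def)
  have Qj: "expands v y j = - Q" by (simp add: Q_def)
  have \<theta>: "\<theta> \<ge> 0" by (simp add: \<theta>_def)
  have e: "X / P + Y / Q \<ge> 0" using * by simp
  have nn: "1 \<le> n * (n + 1)" using n mult_mono[of 1 n 1 "n + 1"] by simp
  have share: "Q / (P + Q) \<le> \<theta>" "P / (P + Q) \<le> \<theta>"
  proof -
    have "\<theta> = (n + 1) / (n + 2)" by (simp add: \<theta>_def n_def)
    moreover have "Q * (n + 2) \<le> (n + 1) * (P + Q)" "P * (n + 2) \<le> (n + 1) * (P + Q)"
      using *(5,6) by (simp_all add: algebra_simps)
    ultimately show "Q / (P + Q) \<le> \<theta>" "P / (P + Q) \<le> \<theta>"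
      using *(3,4) n by (simp_all add: frac_le_eq divide_le_eq pos_le_divide_eq mult.commute)
  qed
  show ?case
  proof (cases "X \<le> Y")
    case True
    have "(n + 1) * X / ((n + 1) * P) + (Y - X) / (P + Q) = X / P + (Y - X) / (P + Q)"
      using n by simp
    also have "\<dots> = (X / P + Y / Q) * (Q / (P + Q))"
      using *(3,4) by (simp add: divide_simps) (simp add: algebra_simps)
    also have "\<dots> \<le> (X / P + Y / Q) * \<theta>"
      by (rule mult_left_mono[OF share(1) e])
    also have "\<dots> \<le> (x i + x j) * \<theta> ^ Suc m"
      using mult_right_mono[OF *(7) \<theta>] by (simp only: power_Suc2 mult.assoc)
    finally have fin: "(n + 1) * X / ((n + 1) * P) + (Y - X) / (P + Q) \<le> (x i + x j) * \<theta> ^ Suc m" .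
    have s: "P + Q \<le> (n + 1) * ((n + 1) * P)" "(n + 1) * P \<le> (n + 1) * (P + Q)"
    proof -
      have "1 * P \<le> (n * (n + 1)) * P"
        using nn *(3,4) by (intro mult_right_mono) auto
      then show "P + Q \<le> (n + 1) * ((n + 1) * P)"
        using *(5,6) by (simp add: algebra_simps)
      show "(n + 1) * P \<le> (n + 1) * (P + Q)" using * n by simp
    qed
    have e': "expands (v @ [i]) x i = (n + 1) * X" "expands (v @ [i]) x j = Y - X"
      "expands (v @ [i]) y i = (n + 1) * P" "expands (v @ [i]) y j = - (P + Q)"
      using ij(3) by (simp_all add: expand_same expand_other defs n_def)
    have "set (v @ [i]) \<subseteq> S" using v ij by simp
    moreover have "0 < (n + 1) * P" "0 < (n + 1) * Q" "0 \<le> (n + 1) * X" "0 \<le> (n + 1) * Y"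
      using * n by simp_all
    ultimately show ?thesis
      using True *(1-4) fin s
      by (intro exI[of _ "v @ [i]"], unfold e' minus_minus \<theta>_def[symmetric], unfold n_def[symmetric]) auto
  next
    case False
    have "(X - Y) / (P + Q) + (n + 1) * Y / ((n + 1) * Q) = (X - Y) / (P + Q) + Y / Q"
      using n by simp
    also have "\<dots> = (X / P + Y / Q) * (P / (P + Q))"
      using *(3,4) by (simp add: divide_simps) (simp add: algebra_simps)
    also have "\<dots> \<le> (X / P + Y / Q) * \<theta>"
      by (rule mult_left_mono[OF share(2) e])
    also have "\<dots> \<le> (x i + x j) * \<theta> ^ Suc m"
      using mult_right_mono[OF *(7) \<theta>] by (simp only: power_Suc2 mult.assoc)
    finally have fin: "(X - Y) / (P + Q) + (n + 1) * Y / ((n + 1) * Q) \<le> (x i + x j) * \<theta> ^ Suc m" .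
    have s: "P + Q \<le> (n + 1) * ((n + 1) * Q)" "(n + 1) * Q \<le> (n + 1) * (P + Q)"
    proof -
      have "1 * Q \<le> (n * (n + 1)) * Q"
        using nn *(3,4) by (intro mult_right_mono) auto
      then show "P + Q \<le> (n + 1) * ((n + 1) * Q)"
        using *(5,6) by (simp add: algebra_simps)
      show "(n + 1) * Q \<le> (n + 1) * (P + Q)" using * n by simp
    qed
    have e': "expands (v @ [j]) x i = X - Y" "expands (v @ [j]) x j = (n + 1) * Y"
      "expands (v @ [j]) y i = P + Q" "expands (v @ [j]) y j = - ((n + 1) * Q)"
      using ij(3) by (simp_all add: expand_same expand_other defs n_def)
    have "set (v @ [j]) \<subseteq> S" using v ij by simp
    moreover have "0 < (n + 1) * P" "0 < (n + 1) * Q" "0 \<le> (n + 1) * X" "0 \<le> (n + 1) * Y"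
      using * n by simp_all
    ultimately show ?thesis
      using False *(1-4) fin s
      by (intro exI[of _ "v @ [j]"], unfold e' minus_minus \<theta>_def[symmetric], unfold n_def[symmetric]) auto
  qed
qed

lemma exists_sign_pair: "\<exists>i\<in>S. \<exists>j\<in>S. i \<noteq> j \<and> 0 \<le> x i * (x j :: real)"
proof -
  have "1 \<in> S" "2 \<in> S" "3 \<in> S" using N_ge_2 by (auto simp: sg_letters_def)
  moreover have "0 \<le> x 1 * x 2 \<or> 0 \<le> x 1 * x 3 \<or> 0 \<le> x 2 * x (3::nat)"
    by (auto simp: zero_le_mult_iff)
  ultimately show ?thesis
    by (metis numeral_eq_iff one_eq_numeral_iff semiring_norm(85,86,89))
qed

text \<open>
  The greedy word makes one coordinate of \<open>x\<close> small compared with that of \<open>y\<close>; repeating its letter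
  afterwards turns the ratio of coordinates into the ratio of norms.
\<close>

lemma small_energy_ratio:
  assumes "balanced x" "ip x x \<noteq> 0"
  shows "\<exists>y. balanced y \<and> (\<forall>\<epsilon>>0. \<exists>v. set v \<subseteq> S \<and>
     ip (expands v y) (expands v y) > 0 \<and>
     ip (expands v x) (expands v x) \<le> \<epsilon> * ip (expands v y) (expands v y))"
proof -
  obtain i j where ij: "i \<in> S" "j \<in> S" "i \<noteq> j" "0 \<le> x i * x j"
    using exists_sign_pair[of x] by auto
  \<comment> \<open>Two coordinates of equal sign may both be negative; then \<open>-x\<close> is used.\<close>
  define \<sigma> :: real where "\<sigma> = (if x i \<ge> 0 \<and> x j \<ge> 0 then 1 else - 1)"
  define z where "z = (\<lambda>k. \<sigma> * x k)"
  have z: "z i \<ge> 0" "z j \<ge> 0" using ij(4) by (auto simp: z_def \<sigma>_def zero_le_mult_iff)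
  have zip: "ip (expands v z) (expands v z) = ip (expands v x) (expands v x)" for v
    by (simp add: z_def expands_scale) (simp add: ip_def \<sigma>_def)
  have balz: "balanced z" using assms(1) by (simp add: balanced_def z_def sum_distrib_left[symmetric])
  define y where "y = (\<lambda>k. if k = i then 1 else if k = j then - 1 else 0 :: real)"
  have sumy: "(\<Sum>k\<in>S. f k) = f i + f j + (\<Sum>k\<in>S - {i} - {j}. f k)" for f :: "nat \<Rightarrow> real"
    using ij sum_S_remove[of i f] sum.remove[of "S - {i}" j f] by simp
  have baly: "balanced y" unfolding balanced_def by (subst sumy) (use ij in \<open>auto simp: y_def\<close>)
  have yy: "y i = 1" "y j = -1" using ij by (auto simp: y_def)
  have "\<exists>v. set v \<subseteq> S \<and> ip (expands v y) (expands v y) > 0 \<and>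
     ip (expands v x) (expands v x) \<le> \<epsilon> * ip (expands v y) (expands v y)" if "\<epsilon> > 0" for \<epsilon>
  proof -
    define \<eta> where "\<eta> = sqrt (\<epsilon> / 2)"
    have \<eta>: "\<eta> > 0" "\<eta>\<^sup>2 = \<epsilon> / 2" using that by (auto simp: \<eta>_def)
    have "(\<lambda>m. (z i + z j) * ((real N + 1) / (real N + 2)) ^ m) \<longlonglongrightarrow> (z i + z j) * 0"
      by (intro tendsto_intros LIMSEQ_power_zero) auto
    then have "eventually (\<lambda>m. (z i + z j) * ((real N + 1) / (real N + 2)) ^ m < \<eta>) sequentially"
      using \<eta> by (intro order_tendstoD) auto
    then obtain m where m: "(z i + z j) * ((real N + 1) / (real N + 2)) ^ m < \<eta>"
      by (auto simp: eventually_sequentially)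
    from greedy_word[OF ij(1,2,3) z yy, of m] obtain v where v: "set v \<subseteq> S"
      and g: "expands v z i \<ge> 0" "expands v z j \<ge> 0" "expands v y i > 0" "expands v y j < 0"
       "expands v z i / expands v y i + expands v z j / - expands v y j
       \<le> (z i + z j) * ((real N + 1) / (real N + 2)) ^ m" by blast
    define Z Y where "Z = expands v z" and "Y = expands v y"
    have bal: "balanced Z" "balanced Y" unfolding Z_def Y_def
      by (intro balanced_expands balz baly v)+
    have "Z j / - Y j \<ge> 0" using g by (simp add: Z_def Y_def divide_nonneg_neg)
    then have "Z i / Y i \<le> \<eta>" using g m by (simp add: Z_def Y_def)
    then have ZY: "Z i \<le> \<eta> * Y i" "0 \<le> Z i" "Y i > 0"
      using g by (auto simp: Z_def Y_def field_simps)
    define G where "G = (\<lambda>m. \<Sum>l<m. (real N + 1) * (real N + 2) * ((real N + 1) ^ l)\<^sup>2)"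
    have G: "real m \<le> G m" for m
    proof -
      have "1 \<le> (real N + 1) * (real N + 2) * ((real N + 1) ^ l)\<^sup>2" for l
      proof -
        have "1 * 1 * 1\<^sup>2 \<le> (real N + 1) * (real N + 2) * ((real N + 1) ^ l)\<^sup>2"
          by (intro mult_mono power_mono) auto
        then show ?thesis by simp
      qed
      then have "(\<Sum>l<m. 1) \<le> G m" unfolding G_def by (intro sum_mono) auto
      then show ?thesis by simp
    qed
    obtain M where M: "real M \<ge> ip Z Z / (\<eta>\<^sup>2 * (Y i)\<^sup>2)" using real_arch_simple by blast
    define w where "w = v @ replicate M i"
    have w: "set w \<subseteq> S" using v ij by (auto simp: w_def)
    have wz: "ip (expands w z) (expands w z) = ip Z Z + G M * (Z i)\<^sup>2"
      and wy: "ip (expands w y) (expands w y) = ip Y Y + G M * (Y i)\<^sup>2"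
      using expands_replicate_ip[OF bal(1) ij(1), of M] expands_replicate_ip[OF bal(2) ij(1), of M]
      by (simp_all add: w_def Z_def Y_def G_def)
    have "\<eta>\<^sup>2 * (Y i)\<^sup>2 > 0" using \<eta>(1) ZY by simp
    then have "ip Z Z \<le> real M * (\<eta>\<^sup>2 * (Y i)\<^sup>2)"
      using M by (simp only: pos_divide_le_eq)
    also have "\<dots> \<le> G M * (\<eta>\<^sup>2 * (Y i)\<^sup>2)"
      by (intro mult_right_mono G) auto
    finally have 1: "ip Z Z \<le> \<eta>\<^sup>2 * (G M * (Y i)\<^sup>2)" by (simp add: algebra_simps)
    have "(Z i)\<^sup>2 \<le> (\<eta> * Y i)\<^sup>2" using ZY by (intro power_mono)
    then have 2: "G M * (Z i)\<^sup>2 \<le> \<eta>\<^sup>2 * (G M * (Y i)\<^sup>2)"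
      using G[of M] mult_left_mono[of "(Z i)\<^sup>2" "(\<eta> * Y i)\<^sup>2" "G M"]
      by (simp add: power_mult_distrib algebra_simps)
    have "(Y i)\<^sup>2 > 0" using ZY by simp
    then have 3: "ip Y Y > 0" using square_le_ip[OF ij(1), of Y] by linarith
    have "ip (expands w z) (expands w z) \<le> 2 * \<eta>\<^sup>2 * (G M * (Y i)\<^sup>2)"
      unfolding wz using 1 2 by linarith
    also have "\<dots> \<le> 2 * \<eta>\<^sup>2 * ip (expands w y) (expands w y)"
      unfolding wy using 3 by (intro mult_left_mono) auto
    finally have "ip (expands w x) (expands w x) \<le> \<epsilon> * ip (expands w y) (expands w y)"
      by (simp add: zip \<eta>)
    moreover have "ip (expands w y) (expands w y) > 0"
      unfolding wy using 3 G[of M] by (intro add_pos_nonneg mult_nonneg_nonneg) auto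
    ultimately show ?thesis using w by blast
  qed
  then show ?thesis using baly by (intro exI[of _ y]) auto
qed

text \<open>
  A balanced vector is the combination of the centred unit vectors with its own coordinates as
  coefficients; apply Cauchy--Schwarz.
\<close>

lemma ip_expands_le_basis:
  assumes "balanced x" "set w \<subseteq> S"
  shows "ip (expands w x) (expands w x)
    \<le> ip x x * (\<Sum>k\<in>S. ip (expands w (centre (\<lambda>i. if i = k then 1 else 0)))
                            (expands w (centre (\<lambda>i. if i = k then 1 else 0))))"
proof -
  define f where "f = (\<lambda>k. centre (\<lambda>i. if i = k then 1 else 0))"
  have lin: "expands w (\<lambda>j. \<Sum>k\<in>A. c k * g k j) = (\<lambda>j. \<Sum>k\<in>A. c k * expands w (g k) j)"
    if "finite A" for A :: "nat set" and c and g :: "nat \<Rightarrow> nat \<Rightarrow> real"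
    using that
  proof (induction A)
    case empty
    show ?case using expands_scale[of w 0] by simp
  next
    case (insert k A)
    then show ?case using expands_linear[of w "c k" "g k" 1] by simp
  qed
  have x: "x j = (\<Sum>k\<in>S. x k * f k j)" if "j \<in> S" for j
  proof -
    have "(\<Sum>k\<in>S. x k * f k j) = (\<Sum>k\<in>S. x k * (if j = k then 1 else 0) - x k / (real N + 1))"
      unfolding f_def centre_def by (intro sum.cong refl) (auto simp: algebra_simps)
    also have "\<dots> = x j"
      using assms(1) that
      by (simp add: sum_subtractf balanced_def sum_divide_distrib[symmetric]
          if_distrib[of "(*) _"] cong: if_cong)
    finally show ?thesis by simp
  qed
  have ex: "expands w x j = (\<Sum>k\<in>S. x k * expands w (f k) j)" if "j \<in> S" for j
  proof -
    have "expands w x j = expands w (\<lambda>j. \<Sum>k\<in>S. x k * f k j) j"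
      by (intro expands_cong x assms that)
    then show ?thesis by (simp add: lin)
  qed
  have "ip (expands w x) (expands w x) = (\<Sum>j\<in>S. (\<Sum>k\<in>S. x k * expands w (f k) j)\<^sup>2)"
    unfolding ip_def by (intro sum.cong refl) (simp add: ex power2_eq_square)
  also have "\<dots> \<le> (\<Sum>j\<in>S. (\<Sum>k\<in>S. (x k)\<^sup>2) * (\<Sum>k\<in>S. (expands w (f k) j)\<^sup>2))"
    by (intro sum_mono Cauchy_Schwarz_ineq_sum)
  also have "\<dots> = ip x x * (\<Sum>j\<in>S. \<Sum>k\<in>S. (expands w (f k) j)\<^sup>2)"
    by (simp add: ip_def power2_eq_square sum_distrib_left)
  also have "(\<Sum>j\<in>S. \<Sum>k\<in>S. (expands w (f k) j)\<^sup>2) = (\<Sum>k\<in>S. ip (expands w (f k)) (expands w (f k)))"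
    by (subst sum.swap) (simp add: ip_def power2_eq_square)
  finally show ?thesis by (simp add: f_def)
qed

section \<open>Addresses of points of the gasket\<close>

abbreviation addr :: "(nat \<Rightarrow> nat) set" where "addr \<equiv> {\<omega>. \<forall>n. \<omega> n \<in> S}"

definition initial :: "nat \<Rightarrow> (nat \<Rightarrow> nat) \<Rightarrow> nat list" where
  "initial n \<omega> = map \<omega> [0..<n]"

definition follow :: "nat list \<Rightarrow> (nat \<Rightarrow> nat) \<Rightarrow> nat \<Rightarrow> nat" where
  "follow w \<omega> n = (if n < length w then w ! n else \<omega> (n - length w))"

abbreviation shift :: "nat \<Rightarrow> (nat \<Rightarrow> nat) \<Rightarrow> nat \<Rightarrow> nat" where
  "shift n \<omega> \<equiv> (\<lambda>k. \<omega> (n + k))"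

text \<open>
  The address of the point between the vertices \<open>i\<close> and \<open>j\<close> of the cell \<open>w\<close>, seen from the
  subcell \<open>i\<close>.
\<close>

abbreviation junction :: "nat list \<Rightarrow> nat \<Rightarrow> nat \<Rightarrow> nat \<Rightarrow> nat" where
  "junction w i j \<equiv> follow (w @ [i]) (\<lambda>_. j)"

lemma length_initial [simp]: "length (initial n \<omega>) = n"
  by (simp add: initial_def)

lemma initial_0 [simp]: "initial 0 \<omega> = []"
  by (simp add: initial_def)

lemma initial_Suc: "initial (Suc n) \<omega> = initial n \<omega> @ [\<omega> n]"
  by (simp add: initial_def)

lemma set_initial: "\<omega> \<in> addr \<Longrightarrow> set (initial n \<omega>) \<subseteq> S"
  by (auto simp: initial_def)

lemma initial_in_words: "\<omega> \<in> addr \<Longrightarrow> initial n \<omega> \<in> sg_words N n"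
  using set_initial by (auto simp: sg_words_def)

lemma initial_eq_iff: "initial n \<omega> = initial n \<omega>' \<longleftrightarrow> (\<forall>k<n. \<omega> k = \<omega>' k)"
  by (auto simp: initial_def)

lemma initial_mono: "initial n \<omega> = initial n \<omega>' \<Longrightarrow> m \<le> n \<Longrightarrow> initial m \<omega> = initial m \<omega>'"
  by (simp add: initial_eq_iff)

lemma follow_initial: "follow (initial n \<omega>) (shift n \<omega>) = \<omega>"
  by (auto simp: follow_def initial_def fun_eq_iff)

lemma initial_follow: "initial (length w) (follow w \<omega>) = w"
  by (auto simp: follow_def initial_def intro: nth_equalityI)

lemma shift_follow: "shift (length w) (follow w \<omega>) = \<omega>"
  by (auto simp: follow_def)

lemma follow_in_addr: "set w \<subseteq> S \<Longrightarrow> \<omega> \<in> addr \<Longrightarrow> follow w \<omega> \<in> addr"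
  by (auto simp: follow_def subset_iff)

lemma follow_append: "follow (v @ w) \<omega> = follow v (follow w \<omega>)"
  by (auto simp: follow_def fun_eq_iff nth_append)

definition pt :: "(nat \<Rightarrow> nat) \<Rightarrow> 'a" where
  "pt \<omega> = (\<Sum>k. (1/2) ^ Suc k *\<^sub>R p (\<omega> k))"

text \<open>
  The \<open>j\<close>-th barycentric coordinate of the point with address \<open>\<omega>\<close>.
\<close>

definition bary :: "nat \<Rightarrow> (nat \<Rightarrow> nat) \<Rightarrow> real" where
  "bary j \<omega> = (\<Sum>k. (1/2) ^ Suc k * of_bool (\<omega> k = j))"

lemma summable_half: "summable (\<lambda>k. (1/2) ^ Suc k :: real)" "(\<Sum>k. (1/2) ^ Suc k :: real) = 1"
  using power_half_series by (auto simp: sums_iff)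

lemma summable_bary: "summable (\<lambda>k. (1/2) ^ Suc k * of_bool (\<omega> k = j) :: real)"
  by (rule summable_comparison_test'[OF summable_half(1)]) (auto simp: of_bool_def)

lemma bary_nonneg: "bary j \<omega> \<ge> 0"
  unfolding bary_def by (intro suminf_nonneg summable_bary) auto

lemma bary_unfold: "bary j \<omega> = (of_bool (\<omega> 0 = j) + bary j (shift 1 \<omega>)) / 2"
proof -
  have "bary j \<omega> = (\<Sum>k. (1/2) ^ Suc (Suc k) * of_bool (\<omega> (Suc k) = j)) + (1/2) ^ Suc 0 * of_bool (\<omega> 0 = j)"
    using suminf_split_head[OF summable_bary[of \<omega> j]] unfolding bary_def by simp
  also have "(\<Sum>k. (1/2) ^ Suc (Suc k) * of_bool (\<omega> (Suc k) = j))
     = (\<Sum>k. (1/2) * ((1/2) ^ Suc k * of_bool (shift 1 \<omega> k = j)) :: real)"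
    by (simp add: mult.assoc)
  also have "\<dots> = (1/2) * bary j (shift 1 \<omega>)"
    unfolding bary_def by (rule suminf_mult[OF summable_bary])
  finally show ?thesis by (simp add: field_simps)
qed

lemma sum_bary:
  assumes "\<omega> \<in> addr"
  shows "(\<Sum>j\<in>S. bary j \<omega>) = 1" "pt \<omega> = (\<Sum>j\<in>S. bary j \<omega> *\<^sub>R p j)"
proof -
  have s: "(\<Sum>j\<in>S. of_bool (\<omega> k = j) *\<^sub>R f j) = f (\<omega> k)" for k and f :: "nat \<Rightarrow> 'b::real_vector"
  proof -
    have "(\<Sum>j\<in>S. of_bool (\<omega> k = j) *\<^sub>R f j) = (\<Sum>j\<in>S. if \<omega> k = j then f j else 0)"
      by (intro sum.cong) auto
    then show ?thesis using assms by simp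
  qed
  have "(\<Sum>j\<in>S. bary j \<omega>) = (\<Sum>k. \<Sum>j\<in>S. (1/2) ^ Suc k * of_bool (\<omega> k = j))"
    unfolding bary_def by (intro suminf_sum[symmetric] summable_bary)
  also have "(\<lambda>k. \<Sum>j\<in>S. (1/2) ^ Suc k * of_bool (\<omega> k = j)) = (\<lambda>k. (1/2) ^ Suc k :: real)"
    using s[of _ "\<lambda>_. 1::real"] unfolding sum_distrib_left[symmetric] by simp
  finally show "(\<Sum>j\<in>S. bary j \<omega>) = 1" using summable_half by simp
  have "(\<Sum>j\<in>S. bary j \<omega> *\<^sub>R p j) = (\<Sum>j\<in>S. \<Sum>k. ((1/2) ^ Suc k * of_bool (\<omega> k = j)) *\<^sub>R p j)"
    unfolding bary_def by (intro sum.cong refl suminf_scaleR_left summable_bary)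
  also have "\<dots> = (\<Sum>k. \<Sum>j\<in>S. ((1/2) ^ Suc k * of_bool (\<omega> k = j)) *\<^sub>R p j)"
    by (intro suminf_sum[symmetric] summable_scaleR_left summable_bary)
  also have "(\<lambda>k. \<Sum>j\<in>S. ((1/2) ^ Suc k * of_bool (\<omega> k = j)) *\<^sub>R p j) = (\<lambda>k. (1/2) ^ Suc k *\<^sub>R p (\<omega> k))"
  proof
    fix k
    have "(\<Sum>j\<in>S. ((1/2) ^ Suc k * of_bool (\<omega> k = j)) *\<^sub>R p j)
        = (1/2) ^ Suc k *\<^sub>R (\<Sum>j\<in>S. of_bool (\<omega> k = j) *\<^sub>R p j)"
      by (simp only: scaleR_sum_right scaleR_scaleR)
    then show "(\<Sum>j\<in>S. ((1/2) ^ Suc k * of_bool (\<omega> k = j)) *\<^sub>R p j) = (1/2) ^ Suc k *\<^sub>R p (\<omega> k)"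
      using s by metis
  qed
  finally show "pt \<omega> = (\<Sum>j\<in>S. bary j \<omega> *\<^sub>R p j)" by (simp add: pt_def)
qed

lemma bary_le_1:
  assumes "\<omega> \<in> addr" "j \<in> S" shows "bary j \<omega> \<le> 1"
  using member_le_sum[OF assms(2), of "\<lambda>j. bary j \<omega>"] sum_bary(1)[OF assms(1)]
  by (simp add: bary_nonneg)

lemma bary_eq_1D:
  assumes "\<omega> \<in> addr" "j \<in> S" "bary j \<omega> = 1" shows "\<omega> = (\<lambda>_. j)"
proof -
  have "bary j (shift n \<omega>) = 1 \<and> \<omega> n = j" for n
  proof (induction n)
    case 0
    show ?case using assms bary_unfold[of j \<omega>] bary_le_1[of "shift 1 \<omega>" j]
      by (auto simp: of_bool_def split: if_splits)
  next
    case (Suc n)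
    have a: "shift (Suc n) \<omega> \<in> addr" using assms by auto
    have 1: "bary j (shift (Suc n) \<omega>) = 1"
      using bary_unfold[of j "shift n \<omega>"] Suc by simp
    then have "\<omega> (Suc n) = j"
      using bary_unfold[of j "shift (Suc n) \<omega>"] bary_le_1[of "shift (Suc (Suc n)) \<omega>" j] assms
      by (auto simp: of_bool_def split: if_splits)
    with 1 show ?case by simp
  qed
  then show ?thesis by auto
qed

lemma barycentric_unique:
  assumes "(\<Sum>j\<in>S. c j) = (0::real)" "(\<Sum>j\<in>S. c j *\<^sub>R p j) = 0" "j \<in> S"
  shows "c j = 0"
proof (rule ccontr)
  assume nz: "c j \<noteq> 0"
  have inj: "inj_on p S" and ind: "\<not> affine_dependent (p ` S)"
    using nondegenerate by (auto simp: sg_nondegenerate_def)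
  define U where "U = (\<lambda>v. c (the_inv_into S p v))"
  have U: "U (p i) = c i" if "i \<in> S" for i
    using that inj by (simp add: U_def the_inv_into_f_f)
  have "sum U (p ` S) = 0" "sum (\<lambda>v. U v *\<^sub>R v) (p ` S) = 0" "U (p j) \<noteq> 0"
    using assms nz by (simp_all add: sum.reindex[OF inj] U)
  then have "affine_dependent (p ` S)"
    using assms(3) by (subst affine_dependent_explicit_finite) auto
  with ind show False by simp
qed

lemma bary_eq:
  assumes "\<omega> \<in> addr" "\<omega>' \<in> addr" "pt \<omega> = pt \<omega>'" "j \<in> S"
  shows "bary j \<omega> = bary j \<omega>'"
proof -
  have "bary j \<omega> - bary j \<omega>' = 0"
  proof (rule barycentric_unique[of "\<lambda>j. bary j \<omega> - bary j \<omega>'"])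
    show "(\<Sum>j\<in>S. bary j \<omega> - bary j \<omega>') = 0"
      using sum_bary(1)[OF assms(1)] sum_bary(1)[OF assms(2)] by (simp add: sum_subtractf)
    show "(\<Sum>j\<in>S. (bary j \<omega> - bary j \<omega>') *\<^sub>R p j) = 0"
      using assms(3) unfolding sum_bary(2)[OF assms(1)] sum_bary(2)[OF assms(2)]
      by (simp add: sum_subtractf scaleR_left_diff_distrib)
  qed (rule assms(4))
  then show ?thesis by simp
qed

lemma pt_unfold:
  assumes "\<omega> \<in> addr" shows "pt \<omega> = sg_map p (\<omega> 0) (pt (shift 1 \<omega>))"
proof -
  have a: "shift 1 \<omega> \<in> addr" using assms by auto
  have "pt \<omega> = (\<Sum>j\<in>S. ((of_bool (\<omega> 0 = j) + bary j (shift 1 \<omega>)) / 2) *\<^sub>R p j)"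
    unfolding sum_bary(2)[OF assms] by (intro sum.cong refl) (metis bary_unfold)
  also have "\<dots> = (1/2) *\<^sub>R ((\<Sum>j\<in>S. of_bool (\<omega> 0 = j) *\<^sub>R p j) + (\<Sum>j\<in>S. bary j (shift 1 \<omega>) *\<^sub>R p j))"
    unfolding sum.distrib[symmetric] scaleR_sum_right
    by (intro sum.cong refl) (simp add: scaleR_add_left scaleR_add_right add_divide_distrib)
  also have "(\<Sum>j\<in>S. of_bool (\<omega> 0 = j) *\<^sub>R p j) = (\<Sum>j\<in>S. if \<omega> 0 = j then p j else 0)"
    by (intro sum.cong) auto
  also have "\<dots> = p (\<omega> 0)" using assms by simp
  finally show ?thesis unfolding sg_map_def sum_bary(2)[OF a] by (simp add: add.commute)
qed

lemma pt_initial: "\<omega> \<in> addr \<Longrightarrow> pt \<omega> = sg_word_map p (initial n \<omega>) (pt (shift n \<omega>))"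
proof (induction n arbitrary: \<omega>)
  case (Suc n)
  have "initial (Suc n) \<omega> = \<omega> 0 # initial n (shift 1 \<omega>)"
    unfolding initial_def by (simp add: upt_conv_Cons map_Suc_upt[symmetric] del: upt_Suc)
  then show ?case
    using Suc.IH[of "shift 1 \<omega>"] Suc.prems pt_unfold[OF Suc.prems] by simp
qed simp

lemma pt_follow: "set w \<subseteq> S \<Longrightarrow> \<omega> \<in> addr \<Longrightarrow> pt (follow w \<omega>) = sg_word_map p w (pt \<omega>)"
  using pt_initial[of "follow w \<omega>" "length w"] follow_in_addr[of w \<omega>]
  by (simp only: initial_follow shift_follow)

lemma pt_const: "i \<in> S \<Longrightarrow> pt (\<lambda>_. i) = p i"
proof -
  assume "i \<in> S"
  then have "pt (\<lambda>_. i) = (1/2) *\<^sub>R (pt (\<lambda>_. i) + p i)"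
    using pt_unfold[of "\<lambda>_. i"] by (simp add: sg_map_def)
  then have "2 *\<^sub>R pt (\<lambda>_. i) = pt (\<lambda>_. i) + p i"
    by (metis (no_types) scaleR_half_double scaleR_2 scaleR_right_distrib)
  then show ?thesis by (simp add: scaleR_2)
qed

lemma dist_word_map: "dist (sg_word_map p w x) (sg_word_map p w y) = dist x y / 2 ^ length w"
proof (induction w)
  case (Cons i w)
  have "dist (sg_map p i a) (sg_map p i b) = dist a b / 2" for a b
    by (simp add: sg_map_def dist_norm flip: scaleR_diff_right)
  from this[of "sg_word_map p w x" "sg_word_map p w y"] show ?case using Cons by simp
qed simp

lemma word_map_inj: "sg_word_map p w x = sg_word_map p w y \<Longrightarrow> x = y"
  using dist_word_map[of w x y] by simp

lemma word_map_append: "sg_word_map p (v @ w) = sg_word_map p v \<circ> sg_word_map p w"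
  by (induction v) auto

text \<open>
  At the first difference the points lie in different subcells \<open>i\<close> and \<open>j\<close> of one cell. Points of
  subcell \<open>i\<close> have \<open>i\<close>-th barycentric coordinate at least \<open>1 / 2\<close>, so both coordinates equal
  \<open>1 / 2\<close>, and this determines all later letters.
\<close>

lemma pt_eqD:
  assumes "\<omega> \<in> addr" "\<omega>' \<in> addr" "pt \<omega> = pt \<omega>'" "\<omega> \<noteq> \<omega>'"
  shows "\<exists>w i j. set w \<subseteq> S \<and> i \<in> S \<and> j \<in> S \<and> i \<noteq> j \<and> \<omega> = junction w i j \<and> \<omega>' = junction w j i"
proof -
  define n where "n = (LEAST n. \<omega> n \<noteq> \<omega>' n)"
  have ne: "\<omega> n \<noteq> \<omega>' n"
    unfolding n_def by (rule LeastI_ex) (use assms(4) in auto)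
  have w: "initial n \<omega>' = initial n \<omega>"
    using not_less_Least unfolding n_def initial_eq_iff by fastforce
  define \<eta> where "\<eta> = shift n \<omega>"
  define \<eta>' where "\<eta>' = shift n \<omega>'"
  have \<eta>: "\<eta> \<in> addr" "\<eta>' \<in> addr" using assms by (auto simp: \<eta>_def \<eta>'_def)
  define i where "i = \<eta> 0"
  define j where "j = \<eta>' 0"
  have ij: "i \<in> S" "j \<in> S" "i \<noteq> j"
    using assms(1,2) ne by (auto simp: i_def j_def \<eta>_def \<eta>'_def)
  have pteq: "pt \<eta> = pt \<eta>'"
    using pt_initial[OF assms(1), of n] pt_initial[OF assms(2), of n] assms(3) w
    by (auto simp: \<eta>_def \<eta>'_def intro: word_map_inj[of "initial n \<omega>"])
  have tail: "\<zeta> = junction [] a b"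
    if "\<zeta> \<in> addr" "\<zeta>' \<in> addr" "pt \<zeta> = pt \<zeta>'" "\<zeta> 0 = a" "\<zeta>' 0 = b" "a \<in> S" "b \<in> S" "a \<noteq> b" for \<zeta> \<zeta>' a b
  proof -
    have s: "shift 1 \<zeta> \<in> addr" using that by auto
    have "bary b \<zeta> = bary b \<zeta>'" using that bary_eq by blast
    also have "\<dots> \<ge> 1 / 2" using bary_unfold[of b \<zeta>'] bary_nonneg[of b "shift 1 \<zeta>'"] that by simp
    finally have "bary b \<zeta> \<ge> 1 / 2" .
    then have "bary b (shift 1 \<zeta>) \<ge> 1" using bary_unfold[of b \<zeta>] that by simp
    then have "bary b (shift 1 \<zeta>) = 1" using bary_le_1[OF s] that by (auto intro: antisym)
    then have "shift 1 \<zeta> = (\<lambda>_. b)" using bary_eq_1D[OF s] that by blast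
    then have "\<zeta> (Suc k) = b" for k using fun_cong[of "shift 1 \<zeta>" "\<lambda>_. b" k] by simp
    then show ?thesis using that(4) by (auto simp: follow_def fun_eq_iff not_less gr0_conv_Suc)
  qed
  have "\<eta> = junction [] i j" using tail[of \<eta> \<eta>' i j] \<eta> pteq ij by (simp add: i_def j_def)
  moreover have "\<eta>' = junction [] j i" using tail[of \<eta>' \<eta> j i] \<eta> pteq ij by (simp add: i_def j_def)
  moreover have "\<omega> = follow (initial n \<omega>) \<eta>" "\<omega>' = follow (initial n \<omega>) \<eta>'"
    using follow_initial[of n \<omega>] follow_initial[of n \<omega>'] w by (auto simp: \<eta>_def \<eta>'_def)
  ultimately show ?thesis
    using ij set_initial[OF assms(1), of n]
    by (metis follow_append append_Nil)
qed

text \<open>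
  Cylinders are open in the product topology, so dependence on finitely many letters up to a small
  error is continuity.
\<close>

lemma initial_continuous:
  fixes F :: "(nat \<Rightarrow> nat) \<Rightarrow> 'b::metric_space"
  assumes "\<And>e. e > 0 \<Longrightarrow> \<exists>n. \<forall>\<omega>\<in>addr. \<forall>\<omega>'\<in>addr. initial n \<omega> = initial n \<omega>' \<longrightarrow> dist (F \<omega>) (F \<omega>') < e"
  shows "continuous_on addr F"
  unfolding continuous_on tendsto_iff eventually_at_topological
proof (intro ballI allI impI)
  fix \<omega> and e :: real assume \<omega>: "\<omega> \<in> addr" and "e > 0"
  then obtain n where n: "\<forall>\<omega>\<in>addr. \<forall>\<omega>'\<in>addr. initial n \<omega> = initial n \<omega>' \<longrightarrow> dist (F \<omega>) (F \<omega>') < e"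
    using assms by blast
  let ?U = "Pi\<^sub>E UNIV (\<lambda>k. if k < n then {\<omega> k} else UNIV)"
  have "open ?U"
  proof (rule open_PiE)
    show "finite {i. (if i < n then {\<omega> i} else UNIV) \<noteq> UNIV}"
      by (rule finite_subset[of _ "{..<n}"]) auto
  qed (simp add: open_discrete)
  moreover have "initial n x = initial n \<omega>" if "x \<in> ?U" for x
  proof -
    have "x k = \<omega> k" if "k < n" for k
      using PiE_mem[OF \<open>x \<in> ?U\<close>, of k] that by simp
    then show ?thesis by (simp add: initial_eq_iff)
  qed
  moreover have "\<omega> \<in> ?U" by auto
  ultimately show "\<exists>U. open U \<and> \<omega> \<in> U \<and> (\<forall>x\<in>U. x \<noteq> \<omega> \<longrightarrow> x \<in> addr \<longrightarrow> dist (F x) (F \<omega>) < e)"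
    using n \<omega> by (intro exI[of _ ?U]) blast
qed

lemma compact_addr: "compact addr"
proof -
  have "addr = Pi\<^sub>E UNIV (\<lambda>_. S)" by auto
  moreover have "compactin (product_topology (\<lambda>_. euclidean) UNIV) (Pi\<^sub>E UNIV (\<lambda>_. S))"
    by (subst compactin_PiE) (auto simp: finite_imp_compact)
  ultimately show ?thesis by (simp add: euclidean_product_topology)
qed

lemma pt_bounded: "\<exists>D>0. \<forall>\<omega>\<in>addr. \<forall>\<omega>'\<in>addr. dist (pt \<omega>) (pt \<omega>') \<le> D"
proof -
  define B where "B = (\<Sum>j\<in>S. norm (p j))"
  have B: "norm (pt \<omega>) \<le> B" if "\<omega> \<in> addr" for \<omega>
  proof -
    have "norm (pt \<omega>) \<le> (\<Sum>j\<in>S. norm (bary j \<omega> *\<^sub>R p j))"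
      unfolding sum_bary(2)[OF that] by (rule norm_sum)
    also have "\<dots> \<le> B" unfolding B_def
    proof (rule sum_mono)
      fix j assume "j \<in> S"
      then show "norm (bary j \<omega> *\<^sub>R p j) \<le> norm (p j)"
        using bary_le_1[OF that, of j] bary_nonneg[of j \<omega>] mult_right_mono[of "bary j \<omega>" 1 "norm (p j)"]
        by simp
    qed
    finally show ?thesis .
  qed
  have "B \<ge> 0" unfolding B_def by (intro sum_nonneg) auto
  have "dist (pt \<omega>) (pt \<omega>') \<le> 2 * B + 1" if "\<omega> \<in> addr" "\<omega>' \<in> addr" for \<omega> \<omega>'
    using B[OF that(1)] B[OF that(2)] dist_triangle2[of "pt \<omega>" "pt \<omega>'" 0] by (simp add: dist_norm)
  with \<open>B \<ge> 0\<close> show ?thesis by (intro exI[of _ "2 * B + 1"]) auto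
qed

lemma cell_small:
  assumes "e > 0"
  shows "\<exists>n. \<forall>\<omega>\<in>addr. \<forall>\<omega>'\<in>addr. \<forall>m\<ge>n. initial m \<omega> = initial m \<omega>' \<longrightarrow> dist (pt \<omega>) (pt \<omega>') < e"
proof -
  obtain D where D: "D > 0" "\<And>\<omega> \<omega>'. \<omega> \<in> addr \<Longrightarrow> \<omega>' \<in> addr \<Longrightarrow> dist (pt \<omega>) (pt \<omega>') \<le> D"
    using pt_bounded by auto
  obtain n where n: "(1/2::real) ^ n < e / D"
    using real_arch_pow_inv[of "e / D" "1/2"] assms D by auto
  have "dist (pt \<omega>) (pt \<omega>') < e" if "\<omega> \<in> addr" "\<omega>' \<in> addr" "m \<ge> n" "initial m \<omega> = initial m \<omega>'" for \<omega> \<omega>' m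
  proof -
    have "initial n \<omega> = initial n \<omega>'" using that initial_mono by blast
    then have "dist (pt \<omega>) (pt \<omega>') = dist (pt (shift n \<omega>)) (pt (shift n \<omega>')) / 2 ^ n"
      using that pt_initial[of \<omega> n] pt_initial[of \<omega>' n] by (simp add: dist_word_map)
    also have "\<dots> \<le> D / 2 ^ n"
      using that D by (intro divide_right_mono) auto
    also have "\<dots> < e" using n D by (simp add: field_simps power_one_over)
    finally show ?thesis .
  qed
  then show ?thesis by blast
qed

lemma continuous_pt: "continuous_on addr pt"
  by (rule initial_continuous) (use cell_small in blast)

text \<open>
  Any two bounded nonempty sets that satisfy the self-similarity equation approximate each other
  within \<open>D / 2 ^ n\<close> for every \<open>n\<close>, hence closed ones coincide.
\<close>

lemma gasket_eq: "sg_gasket N p = pt ` addr"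
  unfolding sg_gasket_def
proof (rule the_equality)
  have "pt ` addr = (\<Union>i\<in>S. sg_map p i ` pt ` addr)"
  proof (intro subset_antisym subsetI)
    fix x assume "x \<in> pt ` addr"
    then obtain \<omega> where \<omega>: "\<omega> \<in> addr" "x = pt \<omega>" by auto
    then have "x = sg_map p (\<omega> 0) (pt (shift 1 \<omega>))" "shift 1 \<omega> \<in> addr" "\<omega> 0 \<in> S"
      using pt_unfold[OF \<omega>(1)] by auto
    then show "x \<in> (\<Union>i\<in>S. sg_map p i ` pt ` addr)" by blast
  next
    fix x assume "x \<in> (\<Union>i\<in>S. sg_map p i ` pt ` addr)"
    then obtain i \<omega> where *: "i \<in> S" "\<omega> \<in> addr" "x = sg_map p i (pt \<omega>)" by auto
    then have "x = pt (follow [i] \<omega>)" by (simp add: pt_follow)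
    moreover have "follow [i] \<omega> \<in> addr" using * by (intro follow_in_addr) auto
    ultimately show "x \<in> pt ` addr" by blast
  qed
  moreover have "compact (pt ` addr)"
    by (rule compact_continuous_image[OF continuous_pt compact_addr])
  moreover have "pt (\<lambda>_. Suc 0) \<in> pt ` addr" by (rule imageI) simp
  ultimately show "compact (pt ` addr) \<and> pt ` addr \<noteq> {} \<and> pt ` addr = (\<Union>i\<in>S. sg_map p i ` pt ` addr)"
    by (metis empty_iff)
next
  fix K assume *: "compact K \<and> K \<noteq> {} \<and> K = (\<Union>i\<in>sg_letters N. sg_map p i ` K)"
  then have K: "compact K" and K_eq: "K = (\<Union>i\<in>sg_letters N. sg_map p i ` K)" by blast+
  obtain z where z: "z \<in> K" using * by blast
  have word: "sg_word_map p w y \<in> K" if "set w \<subseteq> S" "y \<in> K" for w y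
    using that
  proof (induction w)
    case (Cons i w)
    then have "sg_map p i (sg_word_map p w y) \<in> (\<Union>i\<in>S. sg_map p i ` K)" by auto
    then show ?case by (simp add: K_eq[symmetric])
  qed simp
  have "bounded (insert z (K \<union> pt ` addr))"
    using K compact_continuous_image[OF continuous_pt compact_addr] by (simp add: compact_imp_bounded)
  then obtain D where D: "\<And>x y. x \<in> K \<union> pt ` addr \<Longrightarrow> y \<in> K \<union> pt ` addr \<Longrightarrow> dist x y \<le> D"
    unfolding bounded_two_points by blast
  have small: "\<exists>n. D / 2 ^ n < e" if "e > 0" for e
  proof -
    obtain n where "real n > D / e" using reals_Archimedean2 by blast
    moreover have "real n < 2 ^ n" by (simp add: of_nat_less_two_power)
    ultimately have "D / e < 2 ^ n" by linarith
    then show ?thesis using that by (auto simp: field_simps)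
  qed
  show "K = pt ` addr"
  proof (intro subset_antisym subsetI)
    fix x assume "x \<in> pt ` addr"
    then obtain \<omega> where \<omega>: "\<omega> \<in> addr" "x = pt \<omega>" by auto
    have "\<exists>y\<in>K. dist y x < e" if "e > 0" for e
    proof -
      obtain n where n: "D / 2 ^ n < e" using small \<open>e > 0\<close> by blast
      have "shift n \<omega> \<in> addr" using \<omega> by auto
      then have "dist z (pt (shift n \<omega>)) \<le> D" using z by (intro D) auto
      then have "dist (sg_word_map p (initial n \<omega>) z) x \<le> D / 2 ^ n"
        using \<omega> pt_initial[of \<omega> n] by (simp add: dist_word_map divide_right_mono)
      then show ?thesis
        using word[OF set_initial[OF \<omega>(1)] z] n by (meson order_le_less_trans)
    qed
    then have "x \<in> closure K" by (simp add: closure_approachable)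
    then show "x \<in> K" using K by (simp add: compact_imp_closed)
  next
    fix x assume x: "x \<in> K"
    have dec: "\<exists>w y. set w \<subseteq> S \<and> length w = n \<and> y \<in> K \<and> x = sg_word_map p w y" for n
    proof (induction n)
      case (Suc n)
      then obtain w y where *: "set w \<subseteq> S" "length w = n" "y \<in> K" "x = sg_word_map p w y" by auto
      then obtain i y' where "i \<in> S" "y' \<in> K" "y = sg_map p i y'" using K_eq by blast
      with * show ?case
        by (intro exI[of _ "w @ [i]"] exI[of _ y']) (auto simp: word_map_append)
    qed (use x in auto)
    have "\<exists>y\<in>pt ` addr. dist y x < e" if "e > 0" for e
    proof -
      obtain n where n: "D / 2 ^ n < e" using small \<open>e > 0\<close> by blast
      obtain w y where w: "set w \<subseteq> S" "length w = n" "y \<in> K" "x = sg_word_map p w y" using dec by blast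
      have a: "(\<lambda>_. 1) \<in> addr" by simp
      then have "dist (pt (\<lambda>_. 1)) y \<le> D" using w by (intro D) auto
      then have "dist (pt (follow w (\<lambda>_. 1))) x \<le> D / 2 ^ n"
        using w a by (simp add: pt_follow dist_word_map divide_right_mono)
      moreover have "follow w (\<lambda>_. 1) \<in> addr" using w a by (intro follow_in_addr) auto
      ultimately show ?thesis using n by (meson image_eqI order_le_less_trans)
    qed
    then have "x \<in> closure (pt ` addr)" by (simp add: closure_approachable)
    then show "x \<in> pt ` addr"
      using compact_continuous_image[OF continuous_pt compact_addr] by (simp add: compact_imp_closed)
  qed
qed

abbreviation K :: "'a set" where "K \<equiv> sg_gasket N p"

lemma compact_gasket: "compact K"
  unfolding gasket_eq by (rule compact_continuous_image[OF continuous_pt compact_addr])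

lemma pt_in_gasket: "\<omega> \<in> addr \<Longrightarrow> pt \<omega> \<in> K"
  by (simp add: gasket_eq)

lemma word_map_in_gasket: "set w \<subseteq> S \<Longrightarrow> x \<in> K \<Longrightarrow> sg_word_map p w x \<in> K"
proof -
  assume w: "set w \<subseteq> S" and "x \<in> K"
  then obtain \<omega> where "\<omega> \<in> addr" "x = pt \<omega>" by (auto simp: gasket_eq)
  then show ?thesis
    using w pt_follow[of w \<omega>] pt_in_gasket[OF follow_in_addr[of w \<omega>]] by simp
qed

lemma vertex_in_gasket: "i \<in> S \<Longrightarrow> p i \<in> K"
  using pt_const[of i] pt_in_gasket[of "\<lambda>_. i"] by simp

abbreviation cell :: "nat list \<Rightarrow> 'a set" where "cell w \<equiv> sg_word_map p w ` K"

lemma cell_eq: "set w \<subseteq> S \<Longrightarrow> cell w = pt ` {\<omega> \<in> addr. initial (length w) \<omega> = w}"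
proof (intro subset_antisym subsetI)
  fix x assume w: "set w \<subseteq> S" and "x \<in> cell w"
  then obtain \<omega> where "\<omega> \<in> addr" "x = sg_word_map p w (pt \<omega>)" by (auto simp: gasket_eq)
  then show "x \<in> pt ` {\<omega> \<in> addr. initial (length w) \<omega> = w}"
    using w pt_follow[of w \<omega>] follow_in_addr[of w \<omega>] initial_follow[of w \<omega>] by (intro image_eqI) auto
next
  fix x assume w: "set w \<subseteq> S" and "x \<in> pt ` {\<omega> \<in> addr. initial (length w) \<omega> = w}"
  then obtain \<omega> where \<omega>: "\<omega> \<in> addr" "initial (length w) \<omega> = w" "x = pt \<omega>" by auto
  then have "x = sg_word_map p w (pt (shift (length w) \<omega>))" "shift (length w) \<omega> \<in> addr"
    using pt_initial[of \<omega> "length w"] by auto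
  then show "x \<in> cell w" using pt_in_gasket by (metis image_eqI)
qed

lemma compact_cell: "compact (cell w)"
proof -
  have "continuous_on K (sg_word_map p w)"
    unfolding continuous_on_iff
  proof (intro ballI allI impI)
    fix x e assume "0 < (e::real)"
    have "dist (sg_word_map p w x') (sg_word_map p w x) \<le> dist x' x" for x'
      by (simp add: dist_word_map divide_le_eq mult_le_cancel_left1)
    then show "\<exists>d>0. \<forall>x'\<in>K. dist x' x < d \<longrightarrow> dist (sg_word_map p w x') (sg_word_map p w x) < e"
      using \<open>0 < e\<close> by (meson order_le_less_trans)
  qed
  then show ?thesis using compact_gasket compact_continuous_image by blast
qed

definition tail_constant :: "(nat \<Rightarrow> nat) set" where
  "tail_constant = {\<omega>. \<exists>w i. \<omega> = follow w (\<lambda>_. i)}"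

lemma countable_tail_constant: "countable tail_constant"
proof -
  have "tail_constant = (\<lambda>(w, i). follow w (\<lambda>_. i)) ` UNIV"
    by (auto simp: tail_constant_def)
  then show ?thesis by (metis countableI_type countable_image)
qed

lemma pt_eq_tail_constant:
  "\<omega> \<in> addr \<Longrightarrow> \<omega>' \<in> addr \<Longrightarrow> pt \<omega> = pt \<omega>' \<Longrightarrow> \<omega> \<notin> tail_constant \<Longrightarrow> \<omega> = \<omega>'"
  using pt_eqD[of \<omega> \<omega>'] by (force simp: tail_constant_def)

text \<open>
  The function on the gasket induced by a function \<open>\<Phi>\<close> of addresses. The choice of an address is
  immaterial when \<open>\<Phi>\<close> takes equal values at the two addresses of every junction.
\<close>

definition on_gasket :: "((nat \<Rightarrow> nat) \<Rightarrow> real) \<Rightarrow> 'a \<Rightarrow> real" where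
  "on_gasket \<Phi> x = (if x \<in> K then \<Phi> (SOME \<omega>. \<omega> \<in> addr \<and> pt \<omega> = x) else 0)"

lemma on_gasket:
  assumes "\<And>w i j. set w \<subseteq> S \<Longrightarrow> i \<in> S \<Longrightarrow> j \<in> S \<Longrightarrow> i \<noteq> j \<Longrightarrow> \<Phi> (junction w i j) = \<Phi> (junction w j i)"
  shows "\<omega> \<in> addr \<Longrightarrow> on_gasket \<Phi> (pt \<omega>) = \<Phi> \<omega>"
proof -
  assume \<omega>: "\<omega> \<in> addr"
  define \<omega>' where "\<omega>' = (SOME \<omega>'. \<omega>' \<in> addr \<and> pt \<omega>' = pt \<omega>)"
  have "\<omega>' \<in> addr \<and> pt \<omega>' = pt \<omega>" unfolding \<omega>'_def by (rule someI[of _ \<omega>]) (use \<omega> in auto)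
  then have "\<Phi> \<omega>' = \<Phi> \<omega>"
    using pt_eqD[of \<omega>' \<omega>] \<omega> assms by metis
  then show ?thesis using pt_in_gasket[OF \<omega>] by (simp add: on_gasket_def \<omega>'_def)
qed

text \<open>
  The graph of the induced function is a continuous image of the compact space of addresses, and
  a function with compact graph is continuous.
\<close>

lemma on_gasket_continuous:
  assumes "\<And>w i j. set w \<subseteq> S \<Longrightarrow> i \<in> S \<Longrightarrow> j \<in> S \<Longrightarrow> i \<noteq> j \<Longrightarrow> \<Phi> (junction w i j) = \<Phi> (junction w j i)"
    and "continuous_on addr \<Phi>"
  shows "on_gasket \<Phi> \<in> sg_continuous N p"
proof -
  have "(\<lambda>x. (x, on_gasket \<Phi> x)) ` K = (\<lambda>\<omega>. (pt \<omega>, \<Phi> \<omega>)) ` addr"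
    using on_gasket[of \<Phi>, OF assms(1)] by (force simp: gasket_eq)
  moreover have "compact ((\<lambda>\<omega>. (pt \<omega>, \<Phi> \<omega>)) ` addr)"
    by (intro compact_continuous_image compact_addr continuous_on_Pair continuous_pt assms(2))
  ultimately have cl: "closed ((\<lambda>x. (x, on_gasket \<Phi> x)) ` K)" by (simp add: compact_imp_closed)
  have "compact (\<Phi> ` addr)" by (rule compact_continuous_image[OF assms(2) compact_addr])
  moreover have "on_gasket \<Phi> \<in> K \<rightarrow> \<Phi> ` addr"
    using on_gasket[of \<Phi>, OF assms(1)] by (force simp: gasket_eq)
  ultimately have "continuous_on K (on_gasket \<Phi>)" using cl by (rule continuous_from_closed_graph)
  then show ?thesis by (simp add: sg_continuous_def on_gasket_def)
qed

section \<open>Harmonic extension and piecewise harmonic interpolation\<close>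

definition osc_factor :: real where "osc_factor = (real N + 1) / (real N + 3)"

lemma osc_factor: "0 \<le> osc_factor" "osc_factor < 1"
  by (auto simp: osc_factor_def)

definition osc_le :: "(nat \<Rightarrow> real) \<Rightarrow> real \<Rightarrow> bool" where
  "osc_le u d \<longleftrightarrow> (\<forall>j\<in>S. \<forall>k\<in>S. \<bar>u j - u k\<bar> \<le> d)"

lemma osc_le_ex: "\<exists>d\<ge>0. osc_le u d"
proof -
  have "\<bar>u j\<bar> \<le> (\<Sum>k\<in>S. \<bar>u k\<bar>)" if "j \<in> S" for j
    using member_le_sum[OF that, of "\<lambda>k. \<bar>u k\<bar>"] by simp
  then have "osc_le u (2 * (\<Sum>k\<in>S. \<bar>u k\<bar>))" unfolding osc_le_def
    by (smt (verit))
  then show ?thesis by (intro exI[of _ "2 * (\<Sum>k\<in>S. \<bar>u k\<bar>)"]) (auto intro!: sum_nonneg)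
qed

text \<open>
  In terms of \<open>expand\<close>, differences of values within the new cell are either old differences or,
  against the vertex \<open>i\<close>, sums of \<open>N + 1\<close> old differences; both are divided by \<open>N + 3\<close>.
\<close>

lemma osc_le_subdiv:
  assumes "osc_le u d" "i \<in> S"
  shows "osc_le (subdiv i u) (osc_factor * d)"
proof -
  define x where "x = centre u"
  have xd: "x j - x k = u j - u k" for j k by (simp add: x_def centre_def)
  have d: "d \<ge> 0" using assms unfolding osc_le_def by force
  have diff: "subdiv i u j - subdiv i u k = (expand i x j - expand i x k) / (real N + 3)" if "j \<in> S" "k \<in> S" for j k
  proof -
    have "subdiv i u j - subdiv i u k = centre (subdiv i u) j - centre (subdiv i u) k"
      by (simp add: centre_def)
    then show ?thesis using that assms by (simp add: centre_subdiv x_def diff_divide_distrib)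
  qed
  have inner: "\<bar>expand i x j - expand i x k\<bar> \<le> d" if "j \<in> S" "k \<in> S" "j \<noteq> i" "k \<noteq> i" for j k
    using assms(1) that by (simp add: expand_other xd osc_le_def)
  have outer: "\<bar>expand i x i - expand i x k\<bar> \<le> (real N + 1) * d" if "k \<in> S" "k \<noteq> i" for k
  proof -
    have "(\<Sum>j\<in>S - {i}. x i - x j) = real N * x i + x i"
      using balanced_centre[of u] sum_S_remove[OF assms(2), of x] assms(2)
      by (simp add: sum_subtractf balanced_def x_def)
    then have "expand i x i - expand i x k = (\<Sum>j\<in>S - {i}. x i - x j) + (x i - x k)"
      using that by (simp add: expand_same expand_other algebra_simps)
    also have "\<bar>\<dots>\<bar> \<le> (\<Sum>j\<in>S - {i}. \<bar>x i - x j\<bar>) + \<bar>x i - x k\<bar>"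
      using sum_abs[of "\<lambda>j. x i - x j" "S - {i}"] by linarith
    also have "\<dots> \<le> (\<Sum>j\<in>S - {i}. d) + d"
      using assms that unfolding xd osc_le_def by (intro add_mono sum_mono) auto
    finally show ?thesis using assms(2) by (simp add: algebra_simps)
  qed
  have "\<bar>expand i x j - expand i x k\<bar> \<le> (real N + 1) * d" if "j \<in> S" "k \<in> S" for j k
  proof -
    have "d \<le> (real N + 1) * d" using d mult_right_mono[of 1 "real N + 1" d] by simp
    then show ?thesis
      using inner[of j k] outer[of j] outer[of k] that d by (cases "j = i"; cases "k = i") auto
  qed
  then show ?thesis
    unfolding osc_le_def by (auto simp: diff osc_factor_def intro!: divide_right_mono)
qed

lemma osc_le_subdivs:
  "osc_le u d \<Longrightarrow> set w \<subseteq> S \<Longrightarrow> osc_le (subdivs w u) (osc_factor ^ length w * d)"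
proof (induction w arbitrary: u d)
  case (Cons i w)
  have "osc_le (subdivs w (subdiv i u)) (osc_factor ^ length w * (osc_factor * d))"
    using Cons.prems by (intro Cons.IH osc_le_subdiv) auto
  then show ?case by (simp add: mult.assoc mult.left_commute)
qed simp

lemma subdiv_bounds:
  assumes "\<And>j. j \<in> S \<Longrightarrow> a \<le> u j" "\<And>j. j \<in> S \<Longrightarrow> u j \<le> b" "i \<in> S" "j \<in> S"
  shows "a \<le> subdiv i u j" "subdiv i u j \<le> b"
proof -
  have "(\<Sum>k\<in>S. a) \<le> (\<Sum>k\<in>S. u k)" by (rule sum_mono) (rule assms(1))
  moreover have "(\<Sum>k\<in>S. u k) \<le> (\<Sum>k\<in>S. b)" by (rule sum_mono) (rule assms(2))
  ultimately have "a * (real N + 3) \<le> u i + u j + (\<Sum>k\<in>S. u k)" "u i + u j + (\<Sum>k\<in>S. u k) \<le> b * (real N + 3)"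
    using assms(1,2)[OF assms(3)] assms(1,2)[OF assms(4)] by (auto simp: algebra_simps)
  then show "a \<le> subdiv i u j" "subdiv i u j \<le> b"
    using assms by (auto simp: subdiv_def pos_le_divide_eq pos_divide_le_eq)
qed

lemma subdivs_bounds:
  assumes "\<And>j. j \<in> S \<Longrightarrow> a \<le> u j" "\<And>j. j \<in> S \<Longrightarrow> u j \<le> b" "set w \<subseteq> S" "j \<in> S"
  shows "a \<le> subdivs w u j \<and> subdivs w u j \<le> b"
  using assms
proof (induction w arbitrary: u)
  case (Cons i w)
  show ?case unfolding fold.simps comp_def
    using Cons.prems by (intro Cons.IH subdiv_bounds[of a u b]) auto
qed simp

text \<open>
  The value of the harmonic function with boundary values \<open>u\<close> at the point with address \<open>\<omega>\<close>. As
  the oscillation over the cells of \<open>\<omega>\<close> tends to \<open>0\<close>, any vertex in place of \<open>1\<close> gives the same limit.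
\<close>

definition harm :: "(nat \<Rightarrow> real) \<Rightarrow> (nat \<Rightarrow> nat) \<Rightarrow> real" where
  "harm u \<omega> = lim (\<lambda>n. subdivs (initial n \<omega>) u 1)"

lemma initial_add: "initial (n + m) \<omega> = initial n \<omega> @ initial m (shift n \<omega>)"
  by (rule nth_equalityI) (auto simp: initial_def nth_append)

lemma subdivs_close:
  assumes "osc_le u d" "\<omega> \<in> addr" "j \<in> S" "k \<in> S" "n \<le> m"
  shows "\<bar>subdivs (initial m \<omega>) u j - subdivs (initial n \<omega>) u k\<bar> \<le> osc_factor ^ n * d"
proof -
  define v where "v = subdivs (initial n \<omega>) u"
  have "osc_le v (osc_factor ^ n * d)"
    using osc_le_subdivs[OF assms(1) set_initial[OF assms(2), of n]] by (simp add: v_def)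
  then have v: "v k - osc_factor ^ n * d \<le> v l" "v l \<le> v k + osc_factor ^ n * d" if "l \<in> S" for l
    using that assms(4) unfolding osc_le_def by (smt (verit))+
  have "subdivs (initial m \<omega>) u = subdivs (initial (m - n) (shift n \<omega>)) v"
    using initial_add[of n "m - n" \<omega>] assms(5) by (simp add: v_def)
  moreover have "set (initial (m - n) (shift n \<omega>)) \<subseteq> S" using assms(2) by (intro set_initial) auto
  ultimately have "v k - osc_factor ^ n * d \<le> subdivs (initial m \<omega>) u j \<and>
    subdivs (initial m \<omega>) u j \<le> v k + osc_factor ^ n * d"
    using subdivs_bounds[of "v k - osc_factor ^ n * d" v "v k + osc_factor ^ n * d"] v assms(3) by auto
  then show ?thesis by (auto simp: v_def)
qed

lemma osc_power_tendsto_0: "(\<lambda>n. osc_factor ^ n * d) \<longlonglongrightarrow> 0"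
proof -
  have "(\<lambda>n. osc_factor ^ n * d) \<longlonglongrightarrow> 0 * d"
    using osc_factor by (intro tendsto_intros LIMSEQ_power_zero) auto
  then show ?thesis by simp
qed

lemma harm_tendsto:
  assumes "\<omega> \<in> addr" shows "(\<lambda>n. subdivs (initial n \<omega>) u 1) \<longlonglongrightarrow> harm u \<omega>"
proof -
  obtain d where d: "osc_le u d" using osc_le_ex by blast
  have "Cauchy (\<lambda>n. subdivs (initial n \<omega>) u 1)"
  proof (rule metric_CauchyI)
    fix e :: real assume "e > 0"
    then have "\<exists>M. osc_factor ^ M * d < e / 2"
      using order_tendstoD(2)[OF osc_power_tendsto_0, of "e / 2" d] by (auto simp: eventually_sequentially)
    then obtain M where M: "osc_factor ^ M * d < e / 2" by blast
    have "dist (subdivs (initial m \<omega>) u 1) (subdivs (initial n \<omega>) u 1) < e" if "m \<ge> M" "n \<ge> M" for m n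
      using subdivs_close[OF d assms, of 1 1 M m] subdivs_close[OF d assms, of 1 1 M n] that M
      by (simp add: dist_real_def)
    then show "\<exists>M. \<forall>m\<ge>M. \<forall>n\<ge>M. dist (subdivs (initial m \<omega>) u 1) (subdivs (initial n \<omega>) u 1) < e"
      by blast
  qed
  then show ?thesis unfolding harm_def by (simp add: Cauchy_convergent_iff convergent_LIMSEQ_iff)
qed

lemma harm_close:
  assumes "osc_le u d" "\<omega> \<in> addr" "j \<in> S"
  shows "\<bar>harm u \<omega> - subdivs (initial n \<omega>) u j\<bar> \<le> osc_factor ^ n * d"
proof -
  have "(\<lambda>m. \<bar>subdivs (initial m \<omega>) u 1 - subdivs (initial n \<omega>) u j\<bar>)
      \<longlonglongrightarrow> \<bar>harm u \<omega> - subdivs (initial n \<omega>) u j\<bar>"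
    by (intro tendsto_intros harm_tendsto assms)
  then show ?thesis
    by (rule LIMSEQ_le_const2) (use subdivs_close[OF assms(1,2)] assms(3) in \<open>auto intro!: exI[of _ n]\<close>)
qed

lemma harm_bounds:
  assumes "\<And>j. j \<in> S \<Longrightarrow> a \<le> u j" "\<And>j. j \<in> S \<Longrightarrow> u j \<le> b" "\<omega> \<in> addr"
  shows "a \<le> harm u \<omega>" "harm u \<omega> \<le> b"
proof -
  have "a \<le> subdivs (initial n \<omega>) u 1 \<and> subdivs (initial n \<omega>) u 1 \<le> b" for n
    by (rule subdivs_bounds) (use assms set_initial in auto)
  then show "a \<le> harm u \<omega>" "harm u \<omega> \<le> b"
    using harm_tendsto[OF assms(3), of u] by (auto intro: LIMSEQ_le_const LIMSEQ_le_const2)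
qed

lemma harm_cong:
  assumes "\<And>j. j \<in> S \<Longrightarrow> u j = v j" "\<omega> \<in> addr" shows "harm u \<omega> = harm v \<omega>"
proof -
  have "subdivs (initial n \<omega>) u 1 = subdivs (initial n \<omega>) v 1" for n
    by (rule subdivs_cong) (use assms set_initial in auto)
  then show ?thesis by (simp add: harm_def)
qed

lemma harm_shift:
  assumes "\<omega> \<in> addr" shows "harm u \<omega> = harm (subdivs (initial n \<omega>) u) (shift n \<omega>)"
proof -
  have "(\<lambda>m. subdivs (initial (m + n) \<omega>) u 1) \<longlonglongrightarrow> harm u \<omega>"
    using harm_tendsto[OF assms] by (rule LIMSEQ_ignore_initial_segment)
  then have "(\<lambda>m. subdivs (initial m (shift n \<omega>)) (subdivs (initial n \<omega>) u) 1) \<longlonglongrightarrow> harm u \<omega>"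
    using initial_add[of n _ \<omega>] by (simp add: add.commute)
  then show ?thesis
    using harm_tendsto[of "shift n \<omega>" "subdivs (initial n \<omega>) u"] assms LIMSEQ_unique by auto
qed

lemma harm_follow:
  "set w \<subseteq> S \<Longrightarrow> \<omega> \<in> addr \<Longrightarrow> harm u (follow w \<omega>) = harm (subdivs w u) \<omega>"
  using harm_shift[of "follow w \<omega>" u "length w"] follow_in_addr[of w \<omega>]
  by (simp only: initial_follow shift_follow)

lemma harm_const:
  assumes "j \<in> S" shows "harm u (\<lambda>_. j) = u j"
proof -
  obtain d where d: "osc_le u d" using osc_le_ex by blast
  have "subdivs (initial n (\<lambda>_. j)) u j = u j" for n
    by (induction n) (auto simp: initial_Suc subdiv_def)
  then have "\<bar>harm u (\<lambda>_. j) - u j\<bar> \<le> osc_factor ^ n * d" for n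
    using harm_close[OF d, of "\<lambda>_. j" j n] assms by simp
  then have "\<bar>harm u (\<lambda>_. j) - u j\<bar> \<le> 0"
    by (intro LIMSEQ_le_const[OF osc_power_tendsto_0]) auto
  then show ?thesis by simp
qed

abbreviation vals :: "('a \<Rightarrow> real) \<Rightarrow> nat list \<Rightarrow> nat \<Rightarrow> real" where
  "vals f w \<equiv> (\<lambda>i. f (sg_word_map p w (p i)))"

text \<open>
  The function that agrees with \<open>f\<close> at the vertices of the cells of level \<open>m\<close> and is harmonic inside
  each of these cells.
\<close>

definition interp :: "nat \<Rightarrow> ('a \<Rightarrow> real) \<Rightarrow> (nat \<Rightarrow> nat) \<Rightarrow> real" where
  "interp m f \<omega> = harm (vals f (initial m \<omega>)) (shift m \<omega>)"

lemma sg_map_vertices: "sg_map p i (p j) = sg_map p j (p i)" "sg_map p i (p i) = p i"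
  by (simp_all add: sg_map_def add.commute scaleR_half_double)

lemma junction_in_addr: "set w \<subseteq> S \<Longrightarrow> i \<in> S \<Longrightarrow> j \<in> S \<Longrightarrow> junction w i j \<in> addr"
  by (intro follow_in_addr) auto

lemma pt_junction:
  "set w \<subseteq> S \<Longrightarrow> i \<in> S \<Longrightarrow> j \<in> S \<Longrightarrow> pt (junction w i j) = sg_word_map p w (sg_map p i (p j))"
  using pt_follow[of "w @ [i]" "\<lambda>_. j"] pt_const[of j] by (simp add: word_map_append)

text \<open>
  Inside a cell of level \<open>m\<close> the harmonic value between \<open>i\<close> and \<open>j\<close> is symmetric in \<open>i\<close> and \<open>j\<close>;
  at lower levels a junction is a vertex of level \<open>m\<close>, where the value is that of \<open>f\<close>.
\<close>

lemma interp_junction: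
  assumes "set w \<subseteq> S" "i \<in> S" "j \<in> S" "i \<noteq> j"
  shows "interp m f (junction w i j) = interp m f (junction w j i)"
proof (cases "m \<le> length w")
  case True
  define v where "v = take m w"
  define w' where "w' = drop m w"
  have w: "w = v @ w'" "length v = m" "set v \<subseteq> S" "set w' \<subseteq> S"
    using True assms(1) set_take_subset[of m w] set_drop_subset[of m w] by (auto simp: v_def w'_def)
  have *: "interp m f (junction w i j) = subdiv i (subdivs w' (vals f v)) j"
    if "i \<in> S" "j \<in> S" for i j
  proof -
    have "junction w i j = follow v (junction w' i j)"
      by (simp add: w(1) follow_append)
    then have "interp m f (junction w i j) = harm (vals f v) (junction w' i j)"
      unfolding interp_def by (simp only: w(2)[symmetric] initial_follow shift_follow)
    also have "\<dots> = harm (subdivs (w' @ [i]) (vals f v)) (\<lambda>_. j)"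
      using w that by (intro harm_follow) auto
    finally show ?thesis using that by (simp add: harm_const)
  qed
  show ?thesis using assms by (simp add: * subdiv_def)
next
  case False
  have *: "interp m f (junction w i j) = f (pt (junction w i j))"
    if "i \<in> S" "j \<in> S" for i j
  proof -
    have s: "shift m (junction w i j) = (\<lambda>_. j)" using False by (auto simp: follow_def)
    have "pt (junction w i j) = sg_word_map p (initial m (junction w i j)) (pt (\<lambda>_. j))"
      using pt_initial[OF junction_in_addr[OF assms(1) that], of m] by (simp only: s)
    then show ?thesis using that unfolding interp_def s by (simp add: harm_const pt_const)
  qed
  have "pt (junction w i j) = pt (junction w j i)"
    unfolding pt_junction[OF assms(1,2,3)] pt_junction[OF assms(1,3,2)] by (simp only: sg_map_vertices(1))
  then show ?thesis unfolding *[OF assms(2,3)] *[OF assms(3,2)] by (rule arg_cong)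
qed

lemma interp_continuous: "continuous_on addr (interp m f)"
proof (rule initial_continuous)
  fix e :: real assume "e > 0"
  have "\<exists>d\<ge>0. \<forall>w\<in>sg_words N m. osc_le (vals f w) d"
  proof -
    have fin: "finite (sg_words N m)"
      unfolding sg_words_def by (rule finite_lists_length_eq) simp
    have "\<forall>w. \<exists>d. d \<ge> 0 \<and> osc_le (vals f w) d" using osc_le_ex by blast
    then obtain d where d: "\<And>w. d w \<ge> 0 \<and> osc_le (vals f w) (d w)" unfolding choice_iff by blast
    have "osc_le (vals f w) (\<Sum>w\<in>sg_words N m. d w)" if "w \<in> sg_words N m" for w
    proof -
      have "d w \<le> (\<Sum>w\<in>sg_words N m. d w)"
        using member_le_sum[OF that, of d] d fin by auto
      then show ?thesis using d[of w] unfolding osc_le_def by force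
    qed
    then show ?thesis using d by (intro exI[of _ "\<Sum>w\<in>sg_words N m. d w"]) (auto intro!: sum_nonneg)
  qed
  then obtain d where d: "\<And>w. w \<in> sg_words N m \<Longrightarrow> osc_le (vals f w) d" by blast
  have "\<exists>M. osc_factor ^ M * d < e / 2"
    using order_tendstoD(2)[OF osc_power_tendsto_0, of "e / 2" d] \<open>e > 0\<close> by (auto simp: eventually_sequentially)
  then obtain M where M: "osc_factor ^ M * d < e / 2" by blast
  have "dist (interp m f \<omega>) (interp m f \<omega>') < e"
    if "\<omega> \<in> addr" "\<omega>' \<in> addr" "initial (m + M) \<omega> = initial (m + M) \<omega>'" for \<omega> \<omega>'
  proof -
    have eq: "initial m \<omega> = initial m \<omega>'" "initial M (shift m \<omega>) = initial M (shift m \<omega>')"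
      using that(3) by (simp_all add: initial_add)
    have o: "osc_le (vals f (initial m \<omega>)) d" by (rule d[OF initial_in_words[OF that(1)]])
    have "shift m \<omega> \<in> addr" "shift m \<omega>' \<in> addr" using that by auto
    from harm_close[OF o this(1), of 1 M] harm_close[OF o this(2), of 1 M]
    show ?thesis using M eq by (simp add: interp_def dist_real_def)
  qed
  then show "\<exists>n. \<forall>\<omega>\<in>addr. \<forall>\<omega>'\<in>addr. initial n \<omega> = initial n \<omega>' \<longrightarrow> dist (interp m f \<omega>) (interp m f \<omega>') < e"
    by blast
qed

abbreviation spline :: "nat \<Rightarrow> ('a \<Rightarrow> real) \<Rightarrow> 'a \<Rightarrow> real" where
  "spline m f \<equiv> on_gasket (interp m f)"

lemma spline_continuous: "spline m f \<in> sg_continuous N p"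
  by (intro on_gasket_continuous interp_junction interp_continuous)

lemma spline_pt: "\<omega> \<in> addr \<Longrightarrow> spline m f (pt \<omega>) = interp m f \<omega>"
  by (intro on_gasket interp_junction)

lemma word_map_vertex: "set w \<subseteq> S \<Longrightarrow> i \<in> S \<Longrightarrow> sg_word_map p w (p i) = pt (follow w (\<lambda>_. i))"
  by (simp add: pt_follow pt_const)

lemma vals_spline:
  assumes "length w = m" "set w \<subseteq> S" "set v \<subseteq> S" "i \<in> S"
  shows "vals (spline m f) (w @ v) i = subdivs v (vals f w) i"
proof -
  have a: "follow (w @ v) (\<lambda>_. i) \<in> addr" using assms by (intro follow_in_addr) auto
  have "vals (spline m f) (w @ v) i = interp m f (follow (w @ v) (\<lambda>_. i))"
    using assms a by (simp add: word_map_vertex spline_pt)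
  also have "\<dots> = harm (vals f w) (follow v (\<lambda>_. i))"
    unfolding interp_def follow_append assms(1)[symmetric] by (simp only: initial_follow shift_follow)
  also have "\<dots> = subdivs v (vals f w) i"
    using assms by (simp add: harm_follow harm_const)
  finally show ?thesis .
qed

lemma spline_close:
  assumes "\<omega> \<in> addr" "\<And>i. i \<in> S \<Longrightarrow> \<bar>f (sg_word_map p (initial m \<omega>) (p i)) - c\<bar> \<le> e"
  shows "\<bar>spline m f (pt \<omega>) - c\<bar> \<le> e"
proof -
  have "shift m \<omega> \<in> addr" using assms by auto
  moreover have "c - e \<le> vals f (initial m \<omega>) i" "vals f (initial m \<omega>) i \<le> c + e" if "i \<in> S" for i
    using assms(2)[OF that] by (auto simp: abs_le_iff)
  ultimately have "c - e \<le> interp m f \<omega>" "interp m f \<omega> \<le> c + e"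
    unfolding interp_def
    using harm_bounds[of "c - e" "vals f (initial m \<omega>)" "c + e" "shift m \<omega>"] by simp_all
  then show ?thesis using assms(1) by (simp add: spline_pt abs_le_iff)
qed

section \<open>Energy as a limit over the levels\<close>

lemma finite_words: "finite (sg_words N m)"
  unfolding sg_words_def by (rule finite_lists_length_eq) simp

lemma words_0 [simp]: "sg_words N 0 = {[]}"
  by (auto simp: sg_words_def)

lemma sum_words_Suc:
  "(\<Sum>w\<in>sg_words N (Suc m). g w) = (\<Sum>w\<in>sg_words N m. \<Sum>i\<in>S. g (w @ [i]) :: 'b::comm_monoid_add)"
proof -
  have "sg_words N (Suc m) = (\<lambda>(w, i). w @ [i]) ` (sg_words N m \<times> S)"
  proof (intro subset_antisym subsetI)
    fix w assume "w \<in> sg_words N (Suc m)"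
    then obtain v i where "w = v @ [i]" "v \<in> sg_words N m" "i \<in> S"
      by (cases w rule: rev_cases) (auto simp: sg_words_def)
    then show "w \<in> (\<lambda>(w, i). w @ [i]) ` (sg_words N m \<times> S)" by (intro image_eqI[of _ _ "(v, i)"]) auto
  qed (auto simp: sg_words_def)
  moreover have "inj_on (\<lambda>(w, i). w @ [i]) (sg_words N m \<times> S)" by (auto simp: inj_on_def)
  ultimately show ?thesis
    by (simp add: sum.reindex sum.cartesian_product case_prod_unfold)
qed

abbreviation rr :: real where "rr \<equiv> (real N + 3) / (real N + 1)"

lemma level_energy_eq:
  "sg_level_energy N p f m = rr ^ m * (\<Sum>w\<in>sg_words N m. vertex_energy (vals f w))"
  by (simp add: sg_level_energy_def sg_Q0_def vertex_energy_def add.commute)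

lemma vertex_energy_nonneg: "vertex_energy u \<ge> 0"
  unfolding vertex_energy_def by (intro mult_nonneg_nonneg sum_nonneg) auto

lemma vertex_energy_cong: "(\<And>j. j \<in> S \<Longrightarrow> u j = v j) \<Longrightarrow> vertex_energy u = vertex_energy v"
  unfolding vertex_energy_def by (intro arg_cong[of _ _ "\<lambda>x. 1/2 * x"] sum.cong) auto

abbreviation defect :: "('a \<Rightarrow> real) \<Rightarrow> nat list \<Rightarrow> nat \<Rightarrow> nat \<Rightarrow> real" where
  "defect f w i \<equiv> (\<lambda>j. vals f (w @ [i]) j - subdiv i (vals f w) j)"

text \<open>
  Each step adds the energy of the deviation from harmonic subdivision. This gives monotonicity,
  and it shows that the energy stays constant exactly when every subdivision is harmonic.
\<close>

lemma level_energy_Suc: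
  "sg_level_energy N p f (Suc m) = sg_level_energy N p f m
     + rr ^ Suc m * (\<Sum>w\<in>sg_words N m. \<Sum>i\<in>S. vertex_energy (defect f w i))"
proof -
  have "(\<Sum>i\<in>S. vertex_energy (vals f (w @ [i]))) =
      (real N + 1) / (real N + 3) * vertex_energy (vals f w) + (\<Sum>i\<in>S. vertex_energy (defect f w i))" for w
  proof -
    have "vals f (w @ [i]) j = vals f (w @ [j]) i" for i j
      by (simp add: word_map_append) (simp only: sg_map_vertices(1))
    then show ?thesis
      using subdivision_energy[of "\<lambda>i. vals f (w @ [i])"]
      by (simp add: word_map_append sg_map_vertices(2))
  qed
  then have "sg_level_energy N p f (Suc m) = rr ^ Suc m *
      ((real N + 1) / (real N + 3) * (\<Sum>w\<in>sg_words N m. vertex_energy (vals f w))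
        + (\<Sum>w\<in>sg_words N m. \<Sum>i\<in>S. vertex_energy (defect f w i)))"
    unfolding level_energy_eq sum_words_Suc by (simp only: sum.distrib sum_distrib_left)
  also have "\<dots> = rr ^ m * (rr * ((real N + 1) / (real N + 3))) * (\<Sum>w\<in>sg_words N m. vertex_energy (vals f w))
      + rr ^ Suc m * (\<Sum>w\<in>sg_words N m. \<Sum>i\<in>S. vertex_energy (defect f w i))"
    by (simp only: distrib_left power_Suc2 mult.assoc)
  also have "rr * ((real N + 1) / (real N + 3)) = 1" by simp
  finally show ?thesis by (simp only: level_energy_eq mult_1_right)
qed

lemma level_energy_nonneg: "sg_level_energy N p f m \<ge> 0"
  unfolding level_energy_eq
  by (intro mult_nonneg_nonneg sum_nonneg vertex_energy_nonneg zero_le_power) auto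

lemma level_energy_incseq: "incseq (sg_level_energy N p f)"
proof (rule incseq_SucI)
  fix m
  have "0 \<le> rr ^ Suc m * (\<Sum>w\<in>sg_words N m. \<Sum>i\<in>S. vertex_energy (defect f w i))"
    by (intro mult_nonneg_nonneg sum_nonneg vertex_energy_nonneg zero_le_power) auto
  then show "sg_level_energy N p f m \<le> sg_level_energy N p f (Suc m)"
    unfolding level_energy_Suc by simp
qed

lemma energy_eq_SUP: "sg_energy N p f = (SUP m. ennreal (sg_level_energy N p f m))"
  unfolding sg_energy_def
  by (rule limI, rule LIMSEQ_SUP) (use level_energy_incseq[of f] in \<open>auto simp: mono_def ennreal_leI\<close>)

lemma level_energy_le_energy: "ennreal (sg_level_energy N p f m) \<le> sg_energy N p f"
  unfolding energy_eq_SUP by (rule SUP_upper) simp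

lemma domain_iff:
  "f \<in> sg_domain N p \<longleftrightarrow> f \<in> sg_continuous N p \<and> (\<exists>B. \<forall>m. sg_level_energy N p f m \<le> B)"
proof -
  have "sg_energy N p f < \<infinity> \<longleftrightarrow> (\<exists>B. \<forall>m. sg_level_energy N p f m \<le> B)"
  proof
    assume *: "sg_energy N p f < \<infinity>"
    then obtain B where "sg_energy N p f = ennreal B" "B \<ge> 0"
      by (cases "sg_energy N p f") auto
    then have "sg_level_energy N p f m \<le> B" for m
      using level_energy_le_energy[of f m] by (simp add: ennreal_le_iff)
    then show "\<exists>B. \<forall>m. sg_level_energy N p f m \<le> B" by blast
  next
    assume "\<exists>B. \<forall>m. sg_level_energy N p f m \<le> B"
    then obtain B where "\<And>m. sg_level_energy N p f m \<le> B" by blast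
    then have "sg_energy N p f \<le> ennreal B"
      unfolding energy_eq_SUP by (intro SUP_least ennreal_leI) auto
    then show "sg_energy N p f < \<infinity>" using order_le_less_trans by fastforce
  qed
  then show ?thesis by (simp add: sg_domain_def)
qed

lemma level_energy_tendsto:
  assumes "f \<in> sg_domain N p"
  shows "sg_level_energy N p f \<longlonglongrightarrow> enn2real (sg_energy N p f)"
proof -
  have "(\<lambda>m. ennreal (sg_level_energy N p f m)) \<longlonglongrightarrow> sg_energy N p f"
    unfolding energy_eq_SUP
    by (rule LIMSEQ_SUP) (use level_energy_incseq[of f] in \<open>auto simp: mono_def ennreal_leI\<close>)
  moreover have "sg_energy N p f \<noteq> \<infinity>" using assms by (auto simp: sg_domain_def)
  ultimately have "(\<lambda>m. enn2real (ennreal (sg_level_energy N p f m))) \<longlonglongrightarrow> enn2real (sg_energy N p f)"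
    by (intro tendsto_enn2real) (auto simp: less_top[symmetric] ennreal_enn2real)
  then show ?thesis by (simp add: level_energy_nonneg)
qed

lemma vals_spline_le:
  assumes "set w \<subseteq> S" "length w = m" "i \<in> S" shows "vals (spline m f) w i = vals f w i"
  using vals_spline[of w m "[]"] assms by simp

lemma energy_spline:
  "sg_energy N p (spline m f) = ennreal (sg_level_energy N p f m)" "spline m f \<in> sg_domain N p"
proof -
  have m: "sg_level_energy N p (spline m f) m = sg_level_energy N p f m"
    unfolding level_energy_eq
    by (intro arg_cong[of _ _ "\<lambda>x. _ * x"] sum.cong vertex_energy_cong vals_spline_le) (auto simp: sg_words_def)
  have step: "sg_level_energy N p (spline m f) (m + n) = sg_level_energy N p f m" for n
  proof (induction n)
    case (Suc n)
    have "vertex_energy (defect (spline m f) w i) = 0" if w: "w \<in> sg_words N (m + n)" and i: "i \<in> S" for w i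
    proof -
      define a b where "a = take m w" and "b = drop m w"
      have ab: "w = a @ b" "length a = m" "set a \<subseteq> S" "set b \<subseteq> S"
        using w set_take_subset[of m w] set_drop_subset[of m w]
        by (auto simp: sg_words_def a_def b_def)
      have vw: "vals (spline m f) w j = subdivs b (vals f a) j" if "j \<in> S" for j
        unfolding ab(1) by (rule vals_spline) (use ab that in auto)
      have "vals (spline m f) (w @ [i]) j = subdivs (b @ [i]) (vals f a) j" if "j \<in> S" for j
        using vals_spline[of a m "b @ [i]" j f] ab that i by simp
      then have "defect (spline m f) w i j = 0" if "j \<in> S" for j
        using that i vw subdivs_cong[of "vals (spline m f) w" "subdivs b (vals f a)" "[i]" j] by simp
      then show ?thesis by (simp add: vertex_energy_def)
    qed
    then show ?case using Suc by (simp add: level_energy_Suc)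
  qed (simp add: m)
  have le: "sg_level_energy N p (spline m f) n \<le> sg_level_energy N p f m" for n
    using level_energy_incseq[of "spline m f"] step[of n] by (metis incseq_def le_add2)
  show "spline m f \<in> sg_domain N p" using le spline_continuous by (auto simp: domain_iff)
  show "sg_energy N p (spline m f) = ennreal (sg_level_energy N p f m)"
    unfolding energy_eq_SUP
  proof (rule antisym)
    show "(SUP n. ennreal (sg_level_energy N p (spline m f) n)) \<le> ennreal (sg_level_energy N p f m)"
      by (intro SUP_least ennreal_leI le)
    show "ennreal (sg_level_energy N p f m) \<le> (SUP n. ennreal (sg_level_energy N p (spline m f) n))"
      unfolding m[symmetric] by (rule SUP_upper) simp
  qed
qed

lemma harmonic_spline: "spline 0 f \<in> sg_harmonic N p"
proof -
  let ?A = "{g \<in> sg_domain N p. \<forall>i\<in>S. g (p i) = spline 0 f (p i)}"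
  have "sg_energy N p (spline 0 f) \<le> sg_energy N p g" if "g \<in> ?A" for g
  proof -
    have "vertex_energy (vals f []) = vertex_energy (vals g [])"
      using that vals_spline_le[of "[]" 0 _ f] by (intro vertex_energy_cong) auto
    then have "sg_level_energy N p f 0 = sg_level_energy N p g 0" by (simp add: level_energy_eq)
    then show ?thesis using energy_spline(1)[of 0 f] level_energy_le_energy[of g 0] by simp
  qed
  then have "sg_energy N p (spline 0 f) = (INF g\<in>?A. sg_energy N p g)"
    by (intro antisym INF_greatest INF_lower) (auto simp: energy_spline)
  then show ?thesis by (simp add: sg_harmonic_def energy_spline)
qed

text \<open>
  The interpolant of level \<open>0\<close> competes with \<open>h\<close> and has the energy of level \<open>0\<close>. Hence the level
  energies of a minimizer are constant, and all its deviations from harmonic subdivision vanish.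
\<close>

lemma harmonic_vals:
  assumes "h \<in> sg_harmonic N p" "set w \<subseteq> S" "j \<in> S"
  shows "vals h w j = subdivs w (vals h []) j"
proof -
  have "spline 0 h \<in> {g \<in> sg_domain N p. \<forall>i\<in>S. g (p i) = h (p i)}"
    using energy_spline(2)[of 0 h] vals_spline_le[of "[]" 0 _ h] by simp
  then have "sg_energy N p h \<le> sg_energy N p (spline 0 h)"
    using assms(1) by (auto simp: sg_harmonic_def intro: INF_lower)
  then have "sg_energy N p h \<le> ennreal (sg_level_energy N p h 0)" by (simp add: energy_spline)
  then have "ennreal (sg_level_energy N p h m) \<le> ennreal (sg_level_energy N p h 0)" for m
    using level_energy_le_energy order_trans by blast
  then have const: "sg_level_energy N p h m = sg_level_energy N p h 0" for m
    using level_energy_incseq[of h] level_energy_nonneg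
    by (simp add: ennreal_le_iff antisym incseq_def)
  have zero: "vals h (w @ [i]) j = subdiv i (vals h w) j" if "set w \<subseteq> S" "i \<in> S" "j \<in> S" for w i j
  proof -
    have "rr ^ Suc (length w) * (\<Sum>w\<in>sg_words N (length w). \<Sum>i\<in>S. vertex_energy (defect h w i)) = 0"
      using level_energy_Suc[of h "length w"] const[of "length w"] const[of "Suc (length w)"] by simp
    then have "(\<Sum>w\<in>sg_words N (length w). \<Sum>i\<in>S. vertex_energy (defect h w i)) = 0" by auto
    then have "(\<Sum>i\<in>S. vertex_energy (defect h w i)) = 0"
      using that finite_words
      by (subst (asm) sum_nonneg_eq_0_iff) (auto intro!: sum_nonneg vertex_energy_nonneg simp: sg_words_def)
    then have "vertex_energy (defect h w i) = 0"
      using that by (subst (asm) sum_nonneg_eq_0_iff) (auto intro!: vertex_energy_nonneg)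
    then have "ip (centre (defect h w i)) (centre (defect h w i)) = 0"
      unfolding vertex_energy_centre by simp
    then have "centre (defect h w i) j = 0" "centre (defect h w i) i = 0"
      using ip_eq_0D that by blast+
    then have "defect h w i j = defect h w i i" unfolding centre_def by simp
    also have "defect h w i i = 0" by (simp add: subdiv_def word_map_append sg_map_vertices)
    finally show ?thesis by simp
  qed
  show ?thesis using assms(2,3)
  proof (induction w arbitrary: j rule: rev_induct)
    case (snoc i w)
    then have "vals h (w @ [i]) j = subdiv i (vals h w) j" by (intro zero) auto
    also have "\<dots> = subdivs [i] (subdivs w (vals h [])) j"
      using snoc subdivs_cong[of "vals h w" "subdivs w (vals h [])" "[i]" j] by simp
    finally show ?case by simp
  qed simp
qed

lemma word_map_tendsto:
  assumes "\<omega> \<in> addr" "i \<in> S"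
  shows "(\<lambda>n. sg_word_map p (initial n \<omega>) (p i)) \<longlonglongrightarrow> pt \<omega>"
proof (rule metric_LIMSEQ_I)
  fix e :: real assume "e > 0"
  then obtain n where n: "\<forall>\<omega>\<in>addr. \<forall>\<omega>'\<in>addr. \<forall>m\<ge>n. initial m \<omega> = initial m \<omega>' \<longrightarrow> dist (pt \<omega>) (pt \<omega>') < e"
    using cell_small by blast
  have "dist (sg_word_map p (initial m \<omega>) (p i)) (pt \<omega>) < e" if "m \<ge> n" for m
  proof -
    have a: "follow (initial m \<omega>) (\<lambda>_. i) \<in> addr"
      using assms by (intro follow_in_addr set_initial) auto
    have "initial m (follow (initial m \<omega>) (\<lambda>_. i)) = initial m \<omega>"
      using initial_follow[of "initial m \<omega>"] by simp
    then show ?thesis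
      using n a assms that word_map_vertex[OF set_initial[OF assms(1)] assms(2), of m] by simp
  qed
  then show "\<exists>n0. \<forall>n\<ge>n0. dist (sg_word_map p (initial n \<omega>) (p i)) (pt \<omega>) < e" by blast
qed

lemma harmonic_eq_spline:
  assumes "h \<in> sg_harmonic N p" shows "h = spline 0 h"
proof
  fix x
  have h: "continuous_on K h" "\<And>x. x \<notin> K \<Longrightarrow> h x = 0"
    using assms by (auto simp: sg_harmonic_def sg_domain_def sg_continuous_def)
  show "h x = spline 0 h x"
  proof (cases "x \<in> K")
    case True
    then obtain \<omega> where \<omega>: "\<omega> \<in> addr" "x = pt \<omega>" by (auto simp: gasket_eq)
    have "(\<lambda>n. h (sg_word_map p (initial n \<omega>) (p 1))) \<longlonglongrightarrow> h x"
    proof (rule continuous_on_tendsto_compose[OF h(1)])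
      show "(\<lambda>n. sg_word_map p (initial n \<omega>) (p 1)) \<longlonglongrightarrow> x"
        using \<omega> word_map_tendsto by simp
      show "\<forall>\<^sub>F n in sequentially. sg_word_map p (initial n \<omega>) (p 1) \<in> K"
        using \<omega> by (intro always_eventually allI word_map_in_gasket set_initial vertex_in_gasket) auto
    qed (rule True)
    moreover have "h (sg_word_map p (initial n \<omega>) (p 1)) = subdivs (initial n \<omega>) (vals h []) 1" for n
      using harmonic_vals[OF assms set_initial[OF \<omega>(1)], of 1] by simp
    ultimately have "(\<lambda>n. subdivs (initial n \<omega>) (vals h []) 1) \<longlonglongrightarrow> h x" by simp
    then have "h x = harm (vals h []) \<omega>"
      using harm_tendsto[OF \<omega>(1)] by (rule LIMSEQ_unique)
    then show ?thesis using \<omega> by (simp add: spline_pt interp_def)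
  qed (simp add: h on_gasket_def)
qed

lemma harmonic_unique:
  assumes "h \<in> sg_harmonic N p" "g \<in> sg_harmonic N p" "\<And>i. i \<in> S \<Longrightarrow> h (p i) = g (p i)"
  shows "h = g"
proof -
  have "interp 0 h \<omega> = interp 0 g \<omega>" if "\<omega> \<in> addr" for \<omega>
    unfolding interp_def using assms(3) that by (intro harm_cong) auto
  then have "spline 0 h x = spline 0 g x" for x
    by (cases "x \<in> K") (auto simp: spline_pt gasket_eq, simp add: on_gasket_def gasket_eq)
  then show ?thesis
    using harmonic_eq_spline[OF assms(1)] harmonic_eq_spline[OF assms(2)] by (metis ext)
qed

lemma harmonic_exists: "\<exists>h\<in>sg_harmonic N p. \<forall>i\<in>S. h (p i) = u i"
proof -
  have inj: "inj_on p S" using nondegenerate by (simp add: sg_nondegenerate_def)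
  define f where "f = (\<lambda>x. u (the_inv_into S p x))"
  have "spline 0 f (p i) = u i" if "i \<in> S" for i
    using vals_spline_le[of "[]" 0 i f] that inj by (simp add: f_def the_inv_into_f_f)
  then show ?thesis using harmonic_spline by blast
qed

lemma basis_harmonic:
  "sg_basis_harmonic N p k \<in> sg_harmonic N p"
  "i \<in> S \<Longrightarrow> sg_basis_harmonic N p k (p i) = (if i = k then 1 else 0)"
proof -
  have "\<exists>!h. h \<in> sg_harmonic N p \<and> (\<forall>i\<in>S. h (p i) = (if i = k then 1 else 0))"
  proof (rule ex_ex1I)
    show "\<exists>h. h \<in> sg_harmonic N p \<and> (\<forall>i\<in>S. h (p i) = (if i = k then 1 else 0))"
      using harmonic_exists[of "\<lambda>i. if i = k then 1 else 0"] by blast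
  qed (auto intro: harmonic_unique)
  from theI'[OF this] show "sg_basis_harmonic N p k \<in> sg_harmonic N p"
    "i \<in> S \<Longrightarrow> sg_basis_harmonic N p k (p i) = (if i = k then 1 else 0)"
    unfolding sg_basis_harmonic_def by auto
qed

section \<open>Measures with prescribed cell masses\<close>

definition cell_weight :: "(nat list \<Rightarrow> real) \<Rightarrow> bool" where
  "cell_weight m \<longleftrightarrow> (\<forall>w. set w \<subseteq> S \<longrightarrow> 0 \<le> m w \<and> (\<Sum>i\<in>S. m (w @ [i])) = m w)"

text \<open>
  Distinct cells of one level may share vertices, so additivity of \<open>m\<close> entails that such a
  measure does not charge these intersections (\<open>cells_ae_disjoint\<close>).
\<close>

definition cell_measure :: "'a measure \<Rightarrow> (nat list \<Rightarrow> real) \<Rightarrow> bool" where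
  "cell_measure \<mu> m \<longleftrightarrow> sets \<mu> = sets (sg_borel N p) \<and> (\<forall>w. set w \<subseteq> S \<longrightarrow> emeasure \<mu> (cell w) = ennreal (m w))"

lemma gasket_borel [measurable]: "K \<in> sets borel"
  using compact_gasket by (simp add: borel_compact)

lemma space_sg_borel: "space (sg_borel N p) = K"
  by (simp add: sg_borel_def space_restrict_space)

lemma sets_sg_borel: "A \<in> sets (sg_borel N p) \<longleftrightarrow> A \<subseteq> K \<and> A \<in> sets borel"
  by (simp add: sg_borel_def sets_restrict_space_iff)

lemma cell_subset: "set w \<subseteq> S \<Longrightarrow> cell w \<subseteq> K"
  using word_map_in_gasket by blast

lemma cell_sets: "set w \<subseteq> S \<Longrightarrow> cell w \<in> sets (sg_borel N p)"
  using cell_subset compact_cell by (simp add: sets_sg_borel borel_compact)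

text \<open>
  The left end of the strip of \<open>w\<close>: the children of a strip are lined up from left to right in the
  order of their letters, with lengths \<open>m\<close>.
\<close>

definition lower :: "(nat list \<Rightarrow> real) \<Rightarrow> nat list \<Rightarrow> real" where
  "lower m w = (\<Sum>k<length w. \<Sum>j\<in>{j\<in>S. j < w ! k}. m (take k w @ [j]))"

abbreviation strip :: "(nat list \<Rightarrow> real) \<Rightarrow> nat list \<Rightarrow> real set" where
  "strip m w \<equiv> {lower m w..<lower m w + m w}"

lemma lower_append: "lower m (w @ [i]) = lower m w + (\<Sum>j\<in>{j\<in>S. j < i}. m (w @ [j]))"
  by (simp add: lower_def nth_append)

text \<open>
  These cells exhaust an open set as the level grows. This passes relations between measures from
  cells to open sets.
\<close>

definition inner_cells :: "nat \<Rightarrow> 'a set \<Rightarrow> nat list set" where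
  "inner_cells n U = {w \<in> sg_words N n. cell w \<subseteq> U}"

context
  fixes m :: "nat list \<Rightarrow> real"
  assumes m: "cell_weight m"
begin

lemma weight_nonneg: "set w \<subseteq> S \<Longrightarrow> 0 \<le> m w"
  and weight_sum: "set w \<subseteq> S \<Longrightarrow> (\<Sum>i\<in>S. m (w @ [i])) = m w"
  using m by (auto simp: cell_weight_def)

lemma child_upper:
  assumes "set w \<subseteq> S" "i \<in> S"
  shows "lower m (w @ [i]) + m (w @ [i]) = lower m w + (\<Sum>j\<in>{j\<in>S. j \<le> i}. m (w @ [j]))"
proof -
  have "{j \<in> S. j \<le> i} = insert i {j \<in> S. j < i}" using assms by auto
  then show ?thesis by (simp add: lower_append)
qed

lemma partial_weight_mono:
  assumes "set w \<subseteq> S" "A \<subseteq> B" "B \<subseteq> S"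
  shows "(\<Sum>j\<in>A. m (w @ [j])) \<le> (\<Sum>j\<in>B. m (w @ [j]))"
  using assms finite_subset[OF assms(3)] by (intro sum_mono2) (auto intro!: weight_nonneg)

lemma strip_child:
  assumes "set w \<subseteq> S" "i \<in> S" shows "strip m (w @ [i]) \<subseteq> strip m w"
proof -
  have "0 \<le> (\<Sum>j\<in>{j\<in>S. j < i}. m (w @ [j]))"
    using assms by (intro sum_nonneg weight_nonneg) auto
  then have 1: "lower m w \<le> lower m (w @ [i])" by (simp add: lower_append)
  have "lower m (w @ [i]) + m (w @ [i]) \<le> lower m w + m w"
    unfolding child_upper[OF assms] using weight_sum[OF assms(1)]
      partial_weight_mono[OF assms(1), of "{j \<in> S. j \<le> i}" S] by auto
  with 1 show ?thesis by auto
qed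

lemma strip_child_ex:
  assumes "set w \<subseteq> S" "x \<in> strip m w" shows "\<exists>i\<in>S. x \<in> strip m (w @ [i])"
proof -
  define A where "A = {i\<in>S. lower m (w @ [i]) \<le> x}"
  have "(\<Sum>j\<in>{j\<in>S. j < 1}. m (w @ [j])) = 0"
    by (rule sum.neutral) (auto simp: sg_letters_def)
  then have "1 \<in> A" using assms unfolding A_def lower_append by simp
  have fin: "finite A" by (auto simp: A_def)
  define i where "i = Max A"
  have i: "i \<in> A" unfolding i_def using fin \<open>1 \<in> A\<close> by (intro Max_in) auto
  then have iS: "i \<in> S" by (simp add: A_def)
  have "x < lower m (w @ [i]) + m (w @ [i])"
  proof (cases "Suc i \<in> S")
    case True
    have "Suc i \<notin> A" using Max_ge[OF fin, of "Suc i"] by (auto simp: i_def)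
    then have "x < lower m (w @ [Suc i])" using True by (simp add: A_def)
    moreover have "{j \<in> S. j < Suc i} = {j \<in> S. j \<le> i}" by auto
    ultimately show ?thesis unfolding child_upper[OF assms(1) iS] by (simp add: lower_append)
  next
    case False
    then have "{j \<in> S. j \<le> i} = S" using iS by (auto simp: sg_letters_def)
    then show ?thesis unfolding child_upper[OF assms(1) iS] using assms(2) weight_sum[OF assms(1)] by simp
  qed
  then show ?thesis using i by (auto simp: A_def)
qed

lemma strip_child_unique:
  assumes "set w \<subseteq> S" "i \<in> S" "j \<in> S" "x \<in> strip m (w @ [i])" "x \<in> strip m (w @ [j])"
  shows "i = j"
proof -
  have "False" if "i < j" "i \<in> S" "j \<in> S" "x \<in> strip m (w @ [i])" "x \<in> strip m (w @ [j])" for i j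
  proof -
    have "lower m (w @ [i]) + m (w @ [i]) \<le> lower m (w @ [j])"
      unfolding child_upper[OF assms(1) that(2)] unfolding lower_append
      by (intro add_left_mono partial_weight_mono[OF assms(1)]) (use that in auto)
    then show False using that by auto
  qed
  then show ?thesis using assms by (meson linorder_neqE_nat)
qed

lemma strip_initial_ex:
  assumes "x \<in> strip m []" shows "\<exists>\<omega>\<in>addr. \<forall>n. x \<in> strip m (initial n \<omega>)"
proof -
  define P where "P = (\<lambda>n w. set w \<subseteq> S \<and> length w = n \<and> x \<in> strip m w)"
  have "\<exists>f. \<forall>n. P n (f n) \<and> (\<exists>i. f (Suc n) = f n @ [i])"
  proof (rule dependent_nat_choice)
    show "\<exists>w. P 0 w" using assms by (intro exI[of _ "[]"]) (simp add: P_def)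
    fix w n assume P: "P n w"
    then obtain i where "i \<in> S" "x \<in> strip m (w @ [i])" using strip_child_ex[of w x] by (auto simp: P_def)
    then show "\<exists>y. P (Suc n) y \<and> (\<exists>i. y = w @ [i])" using P
      by (intro exI[of _ "w @ [i]"]) (auto simp: P_def)
  qed
  then obtain f where f: "\<And>n. P n (f n)" "\<And>n. \<exists>i. f (Suc n) = f n @ [i]" by blast
  then obtain \<omega> where \<omega>: "\<And>n. f (Suc n) = f n @ [\<omega> n]" by metis
  have "initial n \<omega> = f n" for n
    by (induction n) (use f(1)[of 0] in \<open>auto simp: initial_Suc \<omega> P_def\<close>)
  moreover have "\<omega> n \<in> S" for n using f(1)[of "Suc n"] by (simp add: P_def \<omega>)
  ultimately show ?thesis using f(1) by (intro bexI[of _ \<omega>]) (auto simp: P_def)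
qed

lemma strip_unique:
  assumes "set v \<subseteq> S" "set w \<subseteq> S" "length v = length w" "x \<in> strip m v" "x \<in> strip m w"
  shows "v = w"
  using assms
proof (induction v arbitrary: w rule: rev_induct)
  case (snoc i v)
  then obtain w' j where w: "w = w' @ [j]" by (cases w rule: rev_cases) auto
  have "x \<in> strip m v" "x \<in> strip m w'"
    using strip_child[of v i] strip_child[of w' j] snoc.prems unfolding w by auto
  then have "v = w'" using snoc w by auto
  then show ?case using strip_child_unique[of v i j x] snoc.prems unfolding w by auto
qed simp

lemma strip_subset: "set w \<subseteq> S \<Longrightarrow> strip m w \<subseteq> strip m []"
proof (induction w rule: rev_induct)
  case (snoc i w)
  then show ?case using strip_child[of w i] by auto
qed simp

text \<open>
  The measure is the image of Lebesgue measure under the map that sends a number to the point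
  whose address lists the strips that contain the number. The preimage of a cell is the strip of its
  word up to numbers with eventually constant addresses; these form countably many
  intersections of nested strips, each of length \<open>0\<close>.
\<close>

lemma cell_measure_exists:
  assumes decay: "\<And>\<omega>. \<omega> \<in> addr \<Longrightarrow> (\<lambda>n. m (initial n \<omega>)) \<longlonglongrightarrow> 0"
  shows "\<exists>\<mu>. cell_measure \<mu> m"
proof -
  have "\<forall>x. \<exists>\<omega>. x \<in> strip m [] \<longrightarrow> \<omega> \<in> addr \<and> (\<forall>n. x \<in> strip m (initial n \<omega>))"
    using strip_initial_ex by blast
  then obtain \<Theta> where \<Theta>: "\<And>x. x \<in> strip m [] \<Longrightarrow> \<Theta> x \<in> addr"
    "\<And>x n. x \<in> strip m [] \<Longrightarrow> x \<in> strip m (initial n (\<Theta> x))" unfolding choice_iff by blast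
  have \<Theta>_eq: "initial (length w) (\<Theta> x) = w" if "set w \<subseteq> S" "x \<in> strip m w" for w x
    using that \<Theta>[of x] strip_subset[of w] set_initial[of "\<Theta> x"]
    by (intro strip_unique[of _ _ x]) auto
  define M where "M = restrict_space lborel (strip m [])"
  have spM: "space M = strip m []" by (simp add: M_def space_restrict_space)
  have setsM: "A \<in> sets M \<longleftrightarrow> A \<subseteq> strip m [] \<and> A \<in> sets borel" for A
    by (simp add: M_def sets_restrict_space_iff)
  have emM: "A \<subseteq> strip m [] \<Longrightarrow> emeasure M A = emeasure lborel A" for A
    unfolding M_def by (subst emeasure_restrict_space) auto
  have em_strip: "emeasure M (strip m w) = ennreal (m w)" if "set w \<subseteq> S" for w
    using strip_subset[OF that] weight_nonneg[OF that] by (subst emM) auto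
  define X where "X = (\<lambda>x. pt (\<Theta> x))"
  have "(\<lambda>x. sg_word_map p (initial n (\<Theta> x)) (p 1)) \<in> borel_measurable M" for n
  proof (subst measurable_cong)
    fix x assume x: "x \<in> space M"
    have "(\<Sum>w\<in>sg_words N n. indicator (strip m w) x *\<^sub>R sg_word_map p w (p 1))
        = (\<Sum>w\<in>sg_words N n. if w = initial n (\<Theta> x) then sg_word_map p w (p 1) else 0)"
    proof (intro sum.cong refl)
      fix w assume w: "w \<in> sg_words N n"
      have "x \<in> strip m w \<longleftrightarrow> w = initial n (\<Theta> x)"
        using \<Theta>_eq[of w x] \<Theta>(2)[of x n] x w by (auto simp: spM sg_words_def)
      then show "indicator (strip m w) x *\<^sub>R sg_word_map p w (p 1)
         = (if w = initial n (\<Theta> x) then sg_word_map p w (p 1) else 0)" by auto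
    qed
    also have "\<dots> = sg_word_map p (initial n (\<Theta> x)) (p 1)"
      using initial_in_words[OF \<Theta>(1)] x finite_words by (simp add: spM)
    finally show "sg_word_map p (initial n (\<Theta> x)) (p 1)
       = (\<Sum>w\<in>sg_words N n. indicator (strip m w) x *\<^sub>R sg_word_map p w (p 1))" by simp
  next
    have "strip m w \<in> sets M" if "w \<in> sg_words N n" for w
      using that strip_subset[of w] unfolding setsM sg_words_def by auto
    then show "(\<lambda>x. \<Sum>w\<in>sg_words N n. indicator (strip m w) x *\<^sub>R sg_word_map p w (p 1)) \<in> borel_measurable M"
      by (intro borel_measurable_sum borel_measurable_scaleR borel_measurable_indicator borel_measurable_const)
  qed
  then have "X \<in> borel_measurable M"
    by (rule borel_measurable_LIMSEQ_metric) (use \<Theta>(1) in \<open>auto simp: X_def spM intro!: word_map_tendsto\<close>)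
  then have X: "X \<in> measurable M (sg_borel N p)"
    unfolding sg_borel_def using \<Theta>(1) pt_in_gasket
    by (intro measurable_restrict_space2) (auto simp: spM X_def)
  \<comment> \<open>\<open>J \<omega>\<close> contains the numbers with address \<open>\<omega>\<close>.\<close>
  define J where "J = (\<lambda>\<omega>. \<Inter>n. strip m (initial n \<omega>))"
  have J: "J \<omega> \<in> null_sets M" if "\<omega> \<in> addr" for \<omega>
  proof -
    have sub: "J \<omega> \<subseteq> strip m (initial n \<omega>)" for n by (auto simp: J_def)
    have sets: "J \<omega> \<in> sets M"
      using sub[of 0] unfolding setsM J_def by auto
    have "emeasure M (J \<omega>) \<le> ennreal (m (initial n \<omega>))" for n
      using emeasure_mono[OF sub[of n], of M] strip_subset[OF set_initial[OF that, of n]]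
        em_strip[OF set_initial[OF that, of n]] by (auto simp: setsM)
    moreover have "(\<lambda>n. ennreal (m (initial n \<omega>))) \<longlonglongrightarrow> ennreal 0"
      by (intro tendsto_ennrealI decay that)
    ultimately have "emeasure M (J \<omega>) \<le> 0"
      by (intro LIMSEQ_le_const[of "\<lambda>n. ennreal (m (initial n \<omega>))"]) auto
    then show ?thesis using sets by auto
  qed
  have "(\<Union>\<omega>\<in>tail_constant \<inter> addr. J \<omega>) \<in> null_sets M"
    using countable_tail_constant J by (intro null_sets_UN') auto
  then have ae: "AE x in M. x \<notin> (\<Union>\<omega>\<in>tail_constant \<inter> addr. J \<omega>)" by (rule AE_not_in)
  define \<mu> where "\<mu> = distr M (sg_borel N p) X"
  have "emeasure \<mu> (cell w) = ennreal (m w)" if w: "set w \<subseteq> S" for w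
  proof -
    have "emeasure \<mu> (cell w) = emeasure M (X -` cell w \<inter> space M)"
      unfolding \<mu>_def by (rule emeasure_distr[OF X cell_sets[OF w]])
    also have "\<dots> = emeasure M (strip m w)"
    proof (rule emeasure_eq_AE)
      show "X -` cell w \<inter> space M \<in> sets M" by (rule measurable_sets[OF X cell_sets[OF w]])
      show "strip m w \<in> sets M" using strip_subset[OF w] unfolding setsM by auto
      show "AE x in M. x \<in> X -` cell w \<inter> space M \<longleftrightarrow> x \<in> strip m w"
        using ae AE_space
      proof eventually_elim
        case (elim x)
        then have x: "x \<in> strip m []" by (simp add: spM)
        then have a: "\<Theta> x \<in> addr" "x \<in> J (\<Theta> x)" using \<Theta> by (auto simp: J_def)
        then have nt: "\<Theta> x \<notin> tail_constant" using elim(1) by blast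
        show ?case
        proof
          assume "x \<in> X -` cell w \<inter> space M"
          then obtain \<omega> where \<omega>: "\<omega> \<in> addr" "initial (length w) \<omega> = w" "pt (\<Theta> x) = pt \<omega>"
            by (auto simp: X_def cell_eq[OF w])
          then have "\<Theta> x = \<omega>" using pt_eq_tail_constant[OF a(1)] nt by blast
          then show "x \<in> strip m w" using \<Theta>(2)[OF x, of "length w"] \<omega>(2) by simp
        next
          assume xw: "x \<in> strip m w"
          have "initial (length w) (\<Theta> x) = w" by (rule \<Theta>_eq[OF w xw])
          then have "X x \<in> cell w" unfolding X_def cell_eq[OF w] using a(1) by blast
          then show "x \<in> X -` cell w \<inter> space M" using x by (simp add: spM)
        qed
      qed
    qed
    finally show ?thesis using em_strip[OF w] by simp
  qed
  then show ?thesis by (intro exI[of _ \<mu>]) (simp add: cell_measure_def \<mu>_def)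
qed

lemma weight_sum_words:
  assumes "set v \<subseteq> S"
  shows "(\<Sum>w\<in>sg_words N n. m (v @ w)) = m v"
proof (induction n)
  case (Suc n)
  have "(\<Sum>w\<in>sg_words N (Suc n). m (v @ w)) = (\<Sum>w\<in>sg_words N n. \<Sum>i\<in>S. m ((v @ w) @ [i]))"
    by (simp add: sum_words_Suc)
  also have "\<dots> = (\<Sum>w\<in>sg_words N n. m (v @ w))"
    using assms by (intro sum.cong refl weight_sum) (auto simp: sg_words_def)
  finally show ?case using Suc by simp
qed simp

context
  fixes \<mu> :: "'a measure"
  assumes \<mu>: "cell_measure \<mu> m"
begin

lemma cm_sets: "sets \<mu> = sets (sg_borel N p)"
  and cm_cell: "set w \<subseteq> S \<Longrightarrow> emeasure \<mu> (cell w) = ennreal (m w)"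
  using \<mu> by (auto simp: cell_measure_def)

lemma cm_space: "space \<mu> = K"
  using sets_eq_imp_space_eq[OF cm_sets] by (simp add: space_sg_borel)

lemma cm_cell_sets: "set w \<subseteq> S \<Longrightarrow> cell w \<in> sets \<mu>"
  using cell_sets cm_sets by simp

lemma cm_finite: "finite_measure \<mu>"
  by (rule finite_measureI) (use cm_cell[of "[]"] in \<open>simp add: cm_space\<close>)

lemma cm_measure: "set w \<subseteq> S \<Longrightarrow> measure \<mu> (cell w) = m w"
  by (simp add: measure_def cm_cell weight_nonneg)

lemma cm_total: "measure \<mu> K = m []"
  using cm_measure[of "[]"] by simp

lemma cover_cells:
  assumes "x \<in> K" shows "\<exists>w\<in>sg_words N n. x \<in> cell w"
proof -
  obtain \<omega> where \<omega>: "\<omega> \<in> addr" "x = pt \<omega>" using assms by (auto simp: gasket_eq)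
  have "x \<in> cell (initial n \<omega>)" unfolding cell_eq[OF set_initial[OF \<omega>(1)]] using \<omega> by auto
  then show ?thesis using initial_in_words[OF \<omega>(1)] by blast
qed

text \<open>
  The number of cells of a given level that contain \<open>x\<close> is at least \<open>1\<close>, and its integral equals the
  total mass.
\<close>

lemma cells_ae_disjoint:
  "AE x in \<mu>. (\<Sum>w\<in>sg_words N n. indicator (cell w) x) = (1::real)"
proof -
  interpret finite_measure \<mu> by (rule cm_finite)
  define f where "f = (\<lambda>x. (\<Sum>w\<in>sg_words N n. indicator (cell w) x) - (1::real))"
  have int: "integrable \<mu> (\<lambda>x. indicator (cell w) x :: real)" if "w \<in> sg_words N n" for w
    using that cm_cell_sets[of w] by (intro integrable_real_indicator) (auto simp: sg_words_def less_top[symmetric])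
  have fi: "integrable \<mu> f" unfolding f_def
    using int by (intro Bochner_Integration.integrable_diff Bochner_Integration.integrable_sum) auto
  have "integral\<^sup>L \<mu> f = (\<Sum>w\<in>sg_words N n. m w) - m []"
  proof -
    have "integral\<^sup>L \<mu> f = (\<Sum>w\<in>sg_words N n. integral\<^sup>L \<mu> (\<lambda>x. indicator (cell w) x :: real)) - measure \<mu> K"
      unfolding f_def using int
      by (subst Bochner_Integration.integral_diff) (auto simp: cm_space)
    also have "(\<Sum>w\<in>sg_words N n. integral\<^sup>L \<mu> (\<lambda>x. indicator (cell w) x :: real)) = (\<Sum>w\<in>sg_words N n. m w)"
    proof (intro sum.cong refl)
      fix w assume "w \<in> sg_words N n"
      then have w: "set w \<subseteq> S" by (simp add: sg_words_def)
      then have "cell w \<inter> space \<mu> = cell w" using cell_subset[OF w] cm_space by auto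
      then show "integral\<^sup>L \<mu> (\<lambda>x. indicator (cell w) x :: real) = m w"
        using cm_measure[OF w] by simp
    qed
    finally show ?thesis by (simp add: cm_total)
  qed
  then have "integral\<^sup>L \<mu> f = 0" using weight_sum_words[of "[]" n] by simp
  moreover have nn: "f x \<ge> 0" if x: "x \<in> space \<mu>" for x
  proof -
    obtain v where v: "v \<in> sg_words N n" "x \<in> cell v" using cover_cells x cm_space by blast
    have "indicator (cell v) x \<le> (\<Sum>w\<in>sg_words N n. indicator (cell w) x :: real)"
      by (rule member_le_sum[OF v(1)]) (auto simp: finite_words)
    then show ?thesis using v(2) by (simp add: f_def)
  qed
  ultimately have "AE x in \<mu>. f x = 0"
    using fi integral_nonneg_eq_0_iff_AE[OF fi] AE_I2[of \<mu> "\<lambda>x. 0 \<le> f x"] by auto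
  then show ?thesis by (rule AE_mp) (auto simp: f_def)
qed

lemma cm_integral_close:
  assumes g: "integrable \<mu> g"
    and close: "\<And>w x. w \<in> sg_words N n \<Longrightarrow> x \<in> cell w \<Longrightarrow> \<bar>g x - c w\<bar> \<le> e"
  shows "\<bar>(\<integral>x. g x \<partial>\<mu>) - (\<Sum>w\<in>sg_words N n. c w * m w)\<bar> \<le> e * m []"
proof -
  interpret finite_measure \<mu> by (rule cm_finite)
  have w: "set w \<subseteq> S" "cell w \<in> sets \<mu>" "cell w \<inter> space \<mu> = cell w" if "w \<in> sg_words N n" for w
    using that cm_cell_sets[of w] cell_subset[of w] cm_space by (auto simp: sg_words_def)
  have gi: "integrable \<mu> (\<lambda>x. indicator (cell w) x * g x)" if "w \<in> sg_words N n" for w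
    using integrable_mult_indicator[OF w(2)[OF that] g] by simp
  have ii: "integrable \<mu> (\<lambda>x. indicator (cell w) x :: real)" if "w \<in> sg_words N n" for w
    using w[OF that] by (intro integrable_real_indicator) (auto simp: less_top[symmetric])
  have "(\<integral>x. g x \<partial>\<mu>) = (\<integral>x. (\<Sum>w\<in>sg_words N n. indicator (cell w) x * g x) \<partial>\<mu>)"
  proof (rule integral_cong_AE)
    show "AE x in \<mu>. g x = (\<Sum>w\<in>sg_words N n. indicator (cell w) x * g x)"
      using cells_ae_disjoint[of n] by eventually_elim (simp add: sum_distrib_right[symmetric])
    show "(\<lambda>x. \<Sum>w\<in>sg_words N n. indicator (cell w) x * g x) \<in> borel_measurable \<mu>"
      using gi by (intro borel_measurable_sum borel_measurable_integrable)
  qed (use g in auto)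
  also have "\<dots> = (\<Sum>w\<in>sg_words N n. \<integral>x. indicator (cell w) x * g x \<partial>\<mu>)"
    using gi by (intro Bochner_Integration.integral_sum)
  finally have "(\<integral>x. g x \<partial>\<mu>) - (\<Sum>w\<in>sg_words N n. c w * m w)
      = (\<Sum>w\<in>sg_words N n. (\<integral>x. indicator (cell w) x * g x \<partial>\<mu>) - c w * m w)"
    by (simp add: sum_subtractf)
  also have "\<bar>\<dots>\<bar> \<le> (\<Sum>w\<in>sg_words N n. e * m w)"
  proof (rule order_trans[OF sum_abs], rule sum_mono)
    fix v assume v: "v \<in> sg_words N n"
    have int: "(\<integral>x. d * indicator (cell v) x \<partial>\<mu>) = d * m v" for d
      using w[OF v] cm_measure[OF w(1)[OF v]] by simp
    have "(\<integral>x. indicator (cell v) x * g x \<partial>\<mu>) \<le> (\<integral>x. (c v + e) * indicator (cell v) x \<partial>\<mu>)"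
      by (intro integral_mono gi ii v integrable_mult_right)
         (use close[OF v] in \<open>force simp: indicator_def abs_le_iff\<close>)
    moreover have "(\<integral>x. (c v - e) * indicator (cell v) x \<partial>\<mu>) \<le> (\<integral>x. indicator (cell v) x * g x \<partial>\<mu>)"
      by (intro integral_mono gi ii v integrable_mult_right)
         (use close[OF v] in \<open>force simp: indicator_def abs_le_iff\<close>)
    ultimately show "\<bar>(\<integral>x. indicator (cell v) x * g x \<partial>\<mu>) - c v * m v\<bar> \<le> e * m v"
      unfolding int by (simp add: abs_le_iff algebra_simps)
  qed
  also have "\<dots> = e * m []"
    using weight_sum_words[of "[]" n] by (simp add: sum_distrib_left[symmetric])
  finally show ?thesis .
qed

lemma emeasure_inner_cells:
  assumes "A \<in> sets \<mu>"
  shows "emeasure \<mu> (A \<inter> (\<Union>w\<in>inner_cells n U. cell w)) = (\<Sum>w\<in>inner_cells n U. emeasure \<mu> (A \<inter> cell w))"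
proof -
  let ?I = "inner_cells n U"
  have I: "finite ?I" "?I \<subseteq> sg_words N n" using finite_words by (auto simp: inner_cells_def)
  have c: "cell w \<in> sets \<mu>" if "w \<in> ?I" for w
    using that cm_cell_sets[of w] by (auto simp: inner_cells_def sg_words_def)
  have "emeasure \<mu> (A \<inter> (\<Union>w\<in>?I. cell w)) = (\<integral>\<^sup>+x. indicator (A \<inter> (\<Union>w\<in>?I. cell w)) x \<partial>\<mu>)"
    using assms c I by (subst nn_integral_indicator) auto
  also have "\<dots> = (\<integral>\<^sup>+x. (\<Sum>w\<in>?I. indicator (A \<inter> cell w) x) \<partial>\<mu>)"
  proof (rule nn_integral_cong_AE, use cells_ae_disjoint[of n] in eventually_elim)
    case (elim x)
    have card: "real (card {w \<in> sg_words N n. x \<in> cell w}) = 1"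
      using elim finite_words by (simp add: indicator_def sum.If_cases Int_def)
    then have "card {w \<in> sg_words N n. x \<in> cell w} = 1" by linarith
    then obtain v where v: "{w \<in> sg_words N n. x \<in> cell w} = {v}"
      by (metis card_1_singletonE)
    have "(\<Sum>w\<in>?I. indicator (A \<inter> cell w) x) = (\<Sum>w\<in>?I. if w = v then indicator (A \<inter> cell v) x else 0 :: ennreal)"
      using v I by (intro sum.cong refl) (auto simp: indicator_def)
    also have "\<dots> = indicator (A \<inter> (\<Union>w\<in>?I. cell w)) x"
      using v I by (auto simp: indicator_def)
    finally show ?case by simp
  qed
  also have "\<dots> = (\<Sum>w\<in>?I. emeasure \<mu> (A \<inter> cell w))"
    using assms c by (subst nn_integral_sum) (auto simp: nn_integral_indicator)
  finally show ?thesis .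
qed

end
end

lemma inner_cells_exhaust:
  assumes "open U"
  shows "K \<inter> U = (\<Union>n. \<Union>w\<in>inner_cells n U. cell w)"
    "incseq (\<lambda>n. \<Union>w\<in>inner_cells n U. cell w)"
proof -
  show "K \<inter> U = (\<Union>n. \<Union>w\<in>inner_cells n U. cell w)"
  proof (intro subset_antisym subsetI)
    fix x assume x: "x \<in> K \<inter> U"
    then obtain \<omega> where \<omega>: "\<omega> \<in> addr" "x = pt \<omega>" by (auto simp: gasket_eq)
    obtain e where e: "e > 0" "ball x e \<subseteq> U" using assms x openE by blast
    obtain n where n: "\<forall>\<omega>\<in>addr. \<forall>\<omega>'\<in>addr. \<forall>m\<ge>n. initial m \<omega> = initial m \<omega>' \<longrightarrow> dist (pt \<omega>) (pt \<omega>') < e"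
      using cell_small[OF e(1)] by blast
    have c: "cell (initial n \<omega>) = pt ` {\<omega>' \<in> addr. initial n \<omega>' = initial n \<omega>}"
      using cell_eq[OF set_initial[OF \<omega>(1)], of n] by simp
    have "dist (pt \<omega>) (pt \<omega>') < e" if "\<omega>' \<in> addr" "initial n \<omega>' = initial n \<omega>" for \<omega>'
      using n[rule_format, OF \<omega>(1) that(1) order_refl] that(2) by simp
    then have "cell (initial n \<omega>) \<subseteq> ball x e" unfolding c \<omega>(2) by auto
    moreover have "x \<in> cell (initial n \<omega>)" unfolding c using \<omega> by blast
    ultimately show "x \<in> (\<Union>n. \<Union>w\<in>inner_cells n U. cell w)"
      using e initial_in_words[OF \<omega>(1), of n] by (auto simp: inner_cells_def simp del: image_iff)
  next
    fix x assume "x \<in> (\<Union>n. \<Union>w\<in>inner_cells n U. cell w)"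
    then obtain n w where "w \<in> sg_words N n" "cell w \<subseteq> U" "x \<in> cell w" by (auto simp: inner_cells_def)
    then show "x \<in> K \<inter> U" using cell_subset[of w] by (auto simp: sg_words_def)
  qed
  show "incseq (\<lambda>n. \<Union>w\<in>inner_cells n U. cell w)"
  proof (rule incseq_SucI, rule subsetI)
    fix n x assume "x \<in> (\<Union>w\<in>inner_cells n U. cell w)"
    then obtain w where w: "set w \<subseteq> S" "length w = n" "cell w \<subseteq> U" "x \<in> cell w"
      by (auto simp: inner_cells_def sg_words_def)
    then obtain \<omega> where \<omega>: "\<omega> \<in> addr" "initial n \<omega> = w" "x = pt \<omega>" using cell_eq[OF w(1)] by auto
    have "x \<in> cell (initial (Suc n) \<omega>)"
      using cell_eq[OF set_initial[OF \<omega>(1)], of "Suc n"] \<omega> by auto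
    moreover have "cell (initial (Suc n) \<omega>) \<subseteq> cell w"
      unfolding initial_Suc \<omega>(2) word_map_append image_comp[symmetric]
      using \<omega>(1) word_map_in_gasket[of "[\<omega> n]"] by (intro image_mono) auto
    ultimately show "x \<in> (\<Union>w\<in>inner_cells (Suc n) U. cell w)"
      using w(3) initial_in_words[OF \<omega>(1), of "Suc n"] by (auto simp: inner_cells_def simp del: image_iff)
  qed
qed

lemma inner_cells_sets: "(\<Union>w\<in>inner_cells n U. cell w) \<in> sets (sg_borel N p)"
proof -
  have "finite (inner_cells n U)"
    by (rule finite_subset[OF _ finite_words[of n]]) (auto simp: inner_cells_def)
  then show ?thesis using cell_sets by (intro sets.finite_UN) (auto simp: inner_cells_def sg_words_def)
qed

lemma open_sets: "open U \<Longrightarrow> K \<inter> U \<in> sets (sg_borel N p)"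
  by (simp add: sets_sg_borel)

lemma measure_eq_open:
  assumes "sets \<mu> = sets (sg_borel N p)" "sets \<nu> = sets (sg_borel N p)"
    and "\<And>U. open U \<Longrightarrow> emeasure \<mu> (K \<inter> U) = emeasure \<nu> (K \<inter> U)"
    and "emeasure \<mu> K \<noteq> \<infinity>"
  shows "\<mu> = \<nu>"
proof (rule measure_eqI_generator_eq[of "(\<inter>) K ` {U. open U}" K _ _ "\<lambda>_. K"])
  have "sets (sg_borel N p) = sigma_sets K ((\<inter>) K ` {U. open U})"
    unfolding sg_borel_def sets_restrict_space borel_def
    using sigma_sets_Int[of K UNIV "{U. open U}"] gasket_borel
    by (simp add: borel_def)
  then show "sets \<mu> = sigma_sets K ((\<inter>) K ` {U. open U})" "sets \<nu> = sigma_sets K ((\<inter>) K ` {U. open U})"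
    using assms by simp_all
  show "Int_stable ((\<inter>) K ` {U. open U})"
  proof (rule Int_stableI)
    fix a b assume "a \<in> (\<inter>) K ` {U. open U}" "b \<in> (\<inter>) K ` {U. open U}"
    then obtain U V where "open U" "open V" "a = K \<inter> U" "b = K \<inter> V" by auto
    then show "a \<inter> b \<in> (\<inter>) K ` {U. open U}" by (intro image_eqI[of _ _ "U \<inter> V"]) auto
  qed
  show "range (\<lambda>_. K) \<subseteq> (\<inter>) K ` {U. open U}" by (auto intro!: image_eqI[of _ _ UNIV])
qed (use assms in auto)

lemma emeasure_open_SUP:
  assumes "sets \<mu> = sets (sg_borel N p)" "open U" "A \<in> sets \<mu>"
  shows "emeasure \<mu> (A \<inter> U) = (SUP n. emeasure \<mu> (A \<inter> (\<Union>w\<in>inner_cells n U. cell w)))"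
proof -
  have "A \<subseteq> K" using assms by (simp add: sets_sg_borel)
  then have "A \<inter> U = A \<inter> (K \<inter> U)" by auto
  then have "A \<inter> U = (\<Union>n. A \<inter> (\<Union>w\<in>inner_cells n U. cell w))"
    unfolding inner_cells_exhaust(1)[OF assms(2)] Int_UN_distrib .
  moreover have "(SUP n. emeasure \<mu> (A \<inter> (\<Union>w\<in>inner_cells n U. cell w)))
      = emeasure \<mu> (\<Union>n. A \<inter> (\<Union>w\<in>inner_cells n U. cell w))"
  proof (rule SUP_emeasure_incseq)
    show "range (\<lambda>n. A \<inter> (\<Union>w\<in>inner_cells n U. cell w)) \<subseteq> sets \<mu>"
      using inner_cells_sets assms by (auto intro!: sets.Int)
    show "incseq (\<lambda>n. A \<inter> (\<Union>w\<in>inner_cells n U. cell w))"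
      using inner_cells_exhaust(2)[OF assms(2)] by (fastforce simp: mono_def)
  qed
  ultimately show ?thesis by simp
qed

lemma cell_measure_unique:
  assumes m: "cell_weight m" and \<mu>: "cell_measure \<mu> m" and \<nu>: "cell_measure \<nu> m"
  shows "\<mu> = \<nu>"
proof (rule measure_eq_open)
  show s: "sets \<mu> = sets (sg_borel N p)" "sets \<nu> = sets (sg_borel N p)"
    using \<mu> \<nu> by (auto simp: cell_measure_def)
  show "emeasure \<mu> K \<noteq> \<infinity>" using \<mu> by (auto simp: cell_measure_def dest: spec[of _ "[]"])
  have Ks: "K \<in> sets (sg_borel N p)" by (simp add: sets_sg_borel)
  have c: "K \<inter> cell w = cell w" if "w \<in> inner_cells n U" for w n U
  proof -
    have "set w \<subseteq> S" using that by (simp add: inner_cells_def sg_words_def)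
    then show ?thesis using cell_subset by blast
  qed
  fix U :: "'a set" assume U: "open U"
  have "emeasure \<mu> (K \<inter> (\<Union>w\<in>inner_cells n U. cell w)) = emeasure \<nu> (K \<inter> (\<Union>w\<in>inner_cells n U. cell w))" for n
  proof -
    have "(\<Sum>w\<in>inner_cells n U. emeasure \<mu> (K \<inter> cell w)) = (\<Sum>w\<in>inner_cells n U. emeasure \<nu> (K \<inter> cell w))"
    proof (rule sum.cong[OF refl])
      fix w assume w: "w \<in> inner_cells n U"
      then have "set w \<subseteq> S" by (simp add: inner_cells_def sg_words_def)
      then show "emeasure \<mu> (K \<inter> cell w) = emeasure \<nu> (K \<inter> cell w)"
        unfolding c[OF w] using \<mu> \<nu> by (simp add: cell_measure_def)
    qed
    then show ?thesis
      using Ks s by (subst emeasure_inner_cells[OF m \<mu>], simp, subst emeasure_inner_cells[OF m \<nu>]) simp_all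
  qed
  then show "emeasure \<mu> (K \<inter> U) = emeasure \<nu> (K \<inter> U)"
    using Ks s by (subst (1 2) emeasure_open_SUP[OF _ U]) simp_all
qed

lemma weighted_sum_measure:
  fixes M :: "'i \<Rightarrow> 'a measure"
  assumes "\<And>i. i \<in> I \<Longrightarrow> sets (M i) = sets (sg_borel N p)" "A \<in> sets (sg_borel N p)"
  shows "emeasure (measure_of K (sets (sg_borel N p)) (\<lambda>A. \<Sum>i\<in>I. c i * emeasure (M i) A)) A
     = (\<Sum>i\<in>I. c i * emeasure (M i) A)"
proof (rule emeasure_measure_of_sigma[OF _ _ _ assms(2)])
  show "sigma_algebra K (sets (sg_borel N p))"
    using sets.sigma_algebra_axioms[of "sg_borel N p"] by (simp add: space_sg_borel)
  show "positive (sets (sg_borel N p)) (\<lambda>A. \<Sum>i\<in>I. c i * emeasure (M i) A)"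
    by (simp add: positive_def)
  show "countably_additive (sets (sg_borel N p)) (\<lambda>A. \<Sum>i\<in>I. c i * emeasure (M i) A)"
  proof (rule countably_additiveI)
    fix F :: "nat \<Rightarrow> 'a set" assume F: "range F \<subseteq> sets (sg_borel N p)" "disjoint_family F"
    have "(\<Sum>n. \<Sum>i\<in>I. c i * emeasure (M i) (F n)) = (\<Sum>i\<in>I. \<Sum>n. c i * emeasure (M i) (F n))"
      by (rule suminf_sum) simp
    also have "\<dots> = (\<Sum>i\<in>I. c i * emeasure (M i) (\<Union>n. F n))"
      using assms(1) F by (intro sum.cong refl) (simp add: suminf_emeasure)
    finally show "(\<Sum>n. \<Sum>i\<in>I. c i * emeasure (M i) (F n)) = (\<Sum>i\<in>I. c i * emeasure (M i) (\<Union>n. F n))" .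
  qed
qed

section \<open>Energy measures of harmonic functions\<close>

lemma cell_weight_mass: "balanced x \<Longrightarrow> cell_weight (mass x)"
  by (simp add: cell_weight_def mass_nonneg mass_append)

lemma cell_measure_mass_exists:
  assumes "balanced x" shows "\<exists>\<mu>. cell_measure \<mu> (mass x)"
proof (rule cell_measure_exists[OF cell_weight_mass[OF assms]])
  fix \<omega> assume \<omega>: "\<omega> \<in> addr"
  have "(\<lambda>n. 2 * (real N + 1) * ip x x * decay ^ n) \<longlonglongrightarrow> 2 * (real N + 1) * ip x x * 0"
    using decay by (intro tendsto_intros LIMSEQ_power_zero) auto
  then have "(\<lambda>n. 2 * (real N + 1) * ip x x * decay ^ n) \<longlonglongrightarrow> 0" by simp
  then show "(\<lambda>n. mass x (initial n \<omega>)) \<longlonglongrightarrow> 0"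
    by (rule tendsto_sandwich[OF always_eventually always_eventually tendsto_const, rotated 2])
       (use mass_le[OF assms set_initial[OF \<omega>]] in \<open>auto simp: mass_nonneg\<close>)
qed

definition nu :: "(nat \<Rightarrow> real) \<Rightarrow> 'a measure" where
  "nu x = (SOME \<mu>. cell_measure \<mu> (mass x))"

lemma nu: "balanced x \<Longrightarrow> cell_measure (nu x) (mass x)"
  unfolding nu_def by (rule someI_ex) (rule cell_measure_mass_exists)

lemma cells_osc:
  assumes "continuous_on K f" "e > 0"
  shows "\<exists>n. \<forall>m\<ge>n. \<forall>w\<in>sg_words N m. \<forall>x\<in>cell w. \<forall>y\<in>cell w. \<bar>f x - f y\<bar> < (e::real)"
proof -
  obtain d where d: "d > 0" "\<And>x y. x \<in> K \<Longrightarrow> y \<in> K \<Longrightarrow> dist y x < d \<Longrightarrow> dist (f y) (f x) < e"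
    using compact_uniformly_continuous[OF assms(1) compact_gasket] assms(2)
    unfolding uniformly_continuous_on_def by metis
  obtain n where n: "\<forall>\<omega>\<in>addr. \<forall>\<omega>'\<in>addr. \<forall>m\<ge>n. initial m \<omega> = initial m \<omega>' \<longrightarrow> dist (pt \<omega>) (pt \<omega>') < d"
    using cell_small[OF d(1)] by blast
  have "\<bar>f x - f y\<bar> < e" if m: "m \<ge> n" and "w \<in> sg_words N m" and xy: "x \<in> cell w" "y \<in> cell w" for m w x y
  proof -
    have w: "set w \<subseteq> S" "length w = m" using that by (auto simp: sg_words_def)
    obtain \<omega> \<omega>' where \<omega>: "\<omega> \<in> addr" "\<omega>' \<in> addr" "initial m \<omega> = w" "initial m \<omega>' = w" "x = pt \<omega>" "y = pt \<omega>'"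
      using xy unfolding cell_eq[OF w(1)] w(2) by auto
    have "dist (pt \<omega>) (pt \<omega>') < d"
      using n[rule_format, OF \<omega>(1,2) m] \<omega>(3,4) by simp
    then show ?thesis using d(2)[of y x] \<omega> pt_in_gasket by (simp add: dist_real_def)
  qed
  then show ?thesis by blast
qed

lemma continuous_bounded:
  assumes "f \<in> sg_continuous N p" shows "\<exists>B\<ge>0. \<forall>x\<in>K. \<bar>f x\<bar> \<le> B"
proof -
  have "bounded (f ` K)"
    using assms compact_continuous_image[OF _ compact_gasket] compact_imp_bounded by (auto simp: sg_continuous_def)
  then obtain B where "\<forall>y\<in>f ` K. norm y \<le> B" by (auto simp: bounded_iff)
  then show ?thesis by (intro exI[of _ "max B 0"]) (auto simp: max_def)
qed

lemma integrable_continuous: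
  assumes "f \<in> sg_continuous N p" "finite_measure \<mu>" "sets \<mu> = sets (sg_borel N p)"
  shows "integrable \<mu> f"
proof -
  interpret finite_measure \<mu> by fact
  obtain B where B: "\<And>x. x \<in> K \<Longrightarrow> \<bar>f x\<bar> \<le> B" using continuous_bounded[OF assms(1)] by blast
  have "space \<mu> = K" using sets_eq_imp_space_eq[OF assms(3)] by (simp add: space_sg_borel)
  moreover have "f \<in> borel_measurable \<mu>"
  proof -
    have "f \<in> borel_measurable (sg_borel N p)"
      unfolding sg_borel_def using assms(1)
      by (intro borel_measurable_continuous_on_restrict) (simp add: sg_continuous_def)
    then show ?thesis using measurable_cong_sets[OF assms(3) refl] by blast
  qed
  ultimately show ?thesis using B by (intro integrable_const_bound[of _ B]) auto
qed

lemma vertex_in_cell: "set w \<subseteq> S \<Longrightarrow> i \<in> S \<Longrightarrow> sg_word_map p w (p i) \<in> cell w"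
  using vertex_in_gasket by auto

definition vertex_form :: "(nat \<Rightarrow> real) \<Rightarrow> (nat \<Rightarrow> real) \<Rightarrow> real" where
  "vertex_form u v = (1 / 2) * (\<Sum>i\<in>S. \<Sum>j\<in>S. (u i - u j) * (v i - v j))"

definition level_form :: "('a \<Rightarrow> real) \<Rightarrow> ('a \<Rightarrow> real) \<Rightarrow> nat \<Rightarrow> real" where
  "level_form f g m = rr ^ m * (\<Sum>w\<in>sg_words N m. vertex_form (vals f w) (vals g w))"

lemma level_energy_add:
  "sg_level_energy N p (\<lambda>x. f x + g x) m
     = sg_level_energy N p f m + sg_level_energy N p g m + 2 * level_form f g m"
proof -
  have "vertex_energy (\<lambda>i. u i + v i) = vertex_energy u + vertex_energy v + 2 * vertex_form u v" for u v
    unfolding vertex_energy_def vertex_form_def sum_distrib_left sum.distrib[symmetric]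
    by (intro sum.cong refl) (simp add: power2_eq_square field_simps)
  then show ?thesis
    by (simp add: level_energy_eq level_form_def sum.distrib sum_distrib_left algebra_simps)
qed

lemma sg_form_tendsto:
  assumes "f \<in> sg_domain N p" "g \<in> sg_domain N p" "(\<lambda>x. f x + g x) \<in> sg_domain N p"
  shows "level_form f g \<longlonglongrightarrow> sg_form N p f g"
proof -
  have "(\<lambda>m. (1/2) * (sg_level_energy N p (\<lambda>x. f x + g x) m - sg_level_energy N p f m - sg_level_energy N p g m))
     \<longlonglongrightarrow> sg_form N p f g"
    unfolding sg_form_def by (intro tendsto_intros level_energy_tendsto assms)
  then show ?thesis by (simp add: level_energy_add)
qed

lemma vertex_energy_le:
  assumes "\<And>i j. i \<in> S \<Longrightarrow> j \<in> S \<Longrightarrow> (u i - u j)\<^sup>2 \<le> a * (v i - v j)\<^sup>2 + b * (z i - z j)\<^sup>2"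
  shows "vertex_energy u \<le> a * vertex_energy v + b * vertex_energy z"
proof -
  have "vertex_energy u \<le> (1/2) * (\<Sum>i\<in>S. \<Sum>j\<in>S. a * (v i - v j)\<^sup>2 + b * (z i - z j)\<^sup>2)"
    unfolding vertex_energy_def by (intro mult_left_mono sum_mono assms) auto
  also have "\<dots> = a * vertex_energy v + b * vertex_energy z"
    by (simp add: vertex_energy_def sum.distrib sum_distrib_left algebra_simps)
  finally show ?thesis .
qed

lemma level_energy_le:
  assumes "\<And>w. w \<in> sg_words N m \<Longrightarrow> vertex_energy (vals f w) \<le> a * vertex_energy (vals g w) + b * vertex_energy (vals h w)"
  shows "sg_level_energy N p f m \<le> a * sg_level_energy N p g m + b * sg_level_energy N p h m"
proof -
  have "sg_level_energy N p f m \<le> rr ^ m * (\<Sum>w\<in>sg_words N m. a * vertex_energy (vals g w) + b * vertex_energy (vals h w))"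
    unfolding level_energy_eq by (intro mult_left_mono sum_mono assms zero_le_power) auto
  also have "\<dots> = a * sg_level_energy N p g m + b * sg_level_energy N p h m"
    by (simp add: level_energy_eq sum.distrib sum_distrib_left algebra_simps)
  finally show ?thesis .
qed

lemma domain_leI:
  assumes "f \<in> sg_continuous N p" "g \<in> sg_domain N p" "h \<in> sg_domain N p" "a \<ge> 0" "b \<ge> 0"
    and "\<And>m w. w \<in> sg_words N m \<Longrightarrow> vertex_energy (vals f w) \<le> a * vertex_energy (vals g w) + b * vertex_energy (vals h w)"
  shows "f \<in> sg_domain N p"
proof -
  obtain B C where "\<And>m. sg_level_energy N p g m \<le> B" "\<And>m. sg_level_energy N p h m \<le> C"
    using assms(2,3) by (auto simp: domain_iff)
  then have le: "a * sg_level_energy N p g m + b * sg_level_energy N p h m \<le> a * B + b * C" for m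
    using assms(4,5) by (intro add_mono mult_left_mono) auto
  have "sg_level_energy N p f m \<le> a * B + b * C" for m
    by (rule order_trans[OF level_energy_le[OF assms(6)] le])
  then show ?thesis unfolding domain_iff using assms(1) by blast
qed

lemma domain_add:
  assumes "f \<in> sg_domain N p" "g \<in> sg_domain N p" shows "(\<lambda>x. f x + g x) \<in> sg_domain N p"
proof (rule domain_leI[OF _ assms, of _ 2 2])
  show "(\<lambda>x. f x + g x) \<in> sg_continuous N p"
    using assms by (auto simp: sg_domain_def sg_continuous_def intro!: continuous_on_add)
  have "(a + b)\<^sup>2 \<le> 2 * a\<^sup>2 + 2 * b\<^sup>2" for a b :: real
    using zero_le_power2[of "a - b"] by (simp add: power2_eq_square algebra_simps)
  then show "vertex_energy (vals (\<lambda>x. f x + g x) w) \<le> 2 * vertex_energy (vals f w) + 2 * vertex_energy (vals g w)" for w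
    by (intro vertex_energy_le) (simp add: add_diff_add)
qed auto

lemma domain_mult:
  assumes "f \<in> sg_domain N p" "g \<in> sg_domain N p" shows "(\<lambda>x. f x * g x) \<in> sg_domain N p"
proof -
  have fg: "f \<in> sg_continuous N p" "g \<in> sg_continuous N p" using assms by (auto simp: sg_domain_def)
  obtain A B where AB: "A \<ge> 0" "B \<ge> 0" "\<And>x. x \<in> K \<Longrightarrow> \<bar>f x\<bar> \<le> A" "\<And>x. x \<in> K \<Longrightarrow> \<bar>g x\<bar> \<le> B"
    using continuous_bounded[OF fg(1)] continuous_bounded[OF fg(2)] by blast
  show ?thesis
  proof (rule domain_leI[OF _ assms, of _ "2 * B\<^sup>2" "2 * A\<^sup>2"])
    show "(\<lambda>x. f x * g x) \<in> sg_continuous N p"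
      using fg by (auto simp: sg_continuous_def intro!: continuous_on_mult)
    fix m w assume "w \<in> sg_words N m"
    then have w: "set w \<subseteq> S" by (simp add: sg_words_def)
    show "vertex_energy (vals (\<lambda>x. f x * g x) w) \<le> 2 * B\<^sup>2 * vertex_energy (vals f w) + 2 * A\<^sup>2 * vertex_energy (vals g w)"
    proof (rule vertex_energy_le)
      fix i j assume ij: "i \<in> S" "j \<in> S"
      define a a' b b' where "a = vals f w i" and "a' = vals f w j" and "b = vals g w i" and "b' = vals g w j"
      have K: "sg_word_map p w (p i) \<in> K" "sg_word_map p w (p j) \<in> K"
        using w ij by (auto intro!: word_map_in_gasket vertex_in_gasket)
      have b: "b\<^sup>2 \<le> B\<^sup>2" and a': "a'\<^sup>2 \<le> A\<^sup>2"
        using AB(1,2) AB(4)[OF K(1)] AB(3)[OF K(2)] by (simp_all add: a'_def b_def abs_le_square_iff[symmetric])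
      have "a * b - a' * b' = b * (a - a') + a' * (b - b')" by (simp add: algebra_simps)
      then have "(a * b - a' * b')\<^sup>2 \<le> 2 * (b * (a - a'))\<^sup>2 + 2 * (a' * (b - b'))\<^sup>2"
        using zero_le_power2[of "b * (a - a') - a' * (b - b')"] by (simp add: power2_eq_square algebra_simps)
      also have "\<dots> \<le> 2 * B\<^sup>2 * (a - a')\<^sup>2 + 2 * A\<^sup>2 * (b - b')\<^sup>2"
        using mult_right_mono[OF b, of "(a - a')\<^sup>2"] mult_right_mono[OF a', of "(b - b')\<^sup>2"]
        by (simp add: power_mult_distrib)
      finally show "(vals (\<lambda>x. f x * g x) w i - vals (\<lambda>x. f x * g x) w j)\<^sup>2
         \<le> 2 * B\<^sup>2 * (vals f w i - vals f w j)\<^sup>2 + 2 * A\<^sup>2 * (vals g w i - vals g w j)\<^sup>2"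
        by (simp add: a_def a'_def b_def b'_def)
    qed
  qed auto
qed

text \<open>
  The right-hand side of the defining identity of energy measures, at one cell: up to the variation
  of \<open>v\<close> on the cell it is twice the energy of \<open>u\<close> times the value of \<open>v\<close>.
\<close>

lemma carre_du_champ:
  "2 * vertex_form u (\<lambda>i. u i * v i) - vertex_form (\<lambda>i. (u i)\<^sup>2) v
   = (1/2) * (\<Sum>i\<in>S. \<Sum>j\<in>S. (u i - u j)\<^sup>2 * (v i + v j))"
  unfolding vertex_form_def sum_distrib_left sum_subtractf[symmetric]
  by (intro sum.cong refl) (simp add: power2_eq_square field_simps)

abbreviation boundary :: "('a \<Rightarrow> real) \<Rightarrow> nat \<Rightarrow> real" where
  "boundary h \<equiv> centre (\<lambda>i. h (p i))"

lemma mass_harmonic: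
  assumes "h \<in> sg_harmonic N p" "set w \<subseteq> S"
  shows "mass (boundary h) w = 2 * rr ^ length w * vertex_energy (vals h w)"
proof -
  have "centre (vals h w) j = expands w (boundary h) j / (real N + 3) ^ length w" if "j \<in> S" for j
  proof -
    have "centre (vals h w) j = centre (subdivs w (vals h [])) j"
      unfolding centre_def using harmonic_vals[OF assms] that by (simp cong: sum.cong)
    then show ?thesis using centre_subdivs[OF assms(2) that, of "vals h []"] by simp
  qed
  then have "vertex_energy (vals h w) = (real N + 1) * (\<Sum>j\<in>S. expands w (boundary h) j / (real N + 3) ^ length w * (expands w (boundary h) j / (real N + 3) ^ length w))"
    unfolding vertex_energy_centre ip_def by simp
  also have "\<dots> = (real N + 1) * ip (expands w (boundary h)) (expands w (boundary h)) / ((real N + 3) ^ length w * (real N + 3) ^ length w)"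
    by (simp add: ip_def sum_divide_distrib[symmetric])
  finally show ?thesis unfolding mass_def
    by (simp add: power_divide power_mult_distrib)
qed

text \<open>
  At level \<open>n\<close> both sides differ from \<open>\<Sum>w. g(x\<^sub>w) mass w\<close>, with \<open>x\<^sub>w\<close> a vertex of the cell of \<open>w\<close>, by at
  most the oscillation of \<open>g\<close> over cells times the total mass.
\<close>

lemma energy_measure_identity:
  assumes h: "h \<in> sg_harmonic N p" and g: "g \<in> sg_domain N p"
  shows "has_bochner_integral (nu (boundary h)) g
     (2 * sg_form N p h (\<lambda>x. h x * g x) - sg_form N p (\<lambda>x. (h x)\<^sup>2) g)"
proof -
  define x where "x = boundary h"
  have bal: "balanced x" unfolding x_def by (rule balanced_centre)
  note weight = cell_weight_mass[OF bal]
  note cm = nu[OF bal]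
  have hd: "h \<in> sg_domain N p" using h by (simp add: sg_harmonic_def)
  have gc: "g \<in> sg_continuous N p" "continuous_on K g" using g by (auto simp: sg_domain_def sg_continuous_def)
  have int: "integrable (nu x) g"
    using integrable_continuous[OF gc(1) cm_finite[OF weight cm] cm_sets[OF weight cm]] .
  define D where "D = (\<lambda>n. 2 * level_form h (\<lambda>x. h x * g x) n - level_form (\<lambda>x. (h x)\<^sup>2) g n)"
  have h2: "(\<lambda>x. (h x)\<^sup>2) \<in> sg_domain N p" using domain_mult[OF hd hd] by (simp add: power2_eq_square)
  have lim1: "D \<longlonglongrightarrow> 2 * sg_form N p h (\<lambda>x. h x * g x) - sg_form N p (\<lambda>x. (h x)\<^sup>2) g"
    unfolding D_def by (intro tendsto_intros sg_form_tendsto domain_add domain_mult hd g h2)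
  have D: "D n = (\<Sum>w\<in>sg_words N n. rr ^ n * ((1/2) * (\<Sum>i\<in>S. \<Sum>j\<in>S. (vals h w i - vals h w j)\<^sup>2 * (vals g w i + vals g w j))))" for n
    unfolding D_def level_form_def carre_du_champ[symmetric]
    by (simp add: sum_distrib_left sum_subtractf algebra_simps)
  have lim2: "D \<longlonglongrightarrow> (\<integral>y. g y \<partial>nu x)"
  proof (rule LIMSEQ_I)
    fix e :: real assume "e > 0"
    define e' where "e' = e / (2 * (mass x [] + 1))"
    have mp: "mass x [] \<ge> 0" by (rule mass_nonneg)
    then have e': "e' > 0" using \<open>e > 0\<close> by (simp add: e'_def)
    obtain n0 where n0: "\<forall>m\<ge>n0. \<forall>w\<in>sg_words N m. \<forall>x\<in>cell w. \<forall>y\<in>cell w. \<bar>g x - g y\<bar> < e'"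
      using cells_osc[OF gc(2) e'] by blast
    have "norm (D n - (\<integral>y. g y \<partial>nu x)) < e" if n: "n \<ge> n0" for n
    proof -
      define c where "c = (\<lambda>w. g (sg_word_map p w (p 1)))"
      have close: "\<bar>g y - c w\<bar> \<le> e'" if w: "w \<in> sg_words N n" and y: "y \<in> cell w" for w y
      proof -
        have "sg_word_map p w (p 1) \<in> cell w" using w by (intro vertex_in_cell) (auto simp: sg_words_def)
        from n0[rule_format, OF n w y this] show ?thesis by (simp add: c_def)
      qed
      have 1: "\<bar>(\<integral>y. g y \<partial>nu x) - (\<Sum>w\<in>sg_words N n. c w * mass x w)\<bar> \<le> e' * mass x []"
        by (rule cm_integral_close[OF weight cm int close])
      have "\<bar>D n - (\<Sum>w\<in>sg_words N n. c w * mass x w)\<bar> \<le> (\<Sum>w\<in>sg_words N n. e' * mass x w)"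
        unfolding D sum_subtractf[symmetric]
      proof (rule order_trans[OF sum_abs], rule sum_mono)
        fix w assume w: "w \<in> sg_words N n"
        then have wS: "set w \<subseteq> S" "length w = n" by (auto simp: sg_words_def)
        define d where "d = (\<lambda>i j. (vals h w i - vals h w j)\<^sup>2)"
        have m: "mass x w = rr ^ n * (\<Sum>i\<in>S. \<Sum>j\<in>S. d i j)"
          unfolding x_def mass_harmonic[OF h wS(1)] wS(2) vertex_energy_def d_def by simp
        have "rr ^ n * ((1/2) * (\<Sum>i\<in>S. \<Sum>j\<in>S. d i j * (vals g w i + vals g w j))) - c w * mass x w
           = rr ^ n * (\<Sum>i\<in>S. \<Sum>j\<in>S. d i j * ((vals g w i - c w + (vals g w j - c w)) / 2))"
          unfolding m sum_distrib_left sum_subtractf[symmetric]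
          by (intro sum.cong refl) (simp add: field_simps)
        also have "\<bar>\<dots>\<bar> \<le> rr ^ n * (\<Sum>i\<in>S. \<Sum>j\<in>S. d i j * e')"
        proof -
          have "\<bar>\<Sum>i\<in>S. \<Sum>j\<in>S. d i j * ((vals g w i - c w + (vals g w j - c w)) / 2)\<bar> \<le> (\<Sum>i\<in>S. \<Sum>j\<in>S. d i j * e')"
          proof (rule order_trans[OF sum_abs], rule sum_mono, rule order_trans[OF sum_abs], rule sum_mono)
            fix i j assume ij: "i \<in> S" "j \<in> S"
            have "\<bar>vals g w i - c w\<bar> \<le> e'" "\<bar>vals g w j - c w\<bar> \<le> e'"
              using ij by (auto intro!: close[OF w] vertex_in_gasket)
            then have "\<bar>(vals g w i - c w + (vals g w j - c w)) / 2\<bar> \<le> e'"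
              using abs_triangle_ineq[of "vals g w i - c w" "vals g w j - c w"] by simp
            then show "\<bar>d i j * ((vals g w i - c w + (vals g w j - c w)) / 2)\<bar> \<le> d i j * e'"
              unfolding abs_mult d_def
              by (simp only: abs_power2, intro mult_left_mono) simp_all
          qed
          then show ?thesis unfolding abs_mult by (simp add: mult_left_mono)
        qed
        also have "\<dots> = e' * mass x w"
          by (simp add: m sum_distrib_left sum_distrib_right algebra_simps)
        finally show "\<bar>rr ^ n * ((1/2) * (\<Sum>i\<in>S. \<Sum>j\<in>S. (vals h w i - vals h w j)\<^sup>2 * (vals g w i + vals g w j))) - c w * mass x w\<bar> \<le> e' * mass x w"
          by (simp add: d_def)
      qed
      also have "\<dots> = e' * mass x []"
        using weight_sum_words[OF weight, of "[]" n] by (simp add: sum_distrib_left[symmetric])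
      finally have "\<bar>D n - (\<integral>y. g y \<partial>nu x)\<bar> \<le> 2 * (e' * mass x [])" using 1 by linarith
      also have "\<dots> < e" using mp \<open>e > 0\<close> by (simp add: e'_def field_simps)
      finally show ?thesis by simp
    qed
    then show "\<exists>n0. \<forall>n\<ge>n0. norm (D n - (\<integral>y. g y \<partial>nu x)) < e" by blast
  qed
  show ?thesis
    unfolding x_def[symmetric] has_bochner_integral_iff
    using int LIMSEQ_unique[OF lim2 lim1] by simp
qed

lemma const_domain: "(\<lambda>x. if x \<in> K then 1 else 0) \<in> sg_domain N p"
proof -
  let ?f = "\<lambda>x. if x \<in> K then 1 else 0 :: real"
  have "continuous_on K ?f" by (subst continuous_on_cong[of K K _ "\<lambda>_. 1"]) auto
  moreover have "sg_level_energy N p ?f m = 0" for m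
  proof -
    have "vertex_energy (vals ?f w) = 0" if "w \<in> sg_words N m" for w
      unfolding vertex_energy_def using that
      by (simp add: sg_words_def word_map_in_gasket vertex_in_gasket)
    then show ?thesis by (simp add: level_energy_eq)
  qed
  ultimately show ?thesis by (auto simp: domain_iff sg_continuous_def)
qed

lemma spline_uniform:
  assumes "f \<in> sg_continuous N p" "e > 0"
  shows "\<exists>n. \<forall>x\<in>K. \<bar>spline n f x - f x\<bar> \<le> e"
proof -
  have "continuous_on K f" using assms by (simp add: sg_continuous_def)
  from cells_osc[OF this assms(2)] obtain n where
    n: "\<forall>w\<in>sg_words N n. \<forall>x\<in>cell w. \<forall>y\<in>cell w. \<bar>f x - f y\<bar> < e" by auto
  have "\<bar>spline n f (pt \<omega>) - f (pt \<omega>)\<bar> \<le> e" if \<omega>: "\<omega> \<in> addr" for \<omega>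
  proof (rule spline_close[OF \<omega>])
    fix i assume "i \<in> S"
    then have "sg_word_map p (initial n \<omega>) (p i) \<in> cell (initial n \<omega>)"
      using vertex_in_cell[OF set_initial[OF \<omega>]] by blast
    moreover have "pt \<omega> \<in> cell (initial n \<omega>)" unfolding cell_eq[OF set_initial[OF \<omega>]] using \<omega> by auto
    ultimately show "\<bar>f (sg_word_map p (initial n \<omega>) (p i)) - f (pt \<omega>)\<bar> \<le> e"
      using n initial_in_words[OF \<omega>, of n] less_imp_le by blast
  qed
  then show ?thesis unfolding gasket_eq by blast
qed

text \<open>
  Interpolants lie in the domain of the energy and approximate every continuous function
  uniformly, so the integrals of continuous functions agree; indicators of open sets are limits of
  such functions.
\<close>

lemma measure_eq_domain:
  assumes s: "sets \<mu> = sets (sg_borel N p)" "sets \<nu> = sets (sg_borel N p)"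
    and eq: "\<And>g. g \<in> sg_domain N p \<Longrightarrow> \<exists>c. has_bochner_integral \<mu> g c \<and> has_bochner_integral \<nu> g c"
  shows "\<mu> = \<nu>"
proof -
  have sp: "space \<mu> = K" "space \<nu> = K"
    using s[THEN sets_eq_imp_space_eq] by (simp_all add: space_sg_borel)
  have fin: "finite_measure M" if "space M = K" "has_bochner_integral M (\<lambda>x. if x \<in> K then 1 else 0 :: real) c" for M c
  proof (rule finite_measureI)
    have "integrable M (indicator (space M) :: 'a \<Rightarrow> real) = integrable M (\<lambda>x. if x \<in> K then 1 else 0 :: real)"
      by (rule Bochner_Integration.integrable_cong) (auto simp: that(1) indicator_def)
    then have "integrable M (indicator (space M) :: 'a \<Rightarrow> real)"
      using that(2) by (simp add: has_bochner_integral_iff)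
    then show "emeasure M (space M) \<noteq> \<infinity>" by (simp add: integrable_indicator_iff)
  qed
  have f1: "finite_measure \<mu>" "finite_measure \<nu>"
    using eq[OF const_domain] fin sp by blast+
  interpret M: finite_measure \<mu> by fact
  interpret N: finite_measure \<nu> by fact
  have cont: "(\<integral>x. f x \<partial>\<mu>) = (\<integral>x. f x \<partial>\<nu>)" if f: "f \<in> sg_continuous N p" for f
  proof -
    note int = integrable_continuous[OF f f1(1) s(1)] integrable_continuous[OF f f1(2) s(2)]
    define B where "B = measure \<mu> K + measure \<nu> K"
    have "\<bar>(\<integral>x. f x \<partial>\<mu>) - (\<integral>x. f x \<partial>\<nu>)\<bar> \<le> e" if "e > 0" for e
    proof -
      define e' where "e' = e / (B + 1)"
      have B0: "B \<ge> 0" by (simp add: B_def)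
      then have e': "e' > 0" using that by (simp add: e'_def)
      obtain n where n: "\<forall>x\<in>K. \<bar>spline n f x - f x\<bar> \<le> e'" using spline_uniform[OF f e'] by blast
      note g = spline_continuous[of n f]
      have close: "\<bar>(\<integral>x. spline n f x \<partial>M) - (\<integral>x. f x \<partial>M)\<bar> \<le> e' * measure M K"
        if M: "finite_measure M" "sets M = sets (sg_borel N p)" for M
      proof -
        interpret F: finite_measure M by fact
        have sp: "space M = K" using sets_eq_imp_space_eq[OF M(2)] by (simp add: space_sg_borel)
        note i = integrable_continuous[OF g M] integrable_continuous[OF f M]
        have "\<bar>(\<integral>x. spline n f x \<partial>M) - (\<integral>x. f x \<partial>M)\<bar> = \<bar>\<integral>x. spline n f x - f x \<partial>M\<bar>"
          using i by simp
        also have "\<dots> \<le> (\<integral>x. e' \<partial>M)"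
          by (rule order_trans[OF integral_abs_bound], rule integral_mono)
             (use i n in \<open>auto simp: sp\<close>)
        finally show ?thesis by (simp add: sp mult.commute)
      qed
      have "(\<integral>x. spline n f x \<partial>\<mu>) = (\<integral>x. spline n f x \<partial>\<nu>)"
        using eq[OF energy_spline(2)[of n f]] by (auto simp: has_bochner_integral_iff)
      then have "\<bar>(\<integral>x. f x \<partial>\<mu>) - (\<integral>x. f x \<partial>\<nu>)\<bar> \<le> e' * B"
        using close[OF f1(1) s(1)] close[OF f1(2) s(2)] by (simp add: B_def algebra_simps)
      also have "\<dots> \<le> e" using B0 that by (simp add: e'_def field_simps)
      finally show ?thesis .
    qed
    then have "\<bar>(\<integral>x. f x \<partial>\<mu>) - (\<integral>x. f x \<partial>\<nu>)\<bar> \<le> 0" by (rule field_le_epsilon) simp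
    then show ?thesis by simp
  qed
  show ?thesis
  proof (rule measure_eq_open[OF s])
    show "emeasure \<mu> K \<noteq> \<infinity>" using M.emeasure_finite[of K] by simp
    fix U :: "'a set" assume U: "open U"
    define f where "f = (\<lambda>n x. if x \<in> K then (if U = UNIV then 1 else min 1 (real n * infdist x (- U))) else 0 :: real)"
    have fc: "f n \<in> sg_continuous N p" for n
    proof -
      have "continuous_on K (\<lambda>x. if U = UNIV then 1 else min 1 (real n * infdist x (- U)))"
        by (cases "U = UNIV") (auto intro!: continuous_intros)
      then have "continuous_on K (f n)"
        by (rule continuous_on_cong[THEN iffD1, rotated -1]) (auto simp: f_def)
      then show ?thesis by (simp add: sg_continuous_def f_def)
    qed
    have lim: "(\<lambda>n. f n x) \<longlonglongrightarrow> indicator (K \<inter> U) x" if x: "x \<in> K" for x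
    proof (cases "U = UNIV \<or> x \<notin> U")
      case True
      then have "f n x = indicator (K \<inter> U) x" for n using x by (auto simp: f_def)
      then show ?thesis by simp
    next
      case False
      then have "infdist x (- U) > 0"
        using U by (intro infdist_pos_not_in_closed) auto
      then obtain n0 where n0: "real n0 * infdist x (- U) > 1"
        using reals_Archimedean3 by blast
      have "f n x = indicator (K \<inter> U) x" if "n \<ge> n0" for n
      proof -
        have "real n0 * infdist x (- U) \<le> real n * infdist x (- U)"
          using that by (intro mult_right_mono) (auto simp: infdist_nonneg)
        then show ?thesis using False x n0 by (simp add: f_def)
      qed
      then show ?thesis by (intro tendsto_eventually) (auto simp: eventually_sequentially)
    qed
    have conv: "(\<lambda>n. \<integral>x. f n x \<partial>M) \<longlonglongrightarrow> measure M (K \<inter> U)"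
      if M: "finite_measure M" "sets M = sets (sg_borel N p)" for M
    proof -
      interpret F: finite_measure M by fact
      have sp: "space M = K" using sets_eq_imp_space_eq[OF M(2)] by (simp add: space_sg_borel)
      have KU: "K \<inter> U \<in> sets M" using open_sets[OF U] M(2) by simp
      have "(\<lambda>n. \<integral>x. f n x \<partial>M) \<longlonglongrightarrow> (\<integral>x. indicator (K \<inter> U) x \<partial>M)"
      proof (rule integral_dominated_convergence[where w = "\<lambda>_. 1"])
        show "f n \<in> borel_measurable M" for n
          using integrable_continuous[OF fc M] by (rule borel_measurable_integrable)
        show "AE x in M. norm (f n x) \<le> 1" for n
          by (auto simp: f_def infdist_nonneg)
      qed (use lim KU sp in auto)
      then show ?thesis using KU sets.sets_into_space[OF KU] by (simp add: Int_absorb2)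
    qed
    have "measure \<mu> (K \<inter> U) = measure \<nu> (K \<inter> U)"
      using LIMSEQ_unique[OF conv[OF f1(1) s(1)]] conv[OF f1(2) s(2)] cont[OF fc] by auto
    then show "emeasure \<mu> (K \<inter> U) = emeasure \<nu> (K \<inter> U)"
      by (simp add: M.emeasure_eq_measure N.emeasure_eq_measure)
  qed
qed

lemma energy_measure_eq:
  assumes "h \<in> sg_harmonic N p" shows "sg_energy_measure N p h = nu (boundary h)"
  unfolding sg_energy_measure_def
proof (rule the_equality)
  have "sets (nu (boundary h)) = sets (sg_borel N p)"
    using nu[OF balanced_centre] by (simp add: cell_measure_def)
  then show *: "sets (nu (boundary h)) = sets (sg_borel N p) \<and>
    (\<forall>g\<in>sg_domain N p. has_bochner_integral (nu (boundary h)) g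
      (2 * sg_form N p h (\<lambda>x. h x * g x) - sg_form N p (\<lambda>x. (h x)\<^sup>2) g))"
    using energy_measure_identity[OF assms] by blast
  fix \<mu> assume "sets \<mu> = sets (sg_borel N p) \<and>
    (\<forall>g\<in>sg_domain N p. has_bochner_integral \<mu> g
      (2 * sg_form N p h (\<lambda>x. h x * g x) - sg_form N p (\<lambda>x. (h x)\<^sup>2) g))"
  with * show "\<mu> = nu (boundary h)" by (intro measure_eq_domain) blast+
qed

section \<open>Null sets of energy measures\<close>

lemma balanced_combination: "balanced x \<Longrightarrow> balanced y \<Longrightarrow> balanced (\<lambda>j. x j + c * y j)"
  by (simp add: balanced_def sum.distrib sum_distrib_left[symmetric])

lemma balanced_minus: "balanced x \<Longrightarrow> balanced (\<lambda>j. (-1) * x j)"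
  by (simp add: balanced_def sum_negf)

lemma nu_sets: "balanced x \<Longrightarrow> sets (nu x) = sets (sg_borel N p)"
  using nu by (simp add: cell_measure_def)

lemma nu_space: "balanced x \<Longrightarrow> space (nu x) = K"
  using cm_space[OF cell_weight_mass nu] .

lemma nu_cell: "balanced x \<Longrightarrow> set w \<subseteq> S \<Longrightarrow> emeasure (nu x) (cell w) = ennreal (mass x w)"
  using nu by (simp add: cell_measure_def)

lemma nu_cell_measure: "balanced x \<Longrightarrow> set w \<subseteq> S \<Longrightarrow> measure (nu x) (cell w) = mass x w"
  by (simp add: measure_def nu_cell mass_nonneg)

lemma nu_finite: "balanced x \<Longrightarrow> finite_measure (nu x)"
  using cm_finite[OF cell_weight_mass nu] .

lemma nu_minus: "nu (\<lambda>j. (-1) * x j) = nu x"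
proof -
  have "mass (\<lambda>j. (-1) * x j) = mass x" by (rule ext) (simp only: mass_scale, simp)
  then show ?thesis unfolding nu_def by (rule arg_cong)
qed

text \<open>
  Both sides are measures with the same cell masses.
\<close>

lemma nu_identity:
  fixes I J :: "nat set"
  assumes I: "finite I" "finite J" and bal: "\<And>i. i \<in> I \<Longrightarrow> balanced (x i)" "\<And>j. j \<in> J \<Longrightarrow> balanced (y j)"
    and nn: "\<And>i. i \<in> I \<Longrightarrow> 0 \<le> c i" "\<And>j. j \<in> J \<Longrightarrow> 0 \<le> d j"
    and eq: "\<And>w. (\<Sum>i\<in>I. c i * mass (x i) w) = (\<Sum>j\<in>J. d j * mass (y j) w)"
    and A: "A \<in> sets (sg_borel N p)"
  shows "(\<Sum>i\<in>I. c i * measure (nu (x i)) A) = (\<Sum>j\<in>J. d j * measure (nu (y j)) A)"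
proof -
  define m where "m = (\<lambda>w. \<Sum>i\<in>I. c i * mass (x i) w)"
  have weight: "cell_weight m"
    unfolding cell_weight_def
  proof (intro allI impI conjI)
    fix w :: "nat list" assume w: "set w \<subseteq> S"
    show "0 \<le> m w" unfolding m_def by (intro sum_nonneg mult_nonneg_nonneg nn mass_nonneg)
    have "(\<Sum>k\<in>S. m (w @ [k])) = (\<Sum>i\<in>I. c i * (\<Sum>k\<in>S. mass (x i) (w @ [k])))"
      unfolding m_def by (subst sum.swap) (simp add: sum_distrib_left)
    also have "\<dots> = m w" unfolding m_def using bal w by (intro sum.cong refl) (simp add: mass_append)
    finally show "(\<Sum>k\<in>S. m (w @ [k])) = m w" .
  qed
  define M where "M = (\<lambda>(I :: nat set) c x. measure_of K (sets (sg_borel N p)) (\<lambda>A. \<Sum>i\<in>I. ennreal (c i) * emeasure (nu (x i)) A))"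
  have em: "emeasure (M I c x) B = ennreal (\<Sum>i\<in>I. c i * measure (nu (x i)) B)"
    if "finite I" "\<And>i. i \<in> I \<Longrightarrow> balanced (x i)" "\<And>i. i \<in> I \<Longrightarrow> 0 \<le> c i" "B \<in> sets (sg_borel N p)"
    for I :: "nat set" and c :: "nat \<Rightarrow> real" and x B
  proof -
    have "emeasure (M I c x) B = (\<Sum>i\<in>I. ennreal (c i) * emeasure (nu (x i)) B)"
      unfolding M_def by (rule weighted_sum_measure) (simp_all add: nu_sets that)
    also have "\<dots> = (\<Sum>i\<in>I. ennreal (c i * measure (nu (x i)) B))"
    proof (rule sum.cong[OF refl])
      fix i assume i: "i \<in> I"
      interpret finite_measure "nu (x i)" using that(2)[OF i] by (rule nu_finite)
      show "ennreal (c i) * emeasure (nu (x i)) B = ennreal (c i * measure (nu (x i)) B)"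
        using that(3)[OF i] by (simp add: emeasure_eq_measure ennreal_mult')
    qed
    also have "\<dots> = ennreal (\<Sum>i\<in>I. c i * measure (nu (x i)) B)"
      using that by (intro sum_ennreal) auto
    finally show ?thesis .
  qed
  have sets_M: "sets (M I c x) = sets (sg_borel N p)" for I :: "nat set" and c :: "nat \<Rightarrow> real" and x
    unfolding M_def using sets.space_closed[of "sg_borel N p"] sets.sigma_sets_eq[of "sg_borel N p"]
    by (simp add: sets_measure_of space_sg_borel)
  have "cell_measure (M I c x) m"
    unfolding cell_measure_def using sets_M bal nn I
    by (auto simp: em cell_sets nu_cell_measure m_def)
  moreover have "cell_measure (M J d y) m"
    unfolding cell_measure_def using sets_M bal nn I
    by (auto simp: em cell_sets nu_cell_measure m_def eq)
  ultimately have "M I c x = M J d y" by (rule cell_measure_unique[OF weight])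
  then have "ennreal (\<Sum>i\<in>I. c i * measure (nu (x i)) A) = ennreal (\<Sum>j\<in>J. d j * measure (nu (y j)) A)"
    using em[of I x c A] em[of J y d A] I bal nn A by simp
  then show ?thesis
    by (subst (asm) ennreal_inj) (auto intro!: sum_nonneg mult_nonneg_nonneg nn)
qed

lemma nu_pencil:
  assumes bal: "balanced x" "balanced y" and t: "t \<ge> 0" and A: "A \<in> sets (sg_borel N p)"
  shows "measure (nu (\<lambda>j. x j + t * y j)) A + t / 2 * measure (nu (\<lambda>j. x j + (-1) * y j)) A
    = measure (nu x) A + t\<^sup>2 * measure (nu y) A + t / 2 * measure (nu (\<lambda>j. x j + 1 * y j)) A"
proof -
  define X where "X = (\<lambda>i::nat. if i = 0 then (\<lambda>j. x j + t * y j) else (\<lambda>j. x j + (-1) * y j))"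
  define Y where "Y = (\<lambda>i::nat. if i = 0 then x else if i = 1 then y else (\<lambda>j. x j + 1 * y j))"
  define c where "c = (\<lambda>i::nat. if i = 0 then 1 else t / 2)"
  define d where "d = (\<lambda>i::nat. if i = 0 then 1 else if i = 1 then t\<^sup>2 else t / 2)"
  have "(\<Sum>i\<in>{0,1}. c i * measure (nu (X i)) A) = (\<Sum>i\<in>{0,1,2}. d i * measure (nu (Y i)) A)"
  proof (rule nu_identity[OF _ _ _ _ _ _ _ A])
    show "balanced (X i)" "balanced (Y i)" for i
      using bal by (auto simp only: X_def Y_def balanced_combination split: if_split)
    show "(\<Sum>i\<in>{0,1}. c i * mass (X i) w) = (\<Sum>i\<in>{0,1,2}. d i * mass (Y i) w)" for w
      using mass_pencil[of x t y w] by (simp add: c_def d_def X_def Y_def)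
  qed (use t in \<open>auto simp: c_def d_def\<close>)
  then show ?thesis by (simp add: c_def d_def X_def Y_def)
qed

text \<open>
  The Cauchy--Schwarz inequality for the mutual energy measure, in the form obtained from
  nonnegativity of the measure of \<open>x \<plusminus> t y\<close>.
\<close>

lemma nu_cross_bound:
  assumes bal: "balanced x" "balanced y" and t: "t > 0" and A: "A \<in> sets (sg_borel N p)"
  shows "\<bar>measure (nu (\<lambda>j. x j + 1 * y j)) A - measure (nu (\<lambda>j. x j + (-1) * y j)) A\<bar>
     \<le> 2 * (measure (nu x) A / t + t * measure (nu y) A)"
proof -
  have "2 * (measure (nu x) A / t + t * measure (nu y) A) - (c - b) \<ge> 0"
    if "a \<ge> 0" "a + t / 2 * c = measure (nu x) A + t\<^sup>2 * measure (nu y) A + t / 2 * b" for a b c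
  proof -
    have "2 * (measure (nu x) A / t + t * measure (nu y) A) - (c - b)
        = (2 / t) * (measure (nu x) A + t\<^sup>2 * measure (nu y) A + t / 2 * b - t / 2 * c)"
      using t by (simp add: field_simps power2_eq_square)
    also have "\<dots> = (2 / t) * a" using that(2) by simp
    finally show ?thesis using t that(1) by simp
  qed
  note step = this
  have e: "(\<lambda>j. x j + 1 * ((-1) * y j)) = (\<lambda>j. x j + (-1) * y j)" "(\<lambda>j. x j + (-1) * ((-1) * y j)) = (\<lambda>j. x j + 1 * y j)"
    by auto
  show ?thesis
    using step[OF measure_nonneg nu_pencil[OF bal less_imp_le[OF t] A]]
      step[OF measure_nonneg, of _ A _ _, OF nu_pencil[OF bal(1) balanced_minus[OF bal(2)] less_imp_le[OF t] A, unfolded e nu_minus]]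
    by (simp only: abs_le_iff) linarith
qed

text \<open>
  The square of \<open>1 / (\<rho>\<^sup>2 (N + 1))\<close> enters through \<open>ip_product_le\<close>: the factor \<open>\<rho>\<^sup>2\<close> accounts for the
  two extra letters, and \<open>N + 1\<close> for the constant there.
\<close>

definition overlap :: real where "overlap = (1 / (rho\<^sup>2 * (real N + 1)))\<^sup>2 / 16"

lemma rho_ge_1: "rho \<ge> 1"
  using mult_mono[of 1 "real N + 1" 1 "real N + 3"] by simp

lemma overlap_pos: "overlap > 0"
  using rho_pos by (simp add: overlap_def)

text \<open>
  On \<open>E\<close> the mutual energy measure of \<open>x\<close> and \<open>y\<close> vanishes, because \<open>\<nu>\<^sub>x\<close> does. Some subcell
  \<open>w @ v\<close> with \<open>|v| \<le> 2\<close> has large mutual energy, which must come from the complement of \<open>E\<close>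
  and is bounded there by the measures of \<open>x\<close> and \<open>y\<close>.
\<close>

lemma nu_share_cell:
  assumes bal: "balanced x" "balanced y" and x: "ip x x \<noteq> 0"
    and E: "E \<in> sets (sg_borel N p)" "measure (nu x) E = 0" and w: "set w \<subseteq> S"
  shows "overlap * mass y w \<le> measure (nu y) (cell w - E)"
proof -
  interpret X: finite_measure "nu x" by (rule nu_finite[OF bal(1)])
  interpret Y: finite_measure "nu y" by (rule nu_finite[OF bal(2)])
  define P where "P = nu (\<lambda>j. x j + 1 * y j)"
  define Q where "Q = nu (\<lambda>j. x j + (-1) * y j)"
  have balPQ: "balanced (\<lambda>j. x j + 1 * y j)" "balanced (\<lambda>j. x j + (-1) * y j)"
    by (intro balanced_combination bal)+
  interpret P: finite_measure P unfolding P_def by (rule nu_finite[OF balPQ(1)])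
  interpret Q: finite_measure Q unfolding Q_def by (rule nu_finite[OF balPQ(2)])
  have sets: "sets (nu x) = sets (sg_borel N p)" "sets (nu y) = sets (sg_borel N p)"
    "sets P = sets (sg_borel N p)" "sets Q = sets (sg_borel N p)"
    by (simp_all only: P_def Q_def nu_sets bal balPQ)
  have diff_E: "measure P A = measure Q A" if A: "A \<in> sets (sg_borel N p)" "A \<subseteq> E" for A
  proof -
    have 0: "measure (nu x) A = 0"
      using X.finite_measure_mono[of A E] A E sets measure_nonneg[of "nu x" A] by simp
    have "\<bar>measure P A - measure Q A\<bar> \<le> e" if "e > 0" for e
    proof -
      define m where "m = measure (nu y) A"
      define t where "t = e / 2 / (m + 1)"
      have m: "m + 1 > 0" unfolding m_def by (rule add_nonneg_pos) auto
      then have t: "t > 0" "t * (m + 1) = e / 2"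
        using that t_def by (simp, metis less_irrefl nonzero_divide_eq_eq)
      have "\<bar>measure P A - measure Q A\<bar> \<le> 2 * (t * measure (nu y) A)"
        using nu_cross_bound[OF bal t(1) A(1)] 0 by (simp add: P_def Q_def)
      also have "\<dots> \<le> 2 * (t * (m + 1))" using t by (simp add: m_def)
      also have "\<dots> = e" by (simp add: t(2))
      finally show ?thesis .
    qed
    then have "\<bar>measure P A - measure Q A\<bar> \<le> 0" by (rule field_le_epsilon) simp
    then show ?thesis by simp
  qed
  define X' Y' where "X' = expands w x" and "Y' = expands w y"
  define a b where "a = ip X' X'" and "b = ip Y' Y'"
  have balXY: "balanced X'" "balanced Y'" unfolding X'_def Y'_def by (intro balanced_expands bal w)+
  have a: "a > 0" using ip_expands_ge[OF bal(1) w] ip_nonneg[of x] x by (simp add: a_def X'_def)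
  define R where "R = 2 * (real N + 1) / rho ^ length w"
  have R: "R > 0" using rho_pos by (simp add: R_def)
  have massx: "mass x w = R * a" and massy: "mass y w = R * b"
    by (simp_all add: mass_def R_def a_def b_def X'_def Y'_def)
  show ?thesis
  proof (cases "b = 0")
    case True
    then show ?thesis by (simp add: massy)
  next
    case False
    then have b: "b > 0" using ip_nonneg[of Y'] by (simp add: b_def)
    obtain v where v: "set v \<subseteq> S" "length v \<le> 2"
      "a * b \<le> (4 * (real N + 1))\<^sup>2 * (ip (expands v X') (expands v Y'))\<^sup>2"
      using ip_product_le[OF balXY] unfolding a_def b_def by blast
    define \<beta> where "\<beta> = ip (expands v X') (expands v Y')"
    define \<kappa> where "\<kappa> = 1 / (rho\<^sup>2 * (real N + 1))"
    have \<kappa>: "\<kappa> > 0" using rho_pos by (simp add: \<kappa>_def)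
    have "sqrt (a * b) \<le> sqrt ((4 * (real N + 1) * \<beta>)\<^sup>2)"
      using v(3) by (intro real_sqrt_le_mono) (simp add: \<beta>_def power_mult_distrib)
    then have \<beta>: "sqrt a * sqrt b \<le> 4 * (real N + 1) * \<bar>\<beta>\<bar>"
      by (simp add: real_sqrt_mult abs_mult)
    define C where "C = cell (w @ v)"
    have wv: "set (w @ v) \<subseteq> S" using w v by simp
    have C: "C \<in> sets (sg_borel N p)" unfolding C_def by (rule cell_sets[OF wv])
    have Cw: "C \<subseteq> cell w" unfolding C_def word_map_append image_comp[symmetric]
      by (intro image_mono cell_subset v)
    have cw: "cell w \<in> sets (sg_borel N p)" by (rule cell_sets[OF w])
    define D where "D = C - E"
    have D: "D \<in> sets (sg_borel N p)" "C \<inter> E \<in> sets (sg_borel N p)"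
      unfolding D_def using C E by auto
    have split: "measure M C = measure M (C \<inter> E) + measure M D"
      if "finite_measure M" "sets M = sets (sg_borel N p)" for M
    proof -
      interpret finite_measure M by fact
      have "C = (C \<inter> E) \<union> D" by (auto simp: D_def)
      then show ?thesis
        using finite_measure_Union[of "C \<inter> E" D] D that by (auto simp: D_def)
    qed
    have PQ: "measure P C = mass (\<lambda>j. x j + 1 * y j) (w @ v)"
      "measure Q C = mass (\<lambda>j. x j + (-1) * y j) (w @ v)"
      unfolding P_def Q_def C_def by (intro nu_cell_measure balPQ wv)+
    have "mass (\<lambda>j. x j + 1 * y j) (w @ v) - mass (\<lambda>j. x j + (-1) * y j) (w @ v) = measure P D - measure Q D"
      using split[OF P.finite_measure_axioms sets(3)] split[OF Q.finite_measure_axioms sets(4)] diff_E[OF D(2)]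
      unfolding PQ[symmetric] by simp
    then have pq: "measure P D - measure Q D = 4 * R / rho ^ length v * \<beta>"
      unfolding mass_polar by (simp add: R_def \<beta>_def X'_def Y'_def power_add)
    \<comment> \<open>With this \<open>t\<close> the term with \<open>measure (nu x)\<close> absorbs half of the lower bound.\<close>
    define t where "t = 4 * sqrt a / (\<kappa> * sqrt b)"
    have t: "t > 0" using a b \<kappa> by (simp add: t_def)
    define q where "q = measure (nu y) (cell w - E)"
    have cwE: "cell w - E \<in> sets (nu y)" using cw E sets by auto
    have "R * \<kappa> * (sqrt a * sqrt b) \<le> R * \<kappa> * (4 * (real N + 1) * \<bar>\<beta>\<bar>)"
      using R \<kappa> \<beta> by (intro mult_left_mono) auto
    also have "\<dots> = 4 * R / rho\<^sup>2 * \<bar>\<beta>\<bar>"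
    proof -
      have "R * (1 / (r * n)) * (4 * n * z) = 4 * R / r * z" if "n \<noteq> 0" for r n z :: real
        using that by simp
      note cancel = this
      show ?thesis unfolding \<kappa>_def by (rule cancel) simp
    qed
    also have "\<dots> \<le> 4 * R / rho ^ length v * \<bar>\<beta>\<bar>"
      using R rho_pos rho_ge_1 v(2)
      by (intro mult_right_mono divide_left_mono power_increasing mult_pos_pos zero_less_power) auto
    also have "\<dots> = \<bar>measure P D - measure Q D\<bar>"
      unfolding pq abs_mult using R rho_pos by simp
    also have "\<dots> \<le> 2 * (measure (nu x) D / t + t * measure (nu y) D)"
      using nu_cross_bound[OF bal t D(1)] by (simp add: P_def Q_def)
    also have "\<dots> \<le> 2 * (R * a / t + t * q)"
    proof -
      have "measure (nu x) D \<le> measure (nu x) (cell w)"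
        using Cw cw sets by (intro X.finite_measure_mono) (auto simp: D_def)
      then have "measure (nu x) D \<le> R * a" using nu_cell_measure[OF bal(1) w] massx by simp
      moreover have "measure (nu y) D \<le> q"
        unfolding q_def using Cw cwE by (intro Y.finite_measure_mono) (auto simp: D_def)
      ultimately show ?thesis using t by (intro mult_left_mono add_mono divide_right_mono) auto
    qed
    finally have main: "R * \<kappa> * (sqrt a * sqrt b) \<le> 2 * (R * a / t + t * q)" .
    define sa sb where "sa = sqrt a" and "sb = sqrt b"
    have s: "sa > 0" "sb > 0" "a = sa * sa" "b = sb * sb" using a b by (auto simp: sa_def sb_def)
    have "R * a / t = R * \<kappa> * (sa * sb) / 4"
      unfolding t_def s(3) using s(1,2) \<kappa> by (simp add: sa_def[symmetric] sb_def[symmetric] s(3)[symmetric] field_simps)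
    then have "R * \<kappa> * (sa * sb) / 4 \<le> t * q" using main by (simp add: sa_def sb_def)
    also have "t * q = 4 * sa * q / (\<kappa> * sb)" by (simp add: t_def sa_def sb_def)
    finally have "R * \<kappa> * (sa * sb) / 4 * (\<kappa> * sb) \<le> 4 * sa * q"
      using \<kappa> s by (simp add: pos_le_divide_eq)
    then have "sa * (R * \<kappa>\<^sup>2 * (sb * sb) / 4) \<le> sa * (4 * q)"
      by (simp add: power2_eq_square algebra_simps)
    then have "R * \<kappa>\<^sup>2 * b / 4 \<le> 4 * q" using s by (simp only: mult_le_cancel_left_pos)
    then show ?thesis
      unfolding massy q_def[symmetric] overlap_def \<kappa>_def[symmetric] by (simp add: algebra_simps)
  qed
qed

lemma nu_share_open:
  assumes bal: "balanced x" "balanced y" and x: "ip x x \<noteq> 0"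
    and E: "E \<in> sets (sg_borel N p)" "measure (nu x) E = 0" and U: "open U"
  shows "ennreal overlap * emeasure (nu y) (K \<inter> U) \<le> emeasure (nu y) (K \<inter> U - E)"
proof -
  interpret Y: finite_measure "nu y" by (rule nu_finite[OF bal(2)])
  have s: "sets (nu y) = sets (sg_borel N p)" by (rule nu_sets[OF bal(2)])
  have Ks: "K \<in> sets (nu y)" "K - E \<in> sets (nu y)" using E(1) s by (auto simp: sets_sg_borel)
  note cells = emeasure_inner_cells[OF cell_weight_mass[OF bal(2)] nu[OF bal(2)]]
  have "ennreal overlap * emeasure (nu y) (K \<inter> (\<Union>w\<in>inner_cells n U. cell w))
      \<le> emeasure (nu y) ((K - E) \<inter> (\<Union>w\<in>inner_cells n U. cell w))" for n
    unfolding cells[OF Ks(1)] cells[OF Ks(2)] sum_distrib_left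
  proof (rule sum_mono)
    fix w assume "w \<in> inner_cells n U"
    then have w: "set w \<subseteq> S" by (simp add: inner_cells_def sg_words_def)
    have i: "K \<inter> cell w = cell w" "(K - E) \<inter> cell w = cell w - E"
      using cell_subset[OF w] by blast+
    have "ennreal (overlap * mass y w) \<le> ennreal (measure (nu y) (cell w - E))"
      by (intro ennreal_leI nu_share_cell[OF bal x E w])
    then show "ennreal overlap * emeasure (nu y) (K \<inter> cell w) \<le> emeasure (nu y) ((K - E) \<inter> cell w)"
      unfolding i nu_cell[OF bal(2) w] unfolding Y.emeasure_eq_measure
      using overlap_pos by (simp add: ennreal_mult' mass_nonneg)
  qed
  then have "ennreal overlap * (SUP n. emeasure (nu y) (K \<inter> (\<Union>w\<in>inner_cells n U. cell w)))
      \<le> (SUP n. emeasure (nu y) ((K - E) \<inter> (\<Union>w\<in>inner_cells n U. cell w)))"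
    unfolding SUP_mult_left_ennreal by (intro SUP_mono) auto
  then have "ennreal overlap * emeasure (nu y) (K \<inter> U) \<le> emeasure (nu y) ((K - E) \<inter> U)"
    unfolding emeasure_open_SUP[OF s U Ks(1)] emeasure_open_SUP[OF s U Ks(2)] .
  moreover have "(K - E) \<inter> U = K \<inter> U - E" by auto
  ultimately show ?thesis by simp
qed

text \<open>
  Cover \<open>E\<close> by an open set of almost the same measure; a fixed fraction of this open set lies
  outside \<open>E\<close>.
\<close>

lemma nu_null_transfer:
  assumes bal: "balanced x" "balanced y" and x: "ip x x \<noteq> 0"
    and E: "E \<in> sets (sg_borel N p)" "emeasure (nu x) E = 0"
  shows "emeasure (nu y) E = 0"
proof -
  interpret Y: finite_measure "nu y" by (rule nu_finite[OF bal(2)])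
  have s: "sets (nu y) = sets (sg_borel N p)" by (rule nu_sets[OF bal(2)])
  have EK: "E \<subseteq> K" "E \<in> sets borel" using E by (auto simp: sets_sg_borel)
  \<comment> \<open>Outer regularity is stated for Borel measures on the whole space.\<close>
  define M where "M = distr (nu y) borel (\<lambda>z. z)"
  have "(\<lambda>z. z) \<in> measurable (sg_borel N p) borel"
    unfolding sg_borel_def by (rule measurable_restrict_space1) simp
  then have id: "(\<lambda>z. z) \<in> measurable (nu y) borel"
    by (simp only: measurable_cong_sets[OF s refl])
  have M: "emeasure M A = emeasure (nu y) (K \<inter> A)" if "A \<in> sets borel" for A
    unfolding M_def using that id by (subst emeasure_distr) (auto simp: nu_space[OF bal(2)] Int_commute)
  have "measure (nu y) E * overlap \<le> e" if "e > 0" for e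
  proof -
    have "emeasure M E = (INF U\<in>{U. E \<subseteq> U \<and> open U}. emeasure M U)"
      by (rule outer_regular) (auto simp: M_def EK emeasure_distr[OF id] Y.emeasure_eq_measure)
    moreover have "emeasure M E < emeasure M E + ennreal e"
      using that M[OF EK(2)] by (simp add: Y.emeasure_eq_measure ennreal_plus[symmetric] ennreal_less_iff del: ennreal_plus)
    ultimately have "(INF U\<in>{U. E \<subseteq> U \<and> open U}. emeasure M U) < emeasure M E + ennreal e" by simp
    then obtain U where U: "E \<subseteq> U" "open U" "emeasure M U < emeasure M E + ennreal e"
      unfolding INF_less_iff by blast
    have KU: "K \<inter> U \<in> sets (nu y)" using open_sets[OF U(2)] s by simp
    have KE: "K \<inter> E = E" using EK by auto
    have "measure (nu y) (K \<inter> U) < measure (nu y) E + e"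
      using U M[OF EK(2)] M[of U] that
      by (simp add: KE Y.emeasure_eq_measure ennreal_plus[symmetric] ennreal_less_iff del: ennreal_plus)
    moreover have "measure (nu y) (K \<inter> U - E) = measure (nu y) (K \<inter> U) - measure (nu y) E"
      using KU E s U EK by (intro Y.finite_measure_Diff) auto
    ultimately have "measure (nu y) (K \<inter> U - E) \<le> e" by simp
    moreover have "overlap * measure (nu y) (K \<inter> U) \<le> measure (nu y) (K \<inter> U - E)"
      using nu_share_open[OF bal x E(1) _ U(2)] E(2) overlap_pos
      by (simp add: Y.emeasure_eq_measure ennreal_mult'[symmetric] measure_def[of "nu x"])
    moreover have "measure (nu y) E \<le> measure (nu y) (K \<inter> U)"
      using U EK KU by (intro Y.finite_measure_mono) auto
    ultimately show ?thesis
      using mult_left_mono[OF _ less_imp_le[OF overlap_pos], of "measure (nu y) E" "measure (nu y) (K \<inter> U)"]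
      by (simp add: mult.commute)
  qed
  then have "measure (nu y) E * overlap \<le> 0" by (rule field_le_epsilon) simp
  then have "measure (nu y) E = 0"
    using overlap_pos measure_nonneg[of "nu y" E] by (simp add: mult_le_0_iff)
  then show ?thesis by (simp add: Y.emeasure_eq_measure)
qed

section \<open>The Kusuoka measure and the density\<close>

abbreviation kus :: "'a measure" where "kus \<equiv> sg_kusuoka N p"

abbreviation basis :: "nat \<Rightarrow> nat \<Rightarrow> real" where
  "basis k \<equiv> boundary (sg_basis_harmonic N p k)"

lemma basis_vals: "j \<in> S \<Longrightarrow> basis k j = centre (\<lambda>i. if i = k then 1 else 0) j"
  unfolding centre_def by (simp add: basis_harmonic(2) cong: sum.cong)

lemma basis_ip:
  "set w \<subseteq> S \<Longrightarrow> ip (expands w (basis k)) (expands w (basis k))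
    = ip (expands w (centre (\<lambda>i. if i = k then 1 else 0))) (expands w (centre (\<lambda>i. if i = k then 1 else 0)))"
  unfolding ip_def by (intro sum.cong refl arg_cong2[of _ _ _ _ "(*)"] expands_cong basis_vals)

lemma basis_nonzero: "ip (basis 1) (basis 1) \<noteq> 0"
proof
  assume "ip (basis 1) (basis 1) = 0"
  from ip_eq_0D[OF this one_in_S] have "centre (\<lambda>i. if i = 1 then 1 else 0) 1 = 0"
    using basis_vals[of 1 1] by simp
  then show False using N_ge_2 by (simp add: centre_def)
qed

lemma kus_sets: "sets kus = sets (sg_borel N p)"
  unfolding sg_kusuoka_def using sets.space_closed[of "sg_borel N p"] sets.sigma_sets_eq[of "sg_borel N p"]
  by (simp add: sets_measure_of space_sg_borel)

lemma kus_space: "space kus = K"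
  using sets_eq_imp_space_eq[OF kus_sets] by (simp add: space_sg_borel)

lemma kus_emeasure:
  assumes "A \<in> sets (sg_borel N p)" shows "emeasure kus A = (\<Sum>k\<in>S. emeasure (nu (basis k)) A)"
proof -
  have "sg_energy_measure N p (sg_basis_harmonic N p k) = nu (basis k)" for k
    by (rule energy_measure_eq[OF basis_harmonic(1)])
  then have "kus = measure_of K (sets (sg_borel N p)) (\<lambda>A. \<Sum>k\<in>S. 1 * emeasure (nu (basis k)) A)"
    by (simp add: sg_kusuoka_def)
  then show ?thesis
    using weighted_sum_measure[of S "\<lambda>k. nu (basis k)" A "\<lambda>_. 1"] assms by (simp add: nu_sets balanced_centre)
qed

lemma kus_cell: "set w \<subseteq> S \<Longrightarrow> emeasure kus (cell w) = ennreal (\<Sum>k\<in>S. mass (basis k) w)"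
  by (simp add: kus_emeasure cell_sets nu_cell balanced_centre mass_nonneg)

lemma kus_finite: "finite_measure kus"
  by (rule finite_measureI) (use kus_cell[of "[]"] in \<open>simp add: kus_space\<close>)

lemma mass_le_kus:
  assumes "balanced x" "set w \<subseteq> S" shows "mass x w \<le> ip x x * (\<Sum>k\<in>S. mass (basis k) w)"
proof -
  have "mass x w \<le> 2 * (real N + 1) / rho ^ length w * (ip x x * (\<Sum>k\<in>S. ip (expands w (basis k)) (expands w (basis k))))"
    unfolding mass_def using rho_pos ip_expands_le_basis[OF assms] basis_ip[OF assms(2)]
    by (intro mult_left_mono) auto
  then show ?thesis by (simp add: mass_def sum_distrib_left algebra_simps)
qed

lemma kus_null_iff:
  assumes "balanced x" "ip x x \<noteq> 0" "E \<in> sets (sg_borel N p)"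
  shows "emeasure kus E = 0 \<longleftrightarrow> emeasure (nu x) E = 0"
proof
  assume "emeasure kus E = 0"
  then have "emeasure (nu (basis 1)) E = 0" by (simp add: kus_emeasure[OF assms(3)])
  then show "emeasure (nu x) E = 0"
    using nu_null_transfer[OF balanced_centre assms(1) basis_nonzero assms(3)] by blast
next
  assume "emeasure (nu x) E = 0"
  then show "emeasure kus E = 0"
    using nu_null_transfer[OF assms(1) balanced_centre assms(2,3)] by (simp add: kus_emeasure[OF assms(3)])
qed

text \<open>
  In a cell inside \<open>U\<close>, the function \<open>g\<close> whose restriction to the cell has the boundary values
  provided by \<open>small_energy_ratio\<close> exists since the expansions are invertible, and its measure is
  bounded by a multiple of the Kusuoka measure on cells.
\<close>

lemma no_lower_bound:
  assumes bal: "balanced x" and x: "ip x x \<noteq> 0" and U: "open U" "x0 \<in> K \<inter> U" and c: "c > 0"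
  shows "\<exists>A\<in>sets (sg_borel N p). A \<subseteq> U \<and> emeasure (nu x) A < ennreal c * emeasure kus A"
proof -
  obtain n w where "w \<in> inner_cells n U"
    using U(2) inner_cells_exhaust(1)[OF U(1)] by blast
  then have w: "set w \<subseteq> S" "cell w \<subseteq> U" by (auto simp: inner_cells_def sg_words_def)
  have "balanced (expands w x)" "ip (expands w x) (expands w x) \<noteq> 0"
    using balanced_expands[OF bal w(1)] ip_expands_ge[OF bal w(1)] ip_nonneg[of x] x by auto
  from small_energy_ratio[OF this] obtain y where y: "balanced y"
    "\<And>e. e > 0 \<Longrightarrow> \<exists>v. set v \<subseteq> S \<and> ip (expands v y) (expands v y) > 0 \<and>
        ip (expands v (expands w x)) (expands v (expands w x)) \<le> e * ip (expands v y) (expands v y)"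
    by blast
  obtain g where g: "balanced g" "expands w g = y" using expands_surj[OF y(1) w(1)] by blast
  define e where "e = c / (2 * (ip g g + 1))"
  have gg: "ip g g \<ge> 0" by (rule ip_nonneg)
  have e: "e > 0" using c gg by (simp add: e_def)
  obtain v where v: "set v \<subseteq> S" "ip (expands v y) (expands v y) > 0"
        "ip (expands v (expands w x)) (expands v (expands w x)) \<le> e * ip (expands v y) (expands v y)"
    using y(2)[OF e] by blast
  have wv: "set (w @ v) \<subseteq> S" using w v by simp
  define k where "k = (\<Sum>k\<in>S. mass (basis k) (w @ v))"
  have "mass x (w @ v) \<le> 2 * (real N + 1) / rho ^ length (w @ v) * (e * ip (expands v y) (expands v y))"
    unfolding mass_def using rho_pos v(3) by (intro mult_left_mono) auto
  also have "\<dots> = e * mass g (w @ v)" by (simp add: mass_def g(2))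
  also have "\<dots> \<le> e * (ip g g * k)"
    unfolding k_def using e by (intro mult_left_mono mass_le_kus[OF g(1) wv]) auto
  finally have le: "mass x (w @ v) \<le> e * ip g g * k" by simp
  have "mass g (w @ v) > 0" using v(2) rho_pos by (simp add: mass_def g(2))
  then have "ip g g * k > 0" using mass_le_kus[OF g(1) wv] by (simp add: k_def)
  then have k: "k > 0" using gg by (simp add: zero_less_mult_iff)
  have "ip g g / (2 * (ip g g + 1)) < 1" using gg by simp
  then have "e * ip g g < c"
    using mult_strict_left_mono[OF _ c, of "ip g g / (2 * (ip g g + 1))" 1] by (simp add: e_def)
  then have "mass x (w @ v) < c * k" using le k by (meson mult_strict_right_mono order_le_less_trans)
  then have "emeasure (nu x) (cell (w @ v)) < ennreal c * emeasure kus (cell (w @ v))"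
    unfolding nu_cell[OF bal wv] kus_cell[OF wv] k_def[symmetric]
    using c k by (simp add: ennreal_mult'[symmetric] ennreal_less_iff mass_nonneg)
  moreover have "cell (w @ v) \<subseteq> U"
    using w(2) cell_subset[OF v(1)] unfolding word_map_append image_comp[symmetric] by blast
  ultimately show ?thesis using cell_sets[OF wv] by blast
qed

lemma nonconstant_boundary:
  assumes "h \<in> sg_harmonic N p" "\<not> h constant_on K" shows "ip (boundary h) (boundary h) \<noteq> 0"
proof
  assume "ip (boundary h) (boundary h) = 0"
  define c where "c = (\<Sum>k\<in>S. h (p k)) / (real N + 1)"
  have v: "vals h [] j = c" if "j \<in> S" for j
    using ip_eq_0D[OF \<open>ip _ _ = 0\<close> that] by (simp add: centre_def c_def)
  have "h (pt \<omega>) = c" if \<omega>: "\<omega> \<in> addr" for \<omega>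
  proof -
    have "h (pt \<omega>) = harm (vals h []) \<omega>"
      using fun_cong[OF harmonic_eq_spline[OF assms(1)], of "pt \<omega>"] \<omega> by (simp add: spline_pt interp_def)
    then show ?thesis using harm_bounds[of c "vals h []" c, OF _ _ \<omega>] v by (simp add: antisym)
  qed
  then have "h constant_on K" unfolding constant_on_def gasket_eq by blast
  with assms(2) show False by simp
qed

definition vanishing_nhds :: "(nat \<Rightarrow> real) \<Rightarrow> nat \<Rightarrow> 'a set set" where
  "vanishing_nhds x n = {U. open U \<and> (\<forall>A\<in>sets (sg_borel N p). A \<subseteq> U \<longrightarrow>
     emeasure (nu x) A \<le> ennreal (1 / real (Suc n)) * emeasure kus A)}"

text \<open>
  The points that have, for every \<open>\<epsilon> > 0\<close>, a neighbourhood on which the density is at most \<open>\<epsilon>\<close>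
  almost everywhere. This set does not depend on a version of the density.
\<close>

definition vanishing :: "(nat \<Rightarrow> real) \<Rightarrow> 'a set" where
  "vanishing x = (\<Inter>n. \<Union>(vanishing_nhds x n))"

lemma vanishing_borel: "vanishing x \<in> sets borel"
proof -
  have "open (\<Union>(vanishing_nhds x n))" for n
    by (intro open_Union) (simp add: vanishing_nhds_def)
  then show ?thesis unfolding vanishing_def by (intro sets.countable_INT') auto
qed

text \<open>
  Countably many of the neighbourhoods suffice; make them disjoint and add up.
\<close>

lemma vanishing_union:
  assumes bal: "balanced x" and A: "A \<in> sets (sg_borel N p)" "A \<subseteq> \<Union>(vanishing_nhds x n)"
  shows "emeasure (nu x) A \<le> ennreal (1 / real (Suc n)) * emeasure kus A"
proof -
  obtain F where F: "F \<subseteq> vanishing_nhds x n" "countable F" "\<Union>F = \<Union>(vanishing_nhds x n)"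
    using Lindelof[of "vanishing_nhds x n"] by (auto simp: vanishing_nhds_def)
  show ?thesis
  proof (cases "F = {}")
    case True
    then have "A = {}" using A(2) F(3) by auto
    then show ?thesis by simp
  next
    case False
    define U where "U = from_nat_into F"
    have rU: "range U = F" unfolding U_def by (rule range_from_nat_into[OF False F(2)])
    then have U: "U i \<in> vanishing_nhds x n" for i using F(1) by auto
    define D where "D = (\<lambda>i. A \<inter> disjointed U i)"
    have "disjointed U i \<in> sets borel" for i
      unfolding disjointed_def using U by (intro sets.Diff sets.finite_UN) (auto simp: vanishing_nhds_def)
    then have D: "D i \<in> sets (sg_borel N p)" for i using A(1) by (auto simp: D_def sets_sg_borel)
    have dis: "disjoint_family D"
      using disjoint_family_disjointed[of U] by (auto simp: D_def disjoint_family_on_def)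
    have un: "(\<Union>i. D i) = A"
      using A(2) F(3) rU UN_disjointed_eq[of U] by (auto simp: D_def)
    have "emeasure (nu x) A = (\<Sum>i. emeasure (nu x) (D i))"
      unfolding un[symmetric] using D dis nu_sets[OF bal] by (intro suminf_emeasure[symmetric]) auto
    also have "\<dots> \<le> (\<Sum>i. ennreal (1 / real (Suc n)) * emeasure kus (D i))"
    proof (rule suminf_le)
      fix i
      have "D i \<subseteq> U i" using disjointed_subset[of U i] by (auto simp: D_def)
      then show "emeasure (nu x) (D i) \<le> ennreal (1 / real (Suc n)) * emeasure kus (D i)"
        using U[of i] D[of i] unfolding vanishing_nhds_def by blast
    qed auto
    also have "\<dots> = ennreal (1 / real (Suc n)) * emeasure kus A"
      unfolding un[symmetric] ennreal_suminf_cmult using D dis kus_sets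
      by (subst suminf_emeasure) auto
    finally show ?thesis .
  qed
qed

lemma vanishing_null:
  assumes bal: "balanced x" and x: "ip x x \<noteq> 0"
  shows "emeasure kus (K \<inter> vanishing x) = 0"
proof -
  interpret finite_measure kus by (rule kus_finite)
  interpret X: finite_measure "nu x" by (rule nu_finite[OF bal])
  have V: "K \<inter> vanishing x \<in> sets (sg_borel N p)" using vanishing_borel by (simp add: sets_sg_borel)
  have "measure (nu x) (K \<inter> vanishing x) \<le> 1 / real (Suc n) * measure kus (K \<inter> vanishing x)" for n
  proof -
    have "K \<inter> vanishing x \<subseteq> \<Union>(vanishing_nhds x n)" by (auto simp: vanishing_def)
    from vanishing_union[OF bal V this] show ?thesis
      by (simp add: X.emeasure_eq_measure emeasure_eq_measure ennreal_mult'[symmetric])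
  qed
  moreover have "(\<lambda>n. 1 / real (Suc n) * measure kus (K \<inter> vanishing x)) \<longlonglongrightarrow> 0 * measure kus (K \<inter> vanishing x)"
    by (intro tendsto_intros) (use LIMSEQ_inverse_real_of_nat in \<open>simp add: inverse_eq_divide\<close>)
  ultimately have "measure (nu x) (K \<inter> vanishing x) \<le> 0"
    by (intro LIMSEQ_le_const[of "\<lambda>n. 1 / real (Suc n) * measure kus (K \<inter> vanishing x)"]) auto
  then have "emeasure (nu x) (K \<inter> vanishing x) = 0"
    by (simp add: X.emeasure_eq_measure measure_le_0_iff)
  then show ?thesis using kus_null_iff[OF bal x V] by simp
qed

lemma density_version:
  assumes h: "h \<in> sg_harmonic N p" and x: "ip (boundary h) (boundary h) \<noteq> 0"
    and \<phi>: "sg_density_version N p h \<phi>" and A: "A \<in> sets (sg_borel N p)"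
  shows "emeasure (nu (boundary h)) A = (\<integral>\<^sup>+y. ennreal (\<phi> y) * indicator A y \<partial>kus)"
proof -
  define \<nu> where "\<nu> = nu (boundary h)"
  note bal = balanced_centre[of "\<lambda>i. h (p i)"]
  interpret finite_measure kus by (rule kus_finite)
  have s: "sets \<nu> = sets kus" by (simp add: \<nu>_def nu_sets[OF bal] kus_sets)
  have ac: "absolutely_continuous kus \<nu>"
    unfolding absolutely_continuous_def
    using kus_null_iff[OF bal x] s by (auto simp: null_sets_def \<nu>_def kus_sets)
  have fin: "AE y in kus. RN_deriv kus \<nu> y \<noteq> \<infinity>"
    by (rule RN_deriv_finite[OF _ ac s])
       (simp add: \<nu>_def finite_measure.axioms(1)[OF nu_finite[OF bal]])
  have "AE y in kus. \<phi> y = enn2real (RN_deriv kus \<nu> y)"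
    using \<phi> energy_measure_eq[OF h] by (simp add: sg_density_version_def \<nu>_def)
  with fin have ae: "AE y in kus. RN_deriv kus \<nu> y = ennreal (\<phi> y)"
    by eventually_elim (simp add: less_top)
  have "emeasure \<nu> A = emeasure (density kus (RN_deriv kus \<nu>)) A"
    by (simp add: density_RN_deriv[OF ac s])
  also have "\<dots> = (\<integral>\<^sup>+y. RN_deriv kus \<nu> y * indicator A y \<partial>kus)"
    using A by (intro emeasure_density) (auto simp: kus_sets)
  also have "\<dots> = (\<integral>\<^sup>+y. ennreal (\<phi> y) * indicator A y \<partial>kus)"
    by (rule nn_integral_cong_AE) (use ae in eventually_elim, simp)
  finally show ?thesis by (simp add: \<nu>_def)
qed

text \<open>
  A positive value at a point of continuity would bound the density from below near it, against
  \<open>no_lower_bound\<close>; a value at most \<open>0\<close> would put the point into \<open>vanishing\<close>.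
\<close>

lemma density_discontinuous:
  assumes h: "h \<in> sg_harmonic N p" and x: "ip (boundary h) (boundary h) \<noteq> 0"
    and \<phi>: "sg_density_version N p h \<phi>" and x0: "x0 \<in> K" "x0 \<notin> vanishing (boundary h)"
  shows "\<not> continuous (at x0 within K) \<phi>"
proof
  assume cont: "continuous (at x0 within K) \<phi>"
  note bal = balanced_centre[of "\<lambda>i. h (p i)"]
  have nhd: "\<exists>U. open U \<and> x0 \<in> U \<and> (\<forall>y\<in>K \<inter> U. \<bar>\<phi> y - \<phi> x0\<bar> < e)" if e: "e > 0" for e
  proof -
    obtain d where d: "d > 0" "\<forall>y\<in>K. dist y x0 < d \<longrightarrow> dist (\<phi> y) (\<phi> x0) < e"
      using cont[unfolded continuous_within_eps_delta, rule_format, OF e] by blast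
    then show ?thesis by (intro exI[of _ "ball x0 d"]) (auto simp: dist_commute dist_real_def)
  qed
  show False
  proof (cases "\<phi> x0 > 0")
    case True
    define c where "c = \<phi> x0 / 2"
    have c: "c > 0" using True by (simp add: c_def)
    obtain U where U: "open U" "x0 \<in> U" "\<And>y. y \<in> K \<inter> U \<Longrightarrow> \<bar>\<phi> y - \<phi> x0\<bar> < c"
      using nhd[OF c] by blast
    have low: "c \<le> \<phi> y" if "y \<in> K \<inter> U" for y
      using U(3)[OF that] unfolding c_def abs_less_iff by linarith
    obtain A where A: "A \<in> sets (sg_borel N p)" "A \<subseteq> U" "emeasure (nu (boundary h)) A < ennreal c * emeasure kus A"
      using no_lower_bound[OF bal x U(1) _ c, of x0] x0 U by blast
    have "ennreal c * emeasure kus A = (\<integral>\<^sup>+y. ennreal c * indicator A y \<partial>kus)"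
      using A(1) by (simp add: kus_sets nn_integral_cmult_indicator)
    also have "\<dots> \<le> (\<integral>\<^sup>+y. ennreal (\<phi> y) * indicator A y \<partial>kus)"
      using A(2) low by (intro nn_integral_mono) (auto simp: kus_space indicator_def intro!: ennreal_leI)
    finally show False using A(3) density_version[OF h x \<phi> A(1)] by simp
  next
    case False
    have "x0 \<in> \<Union>(vanishing_nhds (boundary h) n)" for n
    proof -
      have pos: "1 / real (Suc n) > 0" by simp
      obtain U where U: "open U" "x0 \<in> U" "\<And>y. y \<in> K \<inter> U \<Longrightarrow> \<bar>\<phi> y - \<phi> x0\<bar> < 1 / real (Suc n)"
        using nhd[OF pos] by blast
      have up: "\<phi> y \<le> 1 / real (Suc n)" if "y \<in> K \<inter> U" for y
        using U(3)[OF that] False by (simp only: abs_less_iff) linarith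
      have "emeasure (nu (boundary h)) A \<le> ennreal (1 / real (Suc n)) * emeasure kus A"
        if A: "A \<in> sets (sg_borel N p)" "A \<subseteq> U" for A
      proof -
        have "(\<integral>\<^sup>+y. ennreal (\<phi> y) * indicator A y \<partial>kus) \<le> (\<integral>\<^sup>+y. ennreal (1 / real (Suc n)) * indicator A y \<partial>kus)"
          using A(2) up by (intro nn_integral_mono) (auto simp: kus_space indicator_def intro!: ennreal_leI)
        also have "\<dots> = ennreal (1 / real (Suc n)) * emeasure kus A"
          using A(1) by (simp only: kus_sets nn_integral_cmult_indicator)
        finally show ?thesis using density_version[OF h x \<phi> A(1)] by simp
      qed
      then show ?thesis using U by (auto simp: vanishing_nhds_def)
    qed
    then show False using x0(2) by (simp add: vanishing_def)
  qed
qed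

end

theorem theorem2p1:
  fixes N :: nat and p :: "nat \<Rightarrow> real ^ 'n" and h :: "real ^ 'n \<Rightarrow> real"
  assumes "N \<ge> 2" and "CARD('n) = N"
    and "sg_nondegenerate N p"
    and "h \<in> sg_harmonic N p"
    and "\<not> h constant_on sg_gasket N p"
  shows "\<exists>K'. K' \<in> sets borel \<and> K' \<subseteq> sg_gasket N p \<and>
           emeasure (sg_kusuoka N p) (sg_gasket N p - K') = 0 \<and>
           (\<forall>\<phi>. sg_density_version N p h \<phi> \<longrightarrow>
              (\<forall>x\<in>K'. \<not> continuous (at x within sg_gasket N p) \<phi>))"
proof -
  interpret sierpinski_gasket N p
    by unfold_locales (use assms in auto)
  have nz: "ip (boundary h) (boundary h) \<noteq> 0"
    by (rule nonconstant_boundary[OF assms(4,5)])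
  define K' where "K' = sg_gasket N p - vanishing (boundary h)"
  have "K' \<in> sets borel"
    unfolding K'_def using vanishing_borel by (intro sets.Diff gasket_borel)
  moreover have "sg_gasket N p - K' = sg_gasket N p \<inter> vanishing (boundary h)"
    by (auto simp: K'_def)
  then have "emeasure (sg_kusuoka N p) (sg_gasket N p - K') = 0"
    using vanishing_null[OF balanced_centre nz] by simp
  moreover have "\<not> continuous (at x within sg_gasket N p) \<phi>"
    if "sg_density_version N p h \<phi>" "x \<in> K'" for \<phi> x
    using density_discontinuous[OF assms(4) nz that(1)] that(2) by (simp add: K'_def)
  ultimately show ?thesis
    by (intro exI[of _ K']) (auto simp: K'_def)
qed

end
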